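(* Let $S$ be a smooth irreducible curve defined over $\mathbb{C}$. Let $\mathcal{A}\to S$ be an abelian scheme and let $\mathcal{C}$ be an irreducible curve in $\mathcal{A}$, not contained in any fiber $\mathcal{A}_s$, $s\in S$. Let $$\mathcal{C}^{\{1,\mathrm{ram}\}}=\bigcup_{s\in S}\mathcal{C}\cap_{\mathrm{sing}}\mathcal{A}_s .$$ Then $\mathcal{C}^{\{1,\mathrm{ram}\}}$ is a finite set.
   Context: For $s\in S$, $\mathcal{A}_s$ denotes the fiber of $\mathcal{A}\to S$ over $s$ (a closed subvariety of codimension 1). The set $\mathcal{C}\cap_{\mathrm{sing}}\mathcal{A}_s$ consists of the points of $\mathcal{C}\cap\mathcal{A}_s$ at which the intersection multiplicity of $\mathcal{C}$ and $\mathcal{A}_s$ is strictly greater than 1; at a smooth point $p$ of $\mathcal{C}$ this means that the tangent line of $\mathcal{C}$ at $p$ is contained in the tangent space of $\mathcal{A}_s$ at $p$. *)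

theory Defs
  imports
    Complex_Main
    "HOL-Analysis.Abstract_Topology"
    "HOL-Library.Extended_Nat"
    "HOL-Library.FuncSet"
    "HOL-Algebra.QuotRing"
    "HOL-Algebra.Ideal_Product"
    "HOL-Algebra.Embedded_Algebras"
begin

text \<open>
  Complex algebraic varieties in the style of Serre: a variety is its set of closed points with
  the Zariski topology and the sheaf of regular complex-valued functions.  This is equivalent to
  reduced separated schemes of finite type over the complex numbers.  No projective embedding
  is assumed.
\<close>

section \<open>Spaces with functions\<close>

text \<open>Sections are total functions of which only the values on the open set matter; \<open>reg X U f\<close> is
  meaningful only for open \<open>U\<close>.\<close>

record 'a fspace =
  zar :: "'a topology"
  reg :: "'a set \<Rightarrow> ('a \<Rightarrow> complex) \<Rightarrow> bool"

abbreviation points :: "'a fspace \<Rightarrow> 'a set"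
  where "points X \<equiv> topspace (zar X)"

definition space_with_functions :: "'a fspace \<Rightarrow> bool" where
  "space_with_functions X \<longleftrightarrow>
     (\<forall>U f g. openin (zar X) U \<longrightarrow> reg X U f \<longrightarrow> (\<forall>x\<in>U. g x = f x) \<longrightarrow> reg X U g) \<and>
     (\<forall>U c. openin (zar X) U \<longrightarrow> reg X U (\<lambda>_. c)) \<and>
     (\<forall>U f g. openin (zar X) U \<longrightarrow> reg X U f \<longrightarrow> reg X U g \<longrightarrow>
        reg X U (\<lambda>x. f x + g x) \<and> reg X U (\<lambda>x. f x * g x)) \<and>
     (\<forall>U V f. openin (zar X) U \<longrightarrow> openin (zar X) V \<longrightarrow> V \<subseteq> U \<longrightarrow> reg X U f \<longrightarrow> reg X V f) \<and>
     (\<forall>U f. openin (zar X) U \<longrightarrow>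
        (\<forall>p\<in>U. \<exists>V. openin (zar X) V \<and> p \<in> V \<and> V \<subseteq> U \<and> reg X V f) \<longrightarrow> reg X U f)"

definition morphism :: "'a fspace \<Rightarrow> 'b fspace \<Rightarrow> ('a \<Rightarrow> 'b) \<Rightarrow> bool" where
  "morphism X Y \<phi> \<longleftrightarrow>
     continuous_map (zar X) (zar Y) \<phi> \<and>
     (\<forall>V f. openin (zar Y) V \<longrightarrow> reg Y V f \<longrightarrow>
        reg X {x \<in> points X. \<phi> x \<in> V} (\<lambda>x. f (\<phi> x)))"

definition isomorphic :: "'a fspace \<Rightarrow> 'b fspace \<Rightarrow> bool" where
  "isomorphic X Y \<longleftrightarrow>
     (\<exists>\<phi> \<psi>. morphism X Y \<phi> \<and> morphism Y X \<psi> \<and>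
        (\<forall>x\<in>points X. \<psi> (\<phi> x) = x) \<and> (\<forall>y\<in>points Y. \<phi> (\<psi> y) = y))"

text \<open>The structure induced on a subset: regular functions are locally restrictions of regular
  functions of the ambient space.\<close>

definition induced :: "'a fspace \<Rightarrow> 'a set \<Rightarrow> 'a fspace" where
  "induced X Y =
     \<lparr>zar = subtopology (zar X) Y,
      reg = (\<lambda>V f. \<forall>p\<in>V. \<exists>U F. openin (zar X) U \<and> p \<in> U \<and> reg X U F \<and>
                     (\<forall>x\<in>U \<inter> V. f x = F x))\<rparr>"

section \<open>Affine varieties, products, varieties\<close>

text \<open>Polynomial functions in the coordinates \<open>x 0, \<dots>, x (n - 1)\<close>.\<close>

inductive_set poly_fun :: "nat \<Rightarrow> ((nat \<Rightarrow> complex) \<Rightarrow> complex) set" for n where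
  const: "(\<lambda>_. c) \<in> poly_fun n"
| coord: "i < n \<Longrightarrow> (\<lambda>x. x i) \<in> poly_fun n"
| add: "f \<in> poly_fun n \<Longrightarrow> g \<in> poly_fun n \<Longrightarrow> (\<lambda>x. f x + g x) \<in> poly_fun n"
| mult: "f \<in> poly_fun n \<Longrightarrow> g \<in> poly_fun n \<Longrightarrow> (\<lambda>x. f x * g x) \<in> poly_fun n"

definition algebraic_set :: "nat \<Rightarrow> (nat \<Rightarrow> complex) set \<Rightarrow> bool" where
  "algebraic_set n Z \<longleftrightarrow>
     (\<exists>F \<subseteq> poly_fun n. Z = {x \<in> {..<n} \<rightarrow>\<^sub>E UNIV. \<forall>f\<in>F. f x = 0})"

definition affine_fspace :: "nat \<Rightarrow> (nat \<Rightarrow> complex) set \<Rightarrow> (nat \<Rightarrow> complex) fspace" where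
  "affine_fspace n Z =
     (let T = topology_generated_by {{x \<in> Z. f x \<noteq> 0} | f. f \<in> poly_fun n} in
     \<lparr>zar = T,
      reg = (\<lambda>U f. \<forall>p\<in>U. \<exists>V. openin T V \<and> p \<in> V \<and> V \<subseteq> U \<and>
               (\<exists>g\<in>poly_fun n. \<exists>h\<in>poly_fun n. \<forall>x\<in>V. h x \<noteq> 0 \<and> f x = g x / h x))\<rparr>)"

definition affine_variety :: "'a fspace \<Rightarrow> bool" where
  "affine_variety X \<longleftrightarrow> (\<exists>n Z. algebraic_set n Z \<and> isomorphic X (affine_fspace n Z))"

definition prevariety :: "'a fspace \<Rightarrow> bool" where
  "prevariety X \<longleftrightarrow> space_with_functions X \<and>
     (\<exists>\<U>. finite \<U> \<and> \<Union>\<U> = points X \<and>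
        (\<forall>U\<in>\<U>. openin (zar X) U \<and> affine_variety (induced X U)))"

text \<open>Finite sums of products of a regular function on \<open>U\<close> and a regular function on \<open>V\<close>. The nonvanishing
  loci of such functions are a basis of the topology of the product variety, and regular functions on
  the product are locally quotients of such functions.\<close>

definition tensor_fun ::
  "'a fspace \<Rightarrow> 'b fspace \<Rightarrow> 'a set \<Rightarrow> 'b set \<Rightarrow> ('a \<times> 'b \<Rightarrow> complex) set" where
  "tensor_fun X Y U V =
     {(\<lambda>(x, y). \<Sum>i<k. a i x * b i y) | (k::nat) a b. \<forall>i<k. reg X U (a i) \<and> reg Y V (b i)}"

definition prod_fspace :: "'a fspace \<Rightarrow> 'b fspace \<Rightarrow> ('a \<times> 'b) fspace" where
  "prod_fspace X Y =
     \<lparr>zar = topology_generated_by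
        {{q \<in> U \<times> V. h q \<noteq> 0} | U V h.
           openin (zar X) U \<and> openin (zar Y) V \<and> h \<in> tensor_fun X Y U V},
      reg = (\<lambda>W f. \<forall>p\<in>W. \<exists>U V. openin (zar X) U \<and> openin (zar Y) V \<and> p \<in> U \<times> V \<and>
               (\<exists>g\<in>tensor_fun X Y U V. \<exists>h\<in>tensor_fun X Y U V. h p \<noteq> 0 \<and>
                  (\<forall>q\<in>W \<inter> U \<times> V. h q \<noteq> 0 \<longrightarrow> f q = g q / h q)))\<rparr>"

definition variety :: "'a fspace \<Rightarrow> bool" where
  "variety X \<longleftrightarrow> prevariety X \<and>
     closedin (zar (prod_fspace X X)) {(x, x) | x. x \<in> points X}"

definition fiber_prod ::
  "'a fspace \<Rightarrow> 'b fspace \<Rightarrow> ('a \<Rightarrow> 's) \<Rightarrow> ('b \<Rightarrow> 's) \<Rightarrow> ('a \<times> 'b) fspace" where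
  "fiber_prod X Y f g =
     induced (prod_fspace X Y) {(x, y). x \<in> points X \<and> y \<in> points Y \<and> f x = g y}"

definition fiber :: "'a fspace \<Rightarrow> ('a \<Rightarrow> 's) \<Rightarrow> 's \<Rightarrow> 'a set" where
  "fiber X f s = {x \<in> points X. f x = s}"

section \<open>Irreducibility and dimension\<close>

definition irreducible_top :: "'a topology \<Rightarrow> bool" where
  "irreducible_top T \<longleftrightarrow> topspace T \<noteq> {} \<and>
     (\<forall>A B. closedin T A \<longrightarrow> closedin T B \<longrightarrow> A \<union> B = topspace T \<longrightarrow>
        A = topspace T \<or> B = topspace T)"

text \<open>Krull dimension of a topological space (with value \<open>0\<close> on the empty space).\<close>

definition krull_dim :: "'a topology \<Rightarrow> enat" where
  "krull_dim T =
     Sup {enat n | n. \<exists>Z :: nat \<Rightarrow> 'a set.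
            (\<forall>i\<le>n. closedin T (Z i) \<and> irreducible_top (subtopology T (Z i))) \<and>
            (\<forall>i<n. Z i \<subset> Z (Suc i))}"

definition local_dim :: "'a fspace \<Rightarrow> 'a \<Rightarrow> enat" where
  "local_dim X p = Inf {krull_dim (subtopology (zar X) U) | U. openin (zar X) U \<and> p \<in> U}"

definition irreducible_curve :: "'a fspace \<Rightarrow> bool" where
  "irreducible_curve X \<longleftrightarrow> variety X \<and> irreducible_top (zar X) \<and> krull_dim (zar X) = 1"

text \<open>Curves in \<open>X\<close> are allowed to be locally closed; this includes the closed ones.\<close>

definition irreducible_curve_in :: "'a fspace \<Rightarrow> 'a set \<Rightarrow> bool" where
  "irreducible_curve_in X C \<longleftrightarrow>
     (\<exists>U F. openin (zar X) U \<and> closedin (zar X) F \<and> C = U \<inter> F) \<and>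
     irreducible_top (subtopology (zar X) C) \<and>
     krull_dim (subtopology (zar X) C) = 1"

section \<open>Local rings, intersection multiplicity, smoothness\<close>

text \<open>Functions that are regular in some neighbourhood of \<open>p\<close>. The local ring is the quotient by the
  functions vanishing in some neighbourhood of \<open>p\<close>, i.e. the ring of germs at \<open>p\<close>.\<close>

definition near_ring :: "'a fspace \<Rightarrow> 'a \<Rightarrow> ('a \<Rightarrow> complex) ring" where
  "near_ring X p =
     \<lparr>carrier = {f. \<exists>U. openin (zar X) U \<and> p \<in> U \<and> reg X U f},
      monoid.mult = (\<lambda>f g x. f x * g x), one = (\<lambda>_. 1),
      zero = (\<lambda>_. 0), add = (\<lambda>f g x. f x + g x)\<rparr>"

definition vanishing_near :: "'a fspace \<Rightarrow> 'a \<Rightarrow> 'a set \<Rightarrow> ('a \<Rightarrow> complex) set" where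
  "vanishing_near X p Y =
     {f \<in> carrier (near_ring X p). \<exists>U. openin (zar X) U \<and> p \<in> U \<and> (\<forall>x\<in>U \<inter> Y. f x = 0)}"

definition local_ring :: "'a fspace \<Rightarrow> 'a \<Rightarrow> ('a \<Rightarrow> complex) set ring" where
  "local_ring X p = near_ring X p Quot vanishing_near X p UNIV"

definition germ :: "'a fspace \<Rightarrow> 'a \<Rightarrow> ('a \<Rightarrow> complex) \<Rightarrow> ('a \<Rightarrow> complex) set" where
  "germ X p f = vanishing_near X p UNIV +>\<^bsub>near_ring X p\<^esub> f"

text \<open>The ideal in the local ring at \<open>p\<close> of a (locally closed) subvariety \<open>Y\<close>, with its reduced
  structure.\<close>

definition ideal_of :: "'a fspace \<Rightarrow> 'a \<Rightarrow> 'a set \<Rightarrow> ('a \<Rightarrow> complex) set set" where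
  "ideal_of X p Y = germ X p ` vanishing_near X p Y"

definition max_ideal :: "'a fspace \<Rightarrow> 'a \<Rightarrow> ('a \<Rightarrow> complex) set set" where
  "max_ideal X p = ideal_of X p {p}"

text \<open>Dimension of \<open>(E + I) / I\<close> over the complex numbers, for ideals or subspaces \<open>E\<close> of the local
  ring; the complex numbers sit in the quotient as the classes of the constant germs.\<close>

definition quot_dim ::
  "'a fspace \<Rightarrow> 'a \<Rightarrow> ('a \<Rightarrow> complex) set set \<Rightarrow> ('a \<Rightarrow> complex) set set \<Rightarrow> enat" where
  "quot_dim X p I E =
     (let R = local_ring X p;
          cls = (\<lambda>a. I +>\<^bsub>R\<^esub> a);
          K = range (\<lambda>c. cls (germ X p (\<lambda>_. c)));
          is_dim = (\<lambda>n. ring.dimension (R Quot I) n K (cls ` E))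
      in if \<exists>n. is_dim n then enat (THE n. is_dim n) else \<infinity>)"

text \<open>Length of the local ring of the scheme-theoretic intersection of \<open>Y\<close> and \<open>Z\<close> at \<open>p\<close>. For
  a curve \<open>Y\<close> and a divisor \<open>Z\<close> in a nonsingular variety which does not contain \<open>Y\<close> there are no higher Tor
  terms, so this is the intersection multiplicity, also at singular points of \<open>Y\<close>.\<close>

definition intersection_mult :: "'a fspace \<Rightarrow> 'a set \<Rightarrow> 'a set \<Rightarrow> 'a \<Rightarrow> enat" where
  "intersection_mult X Y Z p =
     quot_dim X p (ideal_of X p Y <+>\<^bsub>local_ring X p\<^esub> ideal_of X p Z) (carrier (local_ring X p))"

definition inter_sing :: "'a fspace \<Rightarrow> 'a set \<Rightarrow> 'a set \<Rightarrow> 'a set" where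
  "inter_sing X Y Z = {p \<in> Y \<inter> Z. intersection_mult X Y Z p > 1}"

definition nonsingular_at :: "'a fspace \<Rightarrow> 'a \<Rightarrow> bool" where
  "nonsingular_at X p \<longleftrightarrow>
     quot_dim X p (ideal_prod (local_ring X p) (max_ideal X p) (max_ideal X p)) (max_ideal X p)
     = local_dim X p"

definition smooth_variety :: "'a fspace \<Rightarrow> bool" where
  "smooth_variety X \<longleftrightarrow> variety X \<and> (\<forall>p\<in>points X. nonsingular_at X p)"

text \<open>Point derivations. By the Leibniz rule they vanish on functions that are zero near \<open>p\<close> (such a
  function is its own product with another one vanishing at \<open>p\<close>), so these are the derivations of the
  local ring.\<close>

definition tangent_space :: "'a fspace \<Rightarrow> 'a \<Rightarrow> (('a \<Rightarrow> complex) \<Rightarrow> complex) set" where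
  "tangent_space X p =
     {D. (\<forall>c. D (\<lambda>_. c) = 0) \<and>
         (\<forall>f\<in>carrier (near_ring X p). \<forall>g\<in>carrier (near_ring X p).
            D (\<lambda>x. f x + g x) = D f + D g \<and>
            D (\<lambda>x. f x * g x) = f p * D g + g p * D f)}"

text \<open>Smoothness of a morphism with nonsingular target: the source is nonsingular as well, and all
  tangent maps are surjective.\<close>

definition smooth_morphism :: "'a fspace \<Rightarrow> 's fspace \<Rightarrow> ('a \<Rightarrow> 's) \<Rightarrow> bool" where
  "smooth_morphism X S \<pi> \<longleftrightarrow>
     smooth_variety X \<and> smooth_variety S \<and> morphism X S \<pi> \<and>
     (\<forall>p\<in>points X. \<forall>E\<in>tangent_space S (\<pi> p). \<exists>D\<in>tangent_space X p.
        \<forall>f\<in>carrier (near_ring S (\<pi> p)). E f = D (\<lambda>x. f (\<pi> x)))"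

section \<open>Abelian schemes\<close>

text \<open>The base change \<open>T\<close> runs over all varieties with points in a fixed type of the cardinality of
  the continuum, hence over all varieties up to isomorphism.\<close>

definition proper_morphism :: "'a fspace \<Rightarrow> 's fspace \<Rightarrow> ('a \<Rightarrow> 's) \<Rightarrow> bool" where
  "proper_morphism X S \<pi> \<longleftrightarrow> variety X \<and> variety S \<and> morphism X S \<pi> \<and>
     (\<forall>(T :: (nat \<Rightarrow> complex) fspace) g. variety T \<longrightarrow> morphism T S g \<longrightarrow>
        closed_map (zar (fiber_prod X T \<pi> g)) (zar T) snd)"

text \<open>A smooth proper group scheme over a nonsingular base with connected fibers. Multiplication,
  unit section and inversion are morphisms over \<open>S\<close>; as all varieties involved are reduced, the
  group axioms may be stated on points, that is, in the fibers.\<close>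

definition abelian_scheme :: "'a fspace \<Rightarrow> 's fspace \<Rightarrow> ('a \<Rightarrow> 's) \<Rightarrow> bool" where
  "abelian_scheme A S \<pi> \<longleftrightarrow>
     smooth_morphism A S \<pi> \<and> proper_morphism A S \<pi> \<and>
     (\<forall>s\<in>points S. connectedin (zar A) (fiber A \<pi> s)) \<and>
     (\<exists>m e i. morphism (fiber_prod A A \<pi> \<pi>) A m \<and> morphism S A e \<and> morphism A A i \<and>
        (\<forall>s\<in>points S.
           let G = \<lparr>carrier = fiber A \<pi> s, monoid.mult = (\<lambda>a b. m (a, b)), one = e s\<rparr>
           in group G \<and> (\<forall>a\<in>fiber A \<pi> s. i a = inv\<^bsub>G\<^esub> a)))"

end

theory Submission
  imports
    Defs
    "HOL-Analysis.Continuum_Not_Denumerable"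
    "HOL-Computational_Algebra.Fundamental_Theorem_Algebra"
begin

text \<open>The multiplicity of \<open>C\<close> and the fiber through \<open>p\<close> is the dimension of the local ring of \<open>C\<close> at \<open>p\<close>
  modulo the functions vanishing on the fiber. It equals 1 as soon as these functions
  contain a generator of the maximal ideal of the local ring of \<open>C\<close>, in particular as soon as the
  projection \<open>C \<rightarrow> S\<close> is unramified at \<open>p\<close>. So two things have to be shown: a nonconstant map
  from a curve to \<open>S\<close> is unramified on a nonempty open subset of the curve, and the complement of such a
  subset is finite.

  Finiteness is \<open>proper_closed_subset_of_curve_finite\<close>. By Hilbert's basis theorem, closed subsets of an
  affine chart satisfy the descending chain condition, so an infinite proper closed subset of the curve would lead to a
  minimal infinite closed subset \<open>W\<close> of a chart. Such a \<open>W\<close> is irreducible, and a point of \<open>W\<close>, the closure of \<open>W\<close> and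
  the whole curve would form a chain contradicting dimension 1.

  Generic unramifiedness is \<open>curve_generically_unramified\<close>. Take an affine chart with coordinates
  \<open>x\<^sub>i\<close>, and a function \<open>t\<close> pulled back from \<open>S\<close> which is not constant on \<open>C\<close>. On the curve every \<open>x\<^sub>i\<close> is
  algebraic over \<open>t\<close> (\<open>algebraic_dependence\<close>). In a relation \<open>Q(t, x\<^sub>i) = 0\<close> of least degree in
  \<open>x\<^sub>i\<close>, the derivative \<open>\<partial>Q/\<partial>y (t, x\<^sub>i)\<close> does not vanish identically, because the characteristic is 0. Where it
  is nonzero, expanding \<open>Q\<close> at \<open>p\<close> writes \<open>x\<^sub>i - x\<^sub>i(p)\<close> as \<open>t - t(p)\<close> times a function regular at \<open>p\<close>
  (\<open>relation_linearisation\<close>). Hence \<open>t - t(p)\<close>, which vanishes on the fiber through \<open>p\<close>, generates the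
  maximal ideal of the local ring of \<open>C\<close>.

  For \<open>algebraic_dependence\<close> the dimension enters only through the finiteness of zero sets. For
  \<open>a \<in> \<complex>\<close> let \<open>q\<^sub>a\<close> be the product of the functions \<open>t - t(z)\<close> over the finitely many zeros \<open>z\<close> of
  \<open>x\<^sub>i - a\<close>, where \<open>x\<^sub>i\<close> may be assumed nonconstant. By the Nullstellensatz a power of \<open>q\<^sub>a\<close> is a multiple \<open>r\<^sub>a (x\<^sub>i - a)\<close>. There are uncountably many
  \<open>a\<close>, but the polynomial functions have countable dimension over \<open>\<complex>\<close>, so finitely many of the \<open>r\<^sub>a\<close> are linearly
  dependent; clearing denominators in the relation among the fractions \<open>q\<^sub>a\<^sup>N / (x\<^sub>i - a)\<close> gives a polynomial
  relation between \<open>t\<close> and \<open>x\<^sub>i\<close>. The Nullstellensatz itself is proved by the same counting argument.\<close>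

section \<open>Polynomial functions\<close>

lemma poly_fun_cmult: "f \<in> poly_fun n \<Longrightarrow> (\<lambda>x. c * f x) \<in> poly_fun n"
  by (rule poly_fun.mult[OF poly_fun.const])

lemma poly_fun_minus: "f \<in> poly_fun n \<Longrightarrow> (\<lambda>x. - f x) \<in> poly_fun n"
  using poly_fun_cmult[of f n "-1"] by simp

lemma poly_fun_diff: "f \<in> poly_fun n \<Longrightarrow> g \<in> poly_fun n \<Longrightarrow> (\<lambda>x. f x - g x) \<in> poly_fun n"
  using poly_fun.add[OF _ poly_fun_minus] by fastforce

lemma poly_fun_power: "f \<in> poly_fun n \<Longrightarrow> (\<lambda>x. f x ^ k) \<in> poly_fun n"
  by (induction k) (auto intro: poly_fun.intros)

lemma poly_fun_sum: "(\<And>i. i \<in> I \<Longrightarrow> f i \<in> poly_fun n) \<Longrightarrow> (\<lambda>x. \<Sum>i\<in>I. f i x) \<in> poly_fun n"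
  by (induction I rule: infinite_finite_induct) (auto intro: poly_fun.intros)

lemma poly_fun_prod: "(\<And>i. i \<in> I \<Longrightarrow> f i \<in> poly_fun n) \<Longrightarrow> (\<lambda>x. \<Prod>i\<in>I. f i x) \<in> poly_fun n"
  by (induction I rule: infinite_finite_induct) (auto intro: poly_fun.intros)

lemma poly_fun_poly: "f \<in> poly_fun n \<Longrightarrow> (\<lambda>x. poly p (f x)) \<in> poly_fun n"
  by (induction p) (auto intro: poly_fun.intros)

lemmas poly_fun_intros = poly_fun.intros poly_fun_cmult poly_fun_minus poly_fun_diff poly_fun_power
  poly_fun_sum poly_fun_prod poly_fun_poly

lemma poly_fun_cong:
  assumes "f \<in> poly_fun n" "\<And>i. i < n \<Longrightarrow> u i = v i"
  shows "f u = f v"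
  using assms by induction auto

text \<open>The maximal ideal of a point \<open>c\<close> is generated by the functions \<open>x i - c i\<close>.\<close>

lemma poly_fun_difference_expansion:
  assumes "f \<in> poly_fun n"
  shows "\<exists>r. (\<forall>i<n. r i \<in> poly_fun n) \<and> (\<forall>x. f x - f c = (\<Sum>i<n. (x i - c i) * r i x))"
  using assms
proof induction
  case (const b)
  show ?case by (rule exI[of _ "\<lambda>_ _. 0"]) (simp add: poly_fun.const)
next
  case (coord j)
  have "x j - c j = (\<Sum>i<n. (x i - c i) * (if i = j then 1 else 0))" for x
    using coord by (simp add: if_distrib[of "\<lambda>z. _ * z"] sum.delta cong: if_cong)
  then show ?case by (intro exI[of _ "\<lambda>i _. if i = j then 1 else 0"]) (simp add: poly_fun.const)
next
  case (add f g)
  then obtain r s where rs: "\<forall>i<n. r i \<in> poly_fun n" "\<And>x. f x - f c = (\<Sum>i<n. (x i - c i) * r i x)"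
    "\<forall>i<n. s i \<in> poly_fun n" "\<And>x. g x - g c = (\<Sum>i<n. (x i - c i) * s i x)"
    by blast
  have "f x + g x - (f c + g c) = (\<Sum>i<n. (x i - c i) * (r i x + s i x))" for x
  proof -
    have "f x + g x - (f c + g c) = (f x - f c) + (g x - g c)" by simp
    also have "\<dots> = (\<Sum>i<n. (x i - c i) * (r i x + s i x))"
      unfolding rs(2) rs(4) by (simp add: distrib_left sum.distrib)
    finally show ?thesis .
  qed
  then show ?case using rs(1,3) by (intro exI[of _ "\<lambda>i x. r i x + s i x"]) (simp add: poly_fun.add)
next
  case (mult f g)
  then obtain r s where rs: "\<forall>i<n. r i \<in> poly_fun n" "\<And>x. f x - f c = (\<Sum>i<n. (x i - c i) * r i x)"
    "\<forall>i<n. s i \<in> poly_fun n" "\<And>x. g x - g c = (\<Sum>i<n. (x i - c i) * s i x)"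
    by blast
  have "f x * g x - f c * g c = (\<Sum>i<n. (x i - c i) * (g x * r i x + f c * s i x))" for x
  proof -
    have "f x * g x - f c * g c = g x * (f x - f c) + f c * (g x - g c)" by (simp add: algebra_simps)
    also have "\<dots> = (\<Sum>i<n. (x i - c i) * (g x * r i x + f c * s i x))"
      unfolding rs(2) rs(4) by (simp add: sum_distrib_left distrib_left sum.distrib mult_ac)
    finally show ?thesis .
  qed
  moreover have "(\<lambda>x. g x * r i x + f c * s i x) \<in> poly_fun n" if "i < n" for i
    using rs(1,3) mult.hyps that by (intro poly_fun.add poly_fun.mult poly_fun.const) auto
  ultimately show ?case by (intro exI[of _ "\<lambda>i x. g x * r i x + f c * s i x"]) simp
qed

section \<open>Uncountable families of polynomial functions\<close>

text \<open>Monomials are indexed by the lists of their factors, so that multiplying monomials is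
  appending lists. What matters later is that there are only countably many of them.\<close>

lemma poly_fun_monomial_expansion:
  assumes "f \<in> poly_fun n"
  shows "\<exists>M c. finite M \<and> (\<forall>x. f x = (\<Sum>m\<in>M. c m * prod_list (map x m)))"
  using assms
proof induction
  case (const c)
  show ?case by (rule exI[of _ "{[]}"], rule exI[of _ "\<lambda>_. c"]) simp
next
  case (coord i)
  show ?case by (rule exI[of _ "{[i]}"], rule exI[of _ "\<lambda>_. 1"]) simp
next
  case (add f g)
  then obtain M c N d where M: "finite M" "\<And>x. f x = (\<Sum>m\<in>M. c m * prod_list (map x m))"
    and N: "finite N" "\<And>x. g x = (\<Sum>m\<in>N. d m * prod_list (map x m))" by metis
  have "f x + g x = (\<Sum>m\<in>M \<union> N. ((if m \<in> M then c m else 0) + (if m \<in> N then d m else 0)) *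
      prod_list (map x m))" for x
  proof -
    have "f x = (\<Sum>m\<in>M \<union> N. (if m \<in> M then c m else 0) * prod_list (map x m))"
      unfolding M(2) using M(1) N(1) by (intro sum.mono_neutral_cong_left) auto
    moreover have "g x = (\<Sum>m\<in>M \<union> N. (if m \<in> N then d m else 0) * prod_list (map x m))"
      unfolding N(2) using M(1) N(1) by (intro sum.mono_neutral_cong_left) auto
    ultimately show ?thesis by (simp add: distrib_right sum.distrib)
  qed
  then show ?case using M(1) N(1)
    by (intro exI[of _ "M \<union> N"]
        exI[of _ "\<lambda>m. (if m \<in> M then c m else 0) + (if m \<in> N then d m else 0)"]) blast
next
  case (mult f g)
  then obtain M c N d where M: "finite M" "\<And>x. f x = (\<Sum>m\<in>M. c m * prod_list (map x m))"
    and N: "finite N" "\<And>x. g x = (\<Sum>m\<in>N. d m * prod_list (map x m))" by metis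
  let ?app = "\<lambda>(k, l). k @ l :: nat list"
  let ?e = "\<lambda>m. \<Sum>p\<in>{p \<in> M \<times> N. ?app p = m}. c (fst p) * d (snd p)"
  have "f x * g x = (\<Sum>m\<in>?app ` (M \<times> N). ?e m * prod_list (map x m))" for x
  proof -
    have "f x * g x = (\<Sum>p\<in>M \<times> N. c (fst p) * d (snd p) * prod_list (map x (?app p)))"
      unfolding M(2) N(2) sum_product sum.cartesian_product
      by (intro sum.cong refl) (simp add: split_beta mult_ac)
    also have "\<dots> = (\<Sum>m\<in>?app ` (M \<times> N). \<Sum>p\<in>{p \<in> M \<times> N. ?app p = m}.
        c (fst p) * d (snd p) * prod_list (map x (?app p)))"
      using M(1) N(1) by (intro sum.image_gen) auto
    also have "\<dots> = (\<Sum>m\<in>?app ` (M \<times> N). ?e m * prod_list (map x m))"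
      unfolding sum_distrib_right by (intro sum.cong) auto
    finally show ?thesis .
  qed
  then show ?case using M(1) N(1) by (intro exI[of _ "?app ` (M \<times> N)"] exI[of _ ?e]) auto
qed

text \<open>Gaussian elimination: one equation is used to eliminate one unknown.\<close>

lemma homogeneous_system_nontrivial_solution:
  fixes m :: "'b \<Rightarrow> 'a \<Rightarrow> complex"
  assumes "finite J" "finite B" "card J < card B"
  shows "\<exists>c. (\<exists>b\<in>B. c b \<noteq> 0) \<and> (\<forall>j\<in>J. (\<Sum>b\<in>B. c b * m b j) = 0)"
  using assms
proof (induction J arbitrary: B m rule: finite_induct)
  case empty
  then obtain b where "b \<in> B" by fastforce
  then show ?case by (intro exI[of _ "\<lambda>_. 1"]) auto
next
  case (insert j J)
  show ?case
  proof (cases "\<exists>b\<in>B. m b j \<noteq> 0")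
    case False
    with insert.IH[of B m] insert.prems insert.hyps show ?thesis by auto
  next
    case True
    then obtain b where b: "b \<in> B" "m b j \<noteq> 0" by blast
    let ?m = "\<lambda>a i. m a i - m a j / m b j * m b i"
    have "card J < card (B - {b})" using insert.prems insert.hyps b by simp
    then obtain c where c: "\<exists>a\<in>B - {b}. c a \<noteq> 0"
      "\<And>i. i \<in> J \<Longrightarrow> (\<Sum>a\<in>B - {b}. c a * ?m a i) = 0"
      using insert.IH[of "B - {b}" ?m] insert.prems by auto
    let ?c = "c(b := - (\<Sum>a\<in>B - {b}. c a * m a j / m b j))"
    have "(\<Sum>a\<in>B. ?c a * m a i) = (\<Sum>a\<in>B - {b}. c a * ?m a i)" for i
    proof -
      have "(\<Sum>a\<in>B. ?c a * m a i) = ?c b * m b i + (\<Sum>a\<in>B - {b}. ?c a * m a i)"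
        using b insert.prems by (simp add: sum.remove)
      also have "(\<Sum>a\<in>B - {b}. ?c a * m a i) = (\<Sum>a\<in>B - {b}. c a * m a i)"
        by (intro sum.cong) auto
      also have "?c b * m b i + \<dots> = (\<Sum>a\<in>B - {b}. c a * ?m a i)"
        by (simp add: sum_distrib_right sum_distrib_left right_diff_distrib sum_subtractf mult_ac)
      finally show ?thesis .
    qed
    moreover have "(\<Sum>a\<in>B - {b}. c a * ?m a j) = 0" using b by simp
    moreover have "\<exists>a\<in>B. ?c a \<noteq> 0" using c(1) by auto
    ultimately show ?thesis using c(2) by (intro exI[of _ ?c]) auto
  qed
qed

text \<open>Only countably many finite sets of monomials and labels exist, so infinitely many members of an
  uncountable family share both. More of them than the set has monomials must be linearly
  dependent. The label \<open>\<kappa>\<close> records an exponent that has to be the same for all members of the relation.\<close>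

lemma uncountable_family_dependent:
  fixes r :: "complex \<Rightarrow> (nat \<Rightarrow> complex) \<Rightarrow> complex" and \<kappa> :: "complex \<Rightarrow> nat"
  assumes "\<And>a. r a \<in> poly_fun n"
  obtains B c where "finite B" "\<exists>a\<in>B. c a \<noteq> 0" "\<And>a b. a \<in> B \<Longrightarrow> b \<in> B \<Longrightarrow> \<kappa> a = \<kappa> b"
    "\<And>x. (\<Sum>a\<in>B. c a * r a x) = 0"
proof -
  obtain M c where M: "\<And>a. finite (M a)" and c: "\<And>a x. r a x = (\<Sum>m\<in>M a. c a m * prod_list (map x m))"
    using poly_fun_monomial_expansion[OF assms] by metis
  have "\<exists>y. infinite {a. (\<kappa> a, M a) = y}"
  proof (rule ccontr)
    assume *: "\<nexists>y. infinite {a. (\<kappa> a, M a) = y}"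
    have "range (\<lambda>a. (\<kappa> a, M a)) \<subseteq> UNIV \<times> {M. finite M}" using M by auto
    moreover have "countable (UNIV \<times> {M. finite M} :: (nat \<times> nat list set) set)"
      using countable_Collect_finite_subset[of "UNIV :: nat list set"] by simp
    ultimately have "countable (range (\<lambda>a. (\<kappa> a, M a)))" by (rule countable_subset)
    then have "countable (\<Union>y\<in>range (\<lambda>a. (\<kappa> a, M a)). {a. (\<kappa> a, M a) = y})"
      using * by (intro countable_UN) (auto intro: countable_finite)
    moreover have "(\<Union>y\<in>range (\<lambda>a. (\<kappa> a, M a)). {a. (\<kappa> a, M a) = y}) = UNIV" by auto
    ultimately show False using uncountable_UNIV_complex by simp
  qed
  then obtain k N where inf: "infinite {a. (\<kappa> a, M a) = (k, N)}" by force
  then obtain B where B: "finite B" "card B = Suc (card N)" "B \<subseteq> {a. (\<kappa> a, M a) = (k, N)}"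
    using infinite_arbitrarily_large by blast
  have N: "finite N" using inf M by (metis (mono_tags, lifting) empty_Collect_eq infinite_imp_nonempty prod.inject)
  obtain d where d: "\<exists>b\<in>B. d b \<noteq> 0" "\<And>m. m \<in> N \<Longrightarrow> (\<Sum>a\<in>B. d a * c a m) = 0"
    using homogeneous_system_nontrivial_solution[OF N B(1), of c] B(2) by auto
  have "(\<Sum>a\<in>B. d a * r a x) = 0" for x
  proof -
    have "(\<Sum>a\<in>B. d a * r a x) = (\<Sum>a\<in>B. \<Sum>m\<in>N. d a * c a m * prod_list (map x m))"
      using B(3) by (intro sum.cong refl) (auto simp: c sum_distrib_left mult.assoc)
    also have "\<dots> = (\<Sum>m\<in>N. \<Sum>a\<in>B. d a * c a m * prod_list (map x m))"
      by (rule sum.swap)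
    also have "\<dots> = 0" by (simp add: d(2) flip: sum_distrib_right)
    finally show ?thesis .
  qed
  then show thesis using that[of B d] B d(1) by auto
qed

section \<open>The Nullstellensatz\<close>

definition poly_ideal :: "nat \<Rightarrow> ((nat \<Rightarrow> complex) \<Rightarrow> complex) set \<Rightarrow> bool" where
  "poly_ideal n J \<longleftrightarrow> J \<subseteq> poly_fun n \<and> (\<lambda>_. 0) \<in> J \<and>
     (\<forall>f\<in>J. \<forall>g\<in>J. (\<lambda>x. f x + g x) \<in> J) \<and>
     (\<forall>f\<in>J. \<forall>g\<in>poly_fun n. (\<lambda>x. g x * f x) \<in> J)"

lemma poly_idealD:
  assumes "poly_ideal n J"
  shows "f \<in> J \<Longrightarrow> f \<in> poly_fun n" "(\<lambda>_. 0) \<in> J"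
    "f \<in> J \<Longrightarrow> g \<in> J \<Longrightarrow> (\<lambda>x. f x + g x) \<in> J"
    "f \<in> J \<Longrightarrow> g \<in> poly_fun n \<Longrightarrow> (\<lambda>x. g x * f x) \<in> J"
  using assms unfolding poly_ideal_def by blast+

lemma poly_ideal_sum:
  assumes "poly_ideal n J" "\<And>i. i \<in> I \<Longrightarrow> f i \<in> J"
  shows "(\<lambda>x. \<Sum>i\<in>I. f i x) \<in> J"
  using assms(2)
  by (induction I rule: infinite_finite_induct) (auto intro: poly_idealD[OF assms(1)])

lemma poly_ideal_diff:
  assumes "poly_ideal n J" "f \<in> J" "g \<in> J"
  shows "(\<lambda>x. f x - g x) \<in> J"
  using poly_idealD(3)[OF assms(1,2) poly_idealD(4)[OF assms(1,3) poly_fun.const[of "-1"]]] by simp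

definition adjoin :: "nat \<Rightarrow> ((nat \<Rightarrow> complex) \<Rightarrow> complex) set \<Rightarrow> ((nat \<Rightarrow> complex) \<Rightarrow> complex) \<Rightarrow>
    ((nat \<Rightarrow> complex) \<Rightarrow> complex) set" where
  "adjoin n J g = {(\<lambda>x. f x + r x * g x) | f r. f \<in> J \<and> r \<in> poly_fun n}"

lemma poly_ideal_adjoin:
  assumes J: "poly_ideal n J" and g: "g \<in> poly_fun n"
  shows "poly_ideal n (adjoin n J g)"
  unfolding poly_ideal_def
proof (intro conjI ballI)
  show "adjoin n J g \<subseteq> poly_fun n"
    unfolding adjoin_def using poly_idealD(1)[OF J] g by (auto intro!: poly_fun.intros)
  show "(\<lambda>_. 0) \<in> adjoin n J g"
    unfolding adjoin_def
    by (rule CollectI, rule exI[of _ "\<lambda>_. 0"], rule exI[of _ "\<lambda>_. 0"])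
       (auto intro: poly_idealD(2)[OF J] poly_fun.const)
next
  fix f f' assume "f \<in> adjoin n J g" "f' \<in> adjoin n J g"
  then obtain e r e' r' where "e \<in> J" "r \<in> poly_fun n" "f = (\<lambda>x. e x + r x * g x)"
    "e' \<in> J" "r' \<in> poly_fun n" "f' = (\<lambda>x. e' x + r' x * g x)"
    unfolding adjoin_def by auto
  then show "(\<lambda>x. f x + f' x) \<in> adjoin n J g"
    unfolding adjoin_def
    by (intro CollectI exI[of _ "\<lambda>x. e x + e' x"] exI[of _ "\<lambda>x. r x + r' x"])
       (auto intro: poly_idealD(3)[OF J] poly_fun.intros simp: algebra_simps)
next
  fix f h assume "f \<in> adjoin n J g" and h: "h \<in> poly_fun n"
  then obtain e r where "e \<in> J" "r \<in> poly_fun n" "f = (\<lambda>x. e x + r x * g x)"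
    unfolding adjoin_def by auto
  then show "(\<lambda>x. h x * f x) \<in> adjoin n J g"
    unfolding adjoin_def using h
    by (intro CollectI exI[of _ "\<lambda>x. h x * e x"] exI[of _ "\<lambda>x. h x * r x"])
       (auto intro: poly_idealD(4)[OF J] poly_fun.intros simp: distrib_left mult.assoc)
qed

lemma adjoin_superset: "J \<subseteq> adjoin n J g"
proof
  fix f assume "f \<in> J"
  then show "f \<in> adjoin n J g" unfolding adjoin_def
    by (intro CollectI exI[of _ f] exI[of _ "\<lambda>_. 0"]) (auto intro: poly_fun.const)
qed

lemma adjoin_mem:
  assumes "poly_ideal n J" shows "g \<in> adjoin n J g"
  unfolding adjoin_def
  by (intro CollectI exI[of _ "\<lambda>_. 0"] exI[of _ "\<lambda>_. 1"])
     (auto intro: poly_fun.const poly_idealD(2)[OF assms])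

text \<open>Lagrange interpolation with the denominators cleared, that is, \<open>(\<Sum>a. c a / (y - \<alpha> a)) \<cdot> (\<Prod>a. y - \<alpha> a)\<close>.
  It turns a linear relation among multiples of \<open>1 / (y - \<alpha> a)\<close> into a polynomial relation.\<close>

definition lagrange_comb :: "'b set \<Rightarrow> ('b \<Rightarrow> 'a::comm_ring_1) \<Rightarrow> ('b \<Rightarrow> 'a) \<Rightarrow> 'a poly" where
  "lagrange_comb B \<alpha> c = (\<Sum>a\<in>B. smult (c a) (\<Prod>b\<in>B - {a}. [:- \<alpha> b, 1:]))"

lemma poly_lagrange_comb:
  "poly (lagrange_comb B \<alpha> c) y = (\<Sum>a\<in>B. c a * (\<Prod>b\<in>B - {a}. y - \<alpha> b))"
  by (simp add: lagrange_comb_def poly_sum poly_prod)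

text \<open>At the node \<open>\<alpha> a\<close> only one summand survives.\<close>

lemma lagrange_comb_nonzero:
  fixes c :: "'b \<Rightarrow> 'a::idom"
  assumes "finite B" "inj_on \<alpha> B" "a \<in> B" "c a \<noteq> 0"
  shows "lagrange_comb B \<alpha> c \<noteq> 0"
proof
  assume "lagrange_comb B \<alpha> c = 0"
  then have "0 = (\<Sum>a'\<in>B. c a' * (\<Prod>b\<in>B - {a'}. \<alpha> a - \<alpha> b))"
    using poly_lagrange_comb[of B \<alpha> c "\<alpha> a"] by simp
  also have "\<dots> = c a * (\<Prod>b\<in>B - {a}. \<alpha> a - \<alpha> b)"
    using assms by (subst sum.remove[of _ a]) (auto intro!: sum.neutral prod_zero)
  also have "\<dots> \<noteq> 0"
    using assms by (auto simp: inj_on_def)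
  finally show False by simp
qed

lemma complex_poly_root_induct [consumes 1, case_names const root]:
  fixes p :: "complex poly"
  assumes "p \<noteq> 0" "\<And>c. c \<noteq> 0 \<Longrightarrow> P [:c:]" "\<And>b p. p \<noteq> 0 \<Longrightarrow> P p \<Longrightarrow> P ([:- b, 1:] * p)"
  shows "P p"
  using assms(1)
proof (induction "degree p" arbitrary: p)
  case 0
  then show ?case using assms(2) by (metis degree_eq_zeroE pCons_0_0)
next
  case (Suc d)
  then have "\<not> constant (poly p)" by (simp add: constant_degree)
  then obtain b where "poly p b = 0" using fundamental_theorem_of_algebra by blast
  then obtain q where q: "p = [:- b, 1:] * q" using poly_eq_0_iff_dvd by (metis dvdE)
  with Suc.prems have "q \<noteq> 0" by auto
  with q Suc.hyps(2) have "degree q = d" by (simp add: degree_mult_eq del: mult_pCons_left)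
  with Suc.hyps(1) \<open>q \<noteq> 0\<close> show ?case unfolding q by (intro assms(3)) auto
qed

text \<open>Modulo \<open>J\<close> each \<open>g - a\<close> divides a power of \<open>q\<close>. The linear factors of \<open>p(g)\<close> can therefore be removed one
  after the other, at the price of a larger power of \<open>q\<close>.\<close>

lemma power_in_ideal_if_poly_multiple:
  assumes J: "poly_ideal n J" and q: "q \<in> poly_fun n" and g: "g \<in> poly_fun n"
    and eq: "\<And>a x. q x ^ \<kappa> a = f a x + r a x * (g x - a)"
    and f: "\<And>a. f a \<in> J" and r: "\<And>a. r a \<in> poly_fun n"
    and "p \<noteq> 0" "(\<lambda>x. q x ^ k * poly p (g x)) \<in> J"
  shows "\<exists>k. (\<lambda>x. q x ^ k) \<in> J"
  using assms(7,8)
proof (induction p arbitrary: k rule: complex_poly_root_induct)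
  case (const c)
  from poly_idealD(4)[OF J const(2) poly_fun.const]
  have "(\<lambda>x. inverse c * (q x ^ k * poly [:c:] (g x))) \<in> J" .
  moreover have "(\<lambda>x. inverse c * (q x ^ k * poly [:c:] (g x))) = (\<lambda>x. q x ^ k)"
    using const by (simp add: field_simps)
  ultimately show ?case by metis
next
  case (root b p)
  let ?h = "\<lambda>x. q x ^ k * poly p (g x)"
  have "(\<lambda>x. r b x * (q x ^ k * poly ([:- b, 1:] * p) (g x)) + ?h x * f b x) \<in> J"
    by (rule poly_idealD(3)[OF J poly_idealD(4)[OF J root.prems r] poly_idealD(4)[OF J f]])
       (intro poly_fun.mult poly_fun_power poly_fun_poly q g)
  moreover have "r b x * (q x ^ k * poly ([:- b, 1:] * p) (g x)) + ?h x * f b x =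
      q x ^ (k + \<kappa> b) * poly p (g x)" for x
    unfolding power_add eq by (simp add: algebra_simps)
  ultimately show ?case using root.IH[of "k + \<kappa> b"] by simp
qed

text \<open>If every \<open>J + (g - a)\<close> contained a power of \<open>q\<close>, then \<open>q\<close> raised to some power would be \<open>r\<^sub>a (g - a)\<close> modulo
  \<open>J\<close> for every complex number \<open>a\<close>. A linear relation among uncountably many \<open>r\<^sub>a\<close> would put a
  nonzero polynomial in \<open>g\<close>, times a power of \<open>q\<close>, into \<open>J\<close>.\<close>

lemma exists_value_avoiding_powers:
  assumes J: "poly_ideal n J" and q: "q \<in> poly_fun n" and g: "g \<in> poly_fun n"
    and nopow: "\<And>k. (\<lambda>x. q x ^ k) \<notin> J"
  shows "\<exists>a. \<forall>k. (\<lambda>x. q x ^ k) \<notin> adjoin n J (\<lambda>x. g x - a)"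
proof (rule ccontr)
  assume "\<not> ?thesis"
  then have "\<forall>a. \<exists>k. (\<lambda>x. q x ^ k) \<in> adjoin n J (\<lambda>x. g x - a)"
    by blast
  then obtain \<kappa> where "\<And>a. (\<lambda>x. q x ^ \<kappa> a) \<in> adjoin n J (\<lambda>x. g x - a)"
    by metis
  then have "\<forall>a. \<exists>e r. e \<in> J \<and> r \<in> poly_fun n \<and> (\<forall>x. q x ^ \<kappa> a = e x + r x * (g x - a))"
    unfolding adjoin_def mem_Collect_eq fun_eq_iff by blast
  then obtain f where "\<forall>a. \<exists>r. f a \<in> J \<and> r \<in> poly_fun n \<and> (\<forall>x. q x ^ \<kappa> a = f a x + r x * (g x - a))"
    by (rule choice[THEN exE])
  then obtain r where *: "\<forall>a. f a \<in> J \<and> r a \<in> poly_fun n \<and> (\<forall>x. q x ^ \<kappa> a = f a x + r a x * (g x - a))"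
    by (rule choice[THEN exE])
  then have eq: "\<And>a x. q x ^ \<kappa> a = f a x + r a x * (g x - a)" and f: "\<And>a. f a \<in> J"
    and r: "\<And>a. r a \<in> poly_fun n"
    by blast+
  obtain B c where B: "finite B" "\<exists>a\<in>B. c a \<noteq> 0" "\<And>a b. a \<in> B \<Longrightarrow> b \<in> B \<Longrightarrow> \<kappa> a = \<kappa> b"
    "\<And>x. (\<Sum>a\<in>B. c a * r a x) = 0"
    using uncountable_family_dependent[where r = r and \<kappa> = \<kappa>, OF r] by blast
  then obtain a where a: "a \<in> B" "c a \<noteq> 0" by blast
  let ?p = "lagrange_comb B (\<lambda>a. a) c"
  have "?p \<noteq> 0" using lagrange_comb_nonzero[of B "\<lambda>a. a" a c] B(1) a by simp
  moreover have "(\<lambda>x. q x ^ \<kappa> a * poly ?p (g x)) \<in> J"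
  proof -
    have "q x ^ \<kappa> a * poly ?p (g x) =
      (\<Sum>b\<in>B. (c b * (\<Prod>d\<in>B - {b}. g x - d)) * f b x)" for x
    proof -
      have "q x ^ \<kappa> a * poly ?p (g x) = (\<Sum>b\<in>B. c b * (\<Prod>d\<in>B - {b}. g x - d) * q x ^ \<kappa> b)"
        unfolding poly_lagrange_comb sum_distrib_left using B(3)[OF a(1)]
        by (intro sum.cong refl) (simp add: mult_ac)
      also have "\<dots> = (\<Sum>b\<in>B. (c b * (\<Prod>d\<in>B - {b}. g x - d)) * f b x) +
          (\<Sum>b\<in>B. c b * r b x * ((g x - b) * (\<Prod>d\<in>B - {b}. g x - d)))"
        unfolding eq by (simp add: distrib_left sum.distrib mult_ac)
      also have "(\<Sum>b\<in>B. c b * r b x * ((g x - b) * (\<Prod>d\<in>B - {b}. g x - d))) =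
          (\<Sum>b\<in>B. c b * r b x * (\<Prod>d\<in>B. g x - d))"
        using B(1) by (intro sum.cong) (simp_all add: prod.remove)
      also have "\<dots> = 0" using B(4) by (simp flip: sum_distrib_right)
      finally show ?thesis by simp
    qed
    then show ?thesis using f g
      by (auto intro!: poly_ideal_sum[OF J] poly_idealD(4)[OF J] poly_fun_intros)
  qed
  ultimately show False
    using power_in_ideal_if_poly_multiple[OF J q g eq f r] nopow by blast
qed

text \<open>Adding \<open>x\<^sub>i - u\<^sub>i\<close> to the ideal for all coordinates in turn, with values \<open>u\<^sub>i\<close> chosen such that no
  power of \<open>q\<close> gets into the ideal, leads to the ideal of the point \<open>u\<close>.\<close>

lemma nullstellensatz:
  assumes J: "poly_ideal n J" and q: "q \<in> poly_fun n" and nopow: "\<And>k. (\<lambda>x. q x ^ k) \<notin> J"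
  obtains u where "u \<in> {..<n} \<rightarrow>\<^sub>E UNIV" "\<forall>f\<in>J. f u = 0" "q u \<noteq> 0"
proof -
  have "\<exists>J' u. poly_ideal n J' \<and> J \<subseteq> J' \<and> (\<forall>k. (\<lambda>x. q x ^ k) \<notin> J') \<and>
      (\<forall>i<m. (\<lambda>x. x i - u i) \<in> J')" if "m \<le> n" for m
    using that
  proof (induction m)
    case 0
    then show ?case using J nopow by auto
  next
    case (Suc m)
    then obtain J' u where J': "poly_ideal n J'" "J \<subseteq> J'" "\<And>k. (\<lambda>x. q x ^ k) \<notin> J'"
      "\<And>i. i < m \<Longrightarrow> (\<lambda>x. x i - u i) \<in> J'" by auto
    have m: "(\<lambda>x. x m) \<in> poly_fun n" using Suc.prems by (auto intro: poly_fun.coord)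
    obtain a where a: "\<And>k. (\<lambda>x. q x ^ k) \<notin> adjoin n J' (\<lambda>x. x m - a)"
      using exists_value_avoiding_powers[OF J'(1) q m J'(3)] by blast
    have ideal: "poly_ideal n (adjoin n J' (\<lambda>x. x m - a))"
      by (intro poly_ideal_adjoin[OF J'(1)] poly_fun_diff[OF m] poly_fun.const)
    have "(\<lambda>x. x i - (u(m := a)) i) \<in> adjoin n J' (\<lambda>x. x m - a)" if "i < Suc m" for i
      using J'(4)[of i] that adjoin_superset[of J' n "\<lambda>x. x m - a"] adjoin_mem[OF J'(1)]
      by (cases "i = m") auto
    then show ?case
      using J'(2) a ideal adjoin_superset[of J' n "\<lambda>x. x m - a"]
      by (intro exI[of _ "adjoin n J' (\<lambda>x. x m - a)"] exI[of _ "u(m := a)"]) auto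
  qed
  from this[of n] obtain J' u where J': "poly_ideal n J'" "J \<subseteq> J'" "\<And>k. (\<lambda>x. q x ^ k) \<notin> J'"
    "\<And>i. i < n \<Longrightarrow> (\<lambda>x. x i - u i) \<in> J'" by auto
  have diff: "(\<lambda>x. f x - f u) \<in> J'" if f: "f \<in> poly_fun n" for f
  proof -
    obtain r where r: "\<forall>i<n. r i \<in> poly_fun n" "\<forall>x. f x - f u = (\<Sum>i<n. (x i - u i) * r i x)"
      using poly_fun_difference_expansion[OF f] by blast
    have "(\<lambda>x. \<Sum>i<n. (x i - u i) * r i x) \<in> J'"
    proof (rule poly_ideal_sum[OF J'(1)])
      fix i assume "i \<in> {..<n}"
      then have i: "i < n" by simp
      from poly_idealD(4)[OF J'(1) J'(4)[OF i] r(1)[rule_format, OF i]]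
      show "(\<lambda>x. (x i - u i) * r i x) \<in> J'" by (simp add: mult.commute)
    qed
    then show ?thesis using r(2) by simp
  qed
  have "f u = 0" if "f \<in> J" for f
  proof (rule ccontr)
    assume nz: "f u \<noteq> 0"
    have "f \<in> J'" "f \<in> poly_fun n" using that J'(2) poly_idealD(1)[OF J] by auto
    then have "(\<lambda>x. - inverse (f u) * ((f x - f u) - f x)) \<in> J'"
      by (intro poly_idealD(4)[OF J'(1)] poly_ideal_diff[OF J'(1)] diff poly_fun.const)
    then show False using J'(3)[of 0] nz by simp
  qed
  moreover have "q u \<noteq> 0"
  proof
    assume "q u = 0"
    then have "q \<in> J'" using diff[OF q] by simp
    then show False using J'(3)[of 1] by simp
  qed
  moreover have "f (restrict u {..<n}) = f u" if "f \<in> poly_fun n" for f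
    by (rule poly_fun_cong[OF that]) simp
  ultimately have "\<forall>f\<in>J. f (restrict u {..<n}) = 0" "q (restrict u {..<n}) \<noteq> 0"
    using poly_idealD(1)[OF J] q by metis+
  then show thesis by (intro that[of "restrict u {..<n}"]) auto
qed

section \<open>Hilbert's basis theorem\<close>

definition combinations ::
  "('x \<Rightarrow> complex) set \<Rightarrow> (nat \<Rightarrow> 'x \<Rightarrow> complex) \<Rightarrow> nat \<Rightarrow> ('x \<Rightarrow> complex) set" where
  "combinations R f k = {(\<lambda>x. \<Sum>i<k. b i x * f i x) | b. \<forall>i<k. b i \<in> R}"

lemma combinations_cong: "(\<And>i. i < k \<Longrightarrow> f i = g i) \<Longrightarrow> combinations R f k = combinations R g k"
  unfolding combinations_def by (intro Collect_cong ex_cong1 conj_cong refl) auto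

lemma poly_ideal_combinations:
  assumes "\<And>i. i < k \<Longrightarrow> f i \<in> poly_fun n"
  shows "poly_ideal n (combinations (poly_fun n) f k)"
  unfolding poly_ideal_def
proof (intro conjI ballI)
  show "combinations (poly_fun n) f k \<subseteq> poly_fun n"
    using assms unfolding combinations_def by (auto intro!: poly_fun_sum poly_fun.mult)
  show "(\<lambda>_. 0) \<in> combinations (poly_fun n) f k"
    unfolding combinations_def
    by (intro CollectI exI[of _ "\<lambda>_ _. 0"]) (auto intro: poly_fun.const)
next
  fix g h assume "g \<in> combinations (poly_fun n) f k" "h \<in> combinations (poly_fun n) f k"
  then obtain b c where "g = (\<lambda>x. \<Sum>i<k. b i x * f i x)" "\<And>i. i < k \<Longrightarrow> b i \<in> poly_fun n"
    "h = (\<lambda>x. \<Sum>i<k. c i x * f i x)" "\<And>i. i < k \<Longrightarrow> c i \<in> poly_fun n"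
    unfolding combinations_def by auto
  then show "(\<lambda>x. g x + h x) \<in> combinations (poly_fun n) f k"
    unfolding combinations_def
    by (intro CollectI exI[of _ "\<lambda>i x. b i x + c i x"])
       (auto intro: poly_fun.add simp: distrib_right sum.distrib)
next
  fix g h assume "g \<in> combinations (poly_fun n) f k" and h: "h \<in> poly_fun n"
  then obtain b where "g = (\<lambda>x. \<Sum>i<k. b i x * f i x)" "\<And>i. i < k \<Longrightarrow> b i \<in> poly_fun n"
    unfolding combinations_def by auto
  then show "(\<lambda>x. h x * g x) \<in> combinations (poly_fun n) f k"
    unfolding combinations_def using h
    by (intro CollectI exI[of _ "\<lambda>i x. h x * b i x"])
       (auto intro: poly_fun.mult simp: sum_distrib_left mult.assoc)
qed

lemma combinations_generator:
  assumes "i < k" shows "f i \<in> combinations (poly_fun n) f k"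
  unfolding combinations_def
proof (intro CollectI exI conjI allI impI)
  show "f i = (\<lambda>x. \<Sum>j<k. (if j = i then 1 else 0) * f j x)"
    using assms by (simp add: if_distrib[of "\<lambda>z. z * _"] sum.delta cong: if_cong)
  show "(\<lambda>x. if j = i then 1 else 0) \<in> poly_fun n" for j by (rule poly_fun.const)
qed

lemma combinations_subset_ideal:
  assumes "poly_ideal n J" "\<And>i. i < k \<Longrightarrow> f i \<in> J"
  shows "combinations (poly_fun n) f k \<subseteq> J"
  unfolding combinations_def using assms(2)
  by (auto intro!: poly_ideal_sum[OF assms(1)] poly_idealD(4)[OF assms(1)])

lemma combinations_mono:
  assumes "k \<le> m" "\<And>i. i < m \<Longrightarrow> f i \<in> poly_fun n"
  shows "combinations (poly_fun n) f k \<subseteq> combinations (poly_fun n) f m"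
  using assms by (intro combinations_subset_ideal poly_ideal_combinations combinations_generator) auto

text \<open>Stated for sequences, the form in which the ascending chain condition is used for descending chains
  of zero sets. For rings it is equivalent to finite generation of all ideals.\<close>

definition noetherian_ring_of_functions :: "('x \<Rightarrow> complex) set \<Rightarrow> bool" where
  "noetherian_ring_of_functions R \<longleftrightarrow> (\<forall>f. range f \<subseteq> R \<longrightarrow> (\<exists>m. f m \<in> combinations R f m))"

text \<open>The functions of degree less than \<open>d\<close> in \<open>x n\<close>, with coefficients that are polynomials in the earlier
  coordinates. The bound \<open>d\<close> refers to some representation of the function.\<close>

definition poly_in_last :: "nat \<Rightarrow> nat \<Rightarrow> ((nat \<Rightarrow> complex) \<Rightarrow> complex) set" where
  "poly_in_last n d = {(\<lambda>x. \<Sum>j<d. a j x * x n ^ j) | a. \<forall>j. a j \<in> poly_fun n}"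

lemma poly_in_lastI:
  "(\<And>j. a j \<in> poly_fun n) \<Longrightarrow> (\<And>x. f x = (\<Sum>j<d. a j x * x n ^ j)) \<Longrightarrow> f \<in> poly_in_last n d"
  unfolding poly_in_last_def by auto

lemma poly_in_lastE:
  assumes "f \<in> poly_in_last n d"
  obtains a where "\<And>j. a j \<in> poly_fun n" "\<And>x. f x = (\<Sum>j<d. a j x * x n ^ j)"
  using assms unfolding poly_in_last_def by auto

lemma poly_in_last_add:
  assumes "f \<in> poly_in_last n d" "g \<in> poly_in_last n d"
  shows "(\<lambda>x. f x + g x) \<in> poly_in_last n d"
  using assms
  by (elim poly_in_lastE, intro poly_in_lastI[where a = "\<lambda>j x. _ j x + _ j x"])
     (auto intro: poly_fun.add simp: distrib_right sum.distrib)

lemma poly_in_last_zero: "(\<lambda>x. 0) \<in> poly_in_last n d"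
  by (rule poly_in_lastI[where a = "\<lambda>_ _. 0"]) (auto intro: poly_fun.const)

lemma poly_in_last_sum:
  "(\<And>i. i \<in> I \<Longrightarrow> f i \<in> poly_in_last n d) \<Longrightarrow> (\<lambda>x. \<Sum>i\<in>I. f i x) \<in> poly_in_last n d"
  by (induction I rule: infinite_finite_induct) (auto intro: poly_in_last_zero poly_in_last_add)

lemma poly_in_last_scale:
  assumes "f \<in> poly_in_last n d" "b \<in> poly_fun n"
  shows "(\<lambda>x. b x * f x) \<in> poly_in_last n d"
  using assms
  by (elim poly_in_lastE, intro poly_in_lastI[where a = "\<lambda>j x. b x * _ j x"])
     (auto intro: poly_fun.mult simp: sum_distrib_left mult.assoc)

lemma poly_in_last_mono:
  assumes "f \<in> poly_in_last n d" "d \<le> e"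
  shows "f \<in> poly_in_last n e"
proof -
  obtain a where a: "\<And>j. a j \<in> poly_fun n" "\<And>x. f x = (\<Sum>j<d. a j x * x n ^ j)"
    using assms(1) by (rule poly_in_lastE) blast
  have "f x = (\<Sum>j<e. (if j < d then a j x else 0) * x n ^ j)" for x
    unfolding a(2) using assms(2) by (intro sum.mono_neutral_cong_left) auto
  moreover have "(\<lambda>x. if j < d then a j x else 0) \<in> poly_fun n" for j
    using a(1) by (cases "j < d") (auto intro: poly_fun.const)
  ultimately show ?thesis by (intro poly_in_lastI)
qed

lemma poly_in_last_shift:
  assumes "f \<in> poly_in_last n d"
  shows "(\<lambda>x. x n ^ k * f x) \<in> poly_in_last n (k + d)"
proof -
  obtain a where a: "\<And>j. a j \<in> poly_fun n" "\<And>x. f x = (\<Sum>j<d. a j x * x n ^ j)"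
    using assms(1) by (rule poly_in_lastE) blast
  have "x n ^ k * f x = (\<Sum>j<k + d. (if k \<le> j then a (j - k) x else 0) * x n ^ j)" for x
  proof -
    have "(\<Sum>j<k + d. (if k \<le> j then a (j - k) x else 0) * x n ^ j) =
        (\<Sum>j\<in>{k..<k + d}. a (j - k) x * x n ^ j)"
      by (rule sum.mono_neutral_cong_right) auto
    also have "\<dots> = (\<Sum>j<d. a j x * x n ^ (k + j))"
      by (rule sum.reindex_bij_witness[of _ "\<lambda>j. k + j" "\<lambda>j. j - k"]) auto
    finally show ?thesis by (simp add: a(2) sum_distrib_left power_add mult_ac)
  qed
  moreover have "(\<lambda>x. if k \<le> j then a (j - k) x else 0) \<in> poly_fun n" for j
    using a(1) by (cases "k \<le> j") (auto intro: poly_fun.const)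
  ultimately show ?thesis by (intro poly_in_lastI)
qed

lemma poly_fun_Suc_expansion:
  assumes "f \<in> poly_fun (Suc n)"
  shows "\<exists>d. f \<in> poly_in_last n d"
  using assms
proof induction
  case (const c)
  have "(\<lambda>_. c) \<in> poly_in_last n 1"
    by (rule poly_in_lastI[where a = "\<lambda>_ _. c"]) (auto intro: poly_fun.const)
  then show ?case ..
next
  case (coord i)
  show ?case
  proof (cases "i = n")
    case True
    have "(\<lambda>x. x n ^ 1 * 1) \<in> poly_in_last n (1 + 1)"
      by (intro poly_in_last_shift poly_in_lastI[where a = "\<lambda>_ _. 1"]) (auto intro: poly_fun.const)
    with True show ?thesis by auto
  next
    case False
    with coord have "(\<lambda>x. x i) \<in> poly_in_last n 1"
      by (intro poly_in_lastI[where a = "\<lambda>_ x. x i"]) (auto intro: poly_fun.coord)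
    then show ?thesis ..
  qed
next
  case (add f g)
  then obtain d e where "f \<in> poly_in_last n (max d e)" "g \<in> poly_in_last n (max d e)"
    using poly_in_last_mono by (meson max.cobounded1 max.cobounded2)
  then show ?case using poly_in_last_add by blast
next
  case (mult f g)
  then obtain d e where d: "f \<in> poly_in_last n d" and e: "g \<in> poly_in_last n e" by blast
  obtain a where a: "\<And>j. a j \<in> poly_fun n" "\<And>x. f x = (\<Sum>j<d. a j x * x n ^ j)"
    using d by (rule poly_in_lastE) blast
  have "(\<lambda>x. \<Sum>j<d. a j x * (x n ^ j * g x)) \<in> poly_in_last n (d + e)"
  proof (rule poly_in_last_sum, rule poly_in_last_scale[OF _ a(1)])
    fix j assume "j \<in> {..<d}"
    then show "(\<lambda>x. x n ^ j * g x) \<in> poly_in_last n (d + e)"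
      using poly_in_last_mono[OF poly_in_last_shift[OF e, of j]] by simp
  qed
  then show ?case unfolding a(2) sum_distrib_right by (auto simp: mult.assoc)
qed

lemma poly_fun_mono: "f \<in> poly_fun n \<Longrightarrow> n \<le> m \<Longrightarrow> f \<in> poly_fun m"
  by (induction rule: poly_fun.induct) (auto intro: poly_fun.intros)

text \<open>Hilbert's argument: choose successively elements \<open>g\<^sub>k\<close> of least degree in \<open>x n\<close> outside the ideal generated
  by the earlier ones. Some leading coefficient is a combination of the earlier leading coefficients, and subtracting
  the corresponding combination of the \<open>g\<^sub>i\<close> lowers the degree without entering that ideal.\<close>

lemma hilbert_basis_step:
  assumes "noetherian_ring_of_functions (poly_fun n)"
  shows "noetherian_ring_of_functions (poly_fun (Suc n))"
  unfolding noetherian_ring_of_functions_def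
proof (intro allI impI, rule ccontr)
  fix F assume F: "range F \<subseteq> poly_fun (Suc n)" and "\<nexists>m. F m \<in> combinations (poly_fun (Suc n)) F m"
  let ?R = "poly_fun (Suc n)"
  have Fm: "F m \<notin> combinations ?R F m" for m using \<open>\<nexists>m. _ m\<close> by blast
  have FR: "F i \<in> ?R" for i using F by blast
  define J where "J = (\<Union>k. combinations ?R F k)"
  have cmono: "combinations ?R F k \<subseteq> combinations ?R F l" if "k \<le> l" for k l
    using that FR by (intro combinations_mono)
  have cideal: "poly_ideal (Suc n) (combinations ?R F k)" for k
    using FR by (intro poly_ideal_combinations)
  have J: "poly_ideal (Suc n) J"
    unfolding poly_ideal_def
  proof (intro conjI ballI)
    show "J \<subseteq> ?R" unfolding J_def using poly_idealD(1)[OF cideal] by blast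
    show "(\<lambda>_. 0) \<in> J" unfolding J_def using poly_idealD(2)[OF cideal] by blast
  next
    fix f g assume "f \<in> J" "g \<in> J"
    then obtain k l where "f \<in> combinations ?R F k" "g \<in> combinations ?R F l"
      unfolding J_def by blast
    then have "f \<in> combinations ?R F (max k l)" "g \<in> combinations ?R F (max k l)"
      using cmono[of k "max k l"] cmono[of l "max k l"] by auto
    from poly_idealD(3)[OF cideal this] show "(\<lambda>x. f x + g x) \<in> J" unfolding J_def by blast
  next
    fix f g assume "f \<in> J" "g \<in> ?R"
    then show "(\<lambda>x. g x * f x) \<in> J" unfolding J_def using poly_idealD(4)[OF cideal] by blast
  qed
  \<comment> \<open>a finitely generated \<open>J\<close> would be generated by finitely many of the \<open>F i\<close>\<close>
  have not_generated: "\<exists>f\<in>J. f \<notin> combinations ?R g k" if g: "\<And>i. i < k \<Longrightarrow> g i \<in> J" for g k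
  proof -
    have "\<forall>i. \<exists>l. i < k \<longrightarrow> g i \<in> combinations ?R F l" using g unfolding J_def by blast
    then obtain l where l: "\<And>i. i < k \<Longrightarrow> g i \<in> combinations ?R F (l i)" by metis
    define N where "N = Max (insert 0 (l ` {..<k}))"
    have "g i \<in> combinations ?R F N" if "i < k" for i
    proof -
      have "l i \<le> N" unfolding N_def using that by (intro Max_ge) auto
      with l[OF that] cmono show ?thesis by blast
    qed
    then have "combinations ?R g k \<subseteq> combinations ?R F N"
      by (intro combinations_subset_ideal[OF cideal])
    with Fm[of N] have "F N \<notin> combinations ?R g k" by blast
    moreover have "F N \<in> J"
      unfolding J_def using combinations_generator[of N "Suc N" F] by blast
    ultimately show ?thesis by blast
  qed
  define deg where "deg f = (LEAST d. f \<in> poly_in_last n d)" for f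
  have deg: "f \<in> poly_in_last n (deg f)" if "f \<in> J" for f
    unfolding deg_def using poly_fun_Suc_expansion poly_idealD(1)[OF J that] by (metis LeastI)
  \<comment> \<open>an element of least degree outside the ideal generated by its predecessors\<close>
  let ?P = "\<lambda>g k f. f \<in> J \<and> f \<notin> combinations ?R g k \<and>
      (\<forall>f'\<in>J. f' \<notin> combinations ?R g k \<longrightarrow> deg f \<le> deg f')"
  have "\<exists>g. \<forall>k. ?P g k (g k)"
  proof (rule dependent_wf_choice[of less_than])
    fix g h :: "nat \<Rightarrow> (nat \<Rightarrow> complex) \<Rightarrow> complex" and k r
    assume "\<And>i. (i, k) \<in> less_than \<Longrightarrow> g i = h i"
    then have "combinations ?R g k = combinations ?R h k" by (intro combinations_cong) simp
    then show "?P g k r = ?P h k r" by simp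
  next
    fix k and g :: "nat \<Rightarrow> (nat \<Rightarrow> complex) \<Rightarrow> complex"
    assume "\<And>i. (i, k) \<in> less_than \<Longrightarrow> ?P g i (g i)"
    then obtain f where "f \<in> J \<and> f \<notin> combinations ?R g k"
      using not_generated[of k g] by auto
    from ex_has_least_nat[of "\<lambda>f. f \<in> J \<and> f \<notin> combinations ?R g k", OF this, of deg]
    show "\<exists>f. ?P g k f" by blast
  qed simp
  then obtain g where g: "\<And>k. g k \<in> J" "\<And>k. g k \<notin> combinations ?R g k"
    and least: "\<And>k f. f \<in> J \<Longrightarrow> f \<notin> combinations ?R g k \<Longrightarrow> deg (g k) \<le> deg f" by blast
  have gR: "g k \<in> ?R" for k using g(1) poly_idealD(1)[OF J] by blast
  have gideal: "poly_ideal (Suc n) (combinations ?R g k)" for k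
    using gR by (intro poly_ideal_combinations)
  have deg_mono: "deg (g k) \<le> deg (g m)" if "k \<le> m" for k m
    using combinations_mono[OF that, of g "Suc n"] gR g by (intro least) auto
  obtain a where a: "\<And>k j. a k j \<in> poly_fun n"
    "\<And>k x. g k x = (\<Sum>j<deg (g k). a k j x * x n ^ j)"
  proof -
    have "\<forall>k. \<exists>a. (\<forall>j. a j \<in> poly_fun n) \<and> (\<forall>x. g k x = (\<Sum>j<deg (g k). a j x * x n ^ j))"
    proof
      fix k
      show "\<exists>a. (\<forall>j. a j \<in> poly_fun n) \<and> (\<forall>x. g k x = (\<Sum>j<deg (g k). a j x * x n ^ j))"
        using deg[OF g(1)[of k]] by (rule poly_in_lastE) blast
    qed
    from choice[OF this] show ?thesis using that by blast
  qed
  have deg_pos: "deg (g k) > 0" for k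
  proof (rule ccontr)
    assume "\<not> ?thesis"
    then have "g k = (\<lambda>_. 0)" using a(2)[of k] by auto
    with g(2)[of k] poly_idealD(2)[OF gideal] show False by simp
  qed
  define lead where "lead k = a k (deg (g k) - 1)" for k
  have split_lead: "(\<lambda>x. g k x - lead k x * x n ^ (deg (g k) - 1)) \<in> poly_in_last n (deg (g k) - 1)" for k
  proof (rule poly_in_lastI[OF a(1)])
    fix x
    obtain e where "deg (g k) = Suc e" using deg_pos gr0_conv_Suc by blast
    then show "g k x - lead k x * x n ^ (deg (g k) - 1) = (\<Sum>j<deg (g k) - 1. a k j x * x n ^ j)"
      unfolding a(2)[of k x] lead_def by simp
  qed
  have "range lead \<subseteq> poly_fun n" unfolding lead_def using a(1) by blast
  then obtain m b where b: "\<And>i. i < m \<Longrightarrow> b i \<in> poly_fun n"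
    "\<And>x. lead m x = (\<Sum>i<m. b i x * lead i x)"
  proof -
    obtain m where "lead m \<in> combinations (poly_fun n) lead m"
      using assms \<open>range lead \<subseteq> _\<close> unfolding noetherian_ring_of_functions_def by blast
    then obtain b where "lead m = (\<lambda>x. \<Sum>i<m. b i x * lead i x)" "\<forall>i<m. b i \<in> poly_fun n"
      unfolding combinations_def by blast
    then show ?thesis using that[of m b] by metis
  qed
  let ?e = "\<lambda>i. deg (g m) - deg (g i)"
  \<comment> \<open>the leading terms of degree \<open>deg (g m) - 1\<close> cancel\<close>
  let ?h = "\<lambda>x. g m x - (\<Sum>i<m. b i x * (x n ^ ?e i * g i x))"
  have xn: "(\<lambda>x. x n ^ k) \<in> ?R" for k by (intro poly_fun_power poly_fun.coord) simp
  have bR: "b i \<in> ?R" if "i < m" for i using b(1)[OF that] by (rule poly_fun_mono) simp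
  have comb: "(\<lambda>x. \<Sum>i<m. b i x * (x n ^ ?e i * g i x)) \<in> combinations ?R g m"
  proof (rule poly_ideal_sum[OF gideal])
    fix i assume "i \<in> {..<m}"
    then have "i < m" by simp
    show "(\<lambda>x. b i x * (x n ^ ?e i * g i x)) \<in> combinations ?R g m"
      by (rule poly_idealD(4)[OF gideal poly_idealD(4)[OF gideal
            combinations_generator[OF \<open>i < m\<close>] xn] bR[OF \<open>i < m\<close>]])
  qed
  have "?h \<notin> combinations ?R g m"
  proof
    assume "?h \<in> combinations ?R g m"
    from poly_idealD(3)[OF gideal this comb] g(2)[of m] show False by simp
  qed
  moreover have "?h \<in> J"
    using comb combinations_subset_ideal[OF J, of m g] g(1) by (intro poly_ideal_diff[OF J]) auto
  ultimately have "deg (g m) \<le> deg ?h" by (intro least)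
  moreover have "?h \<in> poly_in_last n (deg (g m) - 1)"
  proof -
    have "(\<lambda>x. (g m x - lead m x * x n ^ (deg (g m) - 1)) +
        (\<Sum>i<m. (- b i x) * (x n ^ ?e i * (g i x - lead i x * x n ^ (deg (g i) - 1)))))
      \<in> poly_in_last n (deg (g m) - 1)"
    proof (rule poly_in_last_add[OF split_lead], rule poly_in_last_sum, rule poly_in_last_scale)
      fix i assume i: "i \<in> {..<m}"
      then show "(\<lambda>x. - b i x) \<in> poly_fun n" using b(1) by (intro poly_fun_minus) simp
      from i have "?e i + (deg (g i) - 1) = deg (g m) - 1"
        using deg_mono[of i m] deg_pos[of i] by simp
      then show "(\<lambda>x. x n ^ ?e i * (g i x - lead i x * x n ^ (deg (g i) - 1)))
          \<in> poly_in_last n (deg (g m) - 1)"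
        using poly_in_last_shift[OF split_lead[of i], of "?e i"] by simp
    qed
    moreover have "(g m x - lead m x * x n ^ (deg (g m) - 1)) +
        (\<Sum>i<m. (- b i x) * (x n ^ ?e i * (g i x - lead i x * x n ^ (deg (g i) - 1)))) = ?h x" for x
    proof -
      have "b i x * (x n ^ ?e i * (lead i x * x n ^ (deg (g i) - 1))) =
          b i x * lead i x * x n ^ (deg (g m) - 1)" if "i < m" for i
      proof -
        have "?e i + (deg (g i) - 1) = deg (g m) - 1"
          using deg_mono[of i m] deg_pos[of i] that by simp
        then have "x n ^ ?e i * x n ^ (deg (g i) - 1) = x n ^ (deg (g m) - 1)"
          by (simp flip: power_add)
        then show ?thesis by (simp add: mult_ac)
      qed
      then have "(\<Sum>i<m. b i x * (x n ^ ?e i * (lead i x * x n ^ (deg (g i) - 1)))) =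
          lead m x * x n ^ (deg (g m) - 1)"
        unfolding b(2) sum_distrib_right by (intro sum.cong refl) simp
      then show ?thesis by (simp add: right_diff_distrib sum_subtractf sum_negf)
    qed
    ultimately show ?thesis by (simp only:)
  qed
  then have "deg ?h \<le> deg (g m) - 1" unfolding deg_def[of ?h] by (rule Least_le)
  ultimately show False using deg_pos[of m] by simp
qed

theorem hilbert_basis: "noetherian_ring_of_functions (poly_fun n)"
proof (induction n)
  case 0
  have const: "\<exists>c. f = (\<lambda>_. c)" if "f \<in> poly_fun 0" for f
    using that by induction auto
  show ?case
    unfolding noetherian_ring_of_functions_def
  proof (intro allI impI)
    fix f :: "nat \<Rightarrow> (nat \<Rightarrow> complex) \<Rightarrow> complex" assume "range f \<subseteq> poly_fun 0"
    then obtain c d where c: "f 0 = (\<lambda>_. c)" "f 1 = (\<lambda>_. d)" using const by (metis range_subsetD)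
    show "\<exists>m. f m \<in> combinations (poly_fun 0) f m"
    proof (cases "c = 0")
      case True
      then have "f 0 \<in> combinations (poly_fun 0) f 0" using c unfolding combinations_def by auto
      then show ?thesis ..
    next
      case False
      then have "f 1 \<in> combinations (poly_fun 0) f 1" using c unfolding combinations_def
        by (intro CollectI exI[of _ "\<lambda>_ _. d / c"]) (auto intro: poly_fun.const)
      then show ?thesis ..
    qed
  qed
next
  case (Suc n)
  then show ?case by (rule hilbert_basis_step)
qed

text \<open>A function vanishing on \<open>Z (Suc i)\<close> but not on \<open>Z i\<close>, for every \<open>i\<close>, gives a sequence in which no
  element is a combination of the earlier ones. The map \<open>\<phi>\<close> will be an affine chart.\<close>

lemma no_strictly_decreasing_zero_loci:
  assumes "\<And>i. Z (Suc i) \<subset> Z i" "\<And>i. \<exists>G \<subseteq> poly_fun n. Z i = {x \<in> X. \<forall>g\<in>G. g (\<phi> x) = 0}"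
  shows False
proof -
  have "\<forall>i. \<exists>g. g \<in> poly_fun n \<and> (\<exists>x\<in>Z i. g (\<phi> x) \<noteq> 0) \<and> (\<forall>y\<in>Z (Suc i). g (\<phi> y) = 0)"
  proof
    fix i
    obtain G where G: "G \<subseteq> poly_fun n" "Z (Suc i) = {x \<in> X. \<forall>g\<in>G. g (\<phi> x) = 0}"
      using assms(2)[of "Suc i"] by blast
    obtain x where x: "x \<in> Z i" "x \<notin> Z (Suc i)"
      using psubset_imp_ex_mem[OF assms(1)[of i]] by blast
    moreover have "Z i \<subseteq> X" using assms(2)[of i] by blast
    ultimately obtain g where "g \<in> G" "g (\<phi> x) \<noteq> 0" using G by blast
    with x G show "\<exists>g. g \<in> poly_fun n \<and> (\<exists>x\<in>Z i. g (\<phi> x) \<noteq> 0) \<and> (\<forall>y\<in>Z (Suc i). g (\<phi> y) = 0)"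
      by auto
  qed
  then obtain g where "\<forall>i. g i \<in> poly_fun n \<and> (\<exists>x\<in>Z i. g i (\<phi> x) \<noteq> 0) \<and>
      (\<forall>y\<in>Z (Suc i). g i (\<phi> y) = 0)"
    by (rule choice[THEN exE])
  then have g: "\<And>i. g i \<in> poly_fun n" "\<And>i. \<exists>x\<in>Z i. g i (\<phi> x) \<noteq> 0"
    "\<And>i y. y \<in> Z (Suc i) \<Longrightarrow> g i (\<phi> y) = 0" by blast+
  have "range g \<subseteq> poly_fun n" using g(1) by blast
  then obtain m where "g m \<in> combinations (poly_fun n) g m"
    using hilbert_basis[of n] unfolding noetherian_ring_of_functions_def by blast
  then obtain b where b: "g m = (\<lambda>u. \<Sum>i<m. b i u * g i u)"
    unfolding combinations_def by blast
  have dec: "Z j \<subseteq> Z i" if "i \<le> j" for i j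
    by (rule lift_Suc_antimono_le[where f = Z, OF psubset_imp_subset[OF assms(1)] that])
  have "g m (\<phi> x) = 0" if "x \<in> Z m" for x
  proof -
    have "g i (\<phi> x) = 0" if "i < m" for i
      using \<open>x \<in> Z m\<close> dec[of "Suc i" m] that by (intro g(3)) auto
    then show ?thesis by (subst b) simp
  qed
  with g(2) show False by blast
qed

section \<open>Affine charts\<close>

text \<open>The regular functions of an affine variety, pulled back along \<open>\<phi>\<close>. The shrinking of neighbourhoods is absorbed
  into the denominator \<open>h\<close>.\<close>

definition locally_quotient ::
  "nat \<Rightarrow> ('a \<Rightarrow> nat \<Rightarrow> complex) \<Rightarrow> 'a set \<Rightarrow> ('a \<Rightarrow> complex) \<Rightarrow> bool" where
  "locally_quotient n \<phi> W f \<longleftrightarrow>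
     (\<forall>p\<in>W. \<exists>g\<in>poly_fun n. \<exists>h\<in>poly_fun n. h (\<phi> p) \<noteq> 0 \<and>
        (\<forall>u\<in>W. h (\<phi> u) \<noteq> 0 \<longrightarrow> f u = g (\<phi> u) / h (\<phi> u)))"

text \<open>An isomorphism of \<open>U\<close> with an affine variety, reduced to its coordinate map \<open>\<phi>\<close>: topology and
  regular functions on \<open>U\<close> are described by polynomial functions composed with \<open>\<phi>\<close>.\<close>

definition affine_chart :: "'a fspace \<Rightarrow> 'a set \<Rightarrow> nat \<Rightarrow> ('a \<Rightarrow> nat \<Rightarrow> complex) \<Rightarrow> bool" where
  "affine_chart X U n \<phi> \<longleftrightarrow>
     openin (zar X) U \<and> inj_on \<phi> U \<and> algebraic_set n (\<phi> ` U) \<and>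
     (\<forall>W\<subseteq>U. openin (zar X) W \<longleftrightarrow>
        (\<forall>p\<in>W. \<exists>f\<in>poly_fun n. f (\<phi> p) \<noteq> 0 \<and> {u \<in> U. f (\<phi> u) \<noteq> 0} \<subseteq> W)) \<and>
     (\<forall>W\<subseteq>U. \<forall>f. openin (zar X) W \<longrightarrow> (reg X W f \<longleftrightarrow> locally_quotient n \<phi> W f))"

lemma zar_affine_fspace:
  "zar (affine_fspace n Z) = topology_generated_by {{x \<in> Z. f x \<noteq> 0} | f. f \<in> poly_fun n}"
  by (simp add: affine_fspace_def Let_def)

text \<open>Principal open sets are closed under intersection, so they are a basis and not only a subbasis.\<close>

lemma openin_affine_fspace:
  "openin (zar (affine_fspace n Z)) W \<longleftrightarrow>
     W \<subseteq> Z \<and> (\<forall>p\<in>W. \<exists>f\<in>poly_fun n. f p \<noteq> 0 \<and> {z \<in> Z. f z \<noteq> 0} \<subseteq> W)"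
proof -
  let ?B = "{{x \<in> Z. f x \<noteq> 0} | f. f \<in> poly_fun n}"
  have "W \<subseteq> Z \<and> (\<forall>p\<in>W. \<exists>f\<in>poly_fun n. f p \<noteq> 0 \<and> {z \<in> Z. f z \<noteq> 0} \<subseteq> W)"
    if "generate_topology_on ?B W"
    using that
  proof induction
    case (Int a b)
    have "\<exists>f\<in>poly_fun n. f p \<noteq> 0 \<and> {z \<in> Z. f z \<noteq> 0} \<subseteq> a \<inter> b" if p: "p \<in> a \<inter> b" for p
    proof -
      obtain f g where "f \<in> poly_fun n" "f p \<noteq> 0" "{z \<in> Z. f z \<noteq> 0} \<subseteq> a"
        "g \<in> poly_fun n" "g p \<noteq> 0" "{z \<in> Z. g z \<noteq> 0} \<subseteq> b"
        using Int.IH p by blast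
      then show ?thesis by (intro bexI[of _ "\<lambda>x. f x * g x"] poly_fun.mult) auto
    qed
    with Int.IH show ?case by blast
  next
    case (UN K)
    have "\<exists>f\<in>poly_fun n. f p \<noteq> 0 \<and> {z \<in> Z. f z \<noteq> 0} \<subseteq> \<Union>K" if "p \<in> \<Union>K" for p
    proof -
      obtain k where k: "k \<in> K" "p \<in> k" using \<open>p \<in> \<Union>K\<close> by (rule UnionE)
      obtain f where "f \<in> poly_fun n" "f p \<noteq> 0" "{z \<in> Z. f z \<noteq> 0} \<subseteq> k"
        using UN.IH[OF k(1)] k(2) by blast
      then show ?thesis using Union_upper[OF k(1)] by (intro bexI[of _ f] conjI) simp_all
    qed
    moreover have "\<Union>K \<subseteq> Z" using UN.IH by (intro Union_least) simp
    ultimately show ?case by simp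
  next
    case (Basis s)
    then obtain f where "f \<in> poly_fun n" "s = {x \<in> Z. f x \<noteq> 0}" by blast
    then show ?case by auto
  qed simp
  moreover have "generate_topology_on ?B W"
    if W: "W \<subseteq> Z" and basis: "\<And>p. p \<in> W \<Longrightarrow> \<exists>f\<in>poly_fun n. f p \<noteq> 0 \<and> {z \<in> Z. f z \<noteq> 0} \<subseteq> W"
  proof -
    have "W = \<Union>{V \<in> ?B. V \<subseteq> W}"
    proof
      show "W \<subseteq> \<Union>{V \<in> ?B. V \<subseteq> W}"
      proof
        fix p assume p: "p \<in> W"
        then obtain f where f: "f \<in> poly_fun n" "f p \<noteq> 0" "{z \<in> Z. f z \<noteq> 0} \<subseteq> W"
          using basis by blast
        moreover have "p \<in> {z \<in> Z. f z \<noteq> 0}" using f p W by auto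
        ultimately show "p \<in> \<Union>{V \<in> ?B. V \<subseteq> W}" by blast
      qed
    qed blast
    moreover have "generate_topology_on ?B (\<Union>{V \<in> ?B. V \<subseteq> W})"
      by (rule generate_topology_on.UN, rule generate_topology_on.Basis) simp
    ultimately show ?thesis by simp
  qed
  ultimately show ?thesis
    unfolding zar_affine_fspace openin_topology_generated_by_iff by blast
qed

lemma points_affine_fspace: "points (affine_fspace n Z) = Z"
proof -
  have "Z \<in> {{x \<in> Z. f x \<noteq> 0} | f. f \<in> poly_fun n}"
    by (rule CollectI, rule exI[of _ "\<lambda>_. 1"]) (simp add: poly_fun.const)
  then show ?thesis unfolding zar_affine_fspace topology_generated_by_topspace by blast
qed

lemma reg_affine_fspace:
  assumes "openin (zar (affine_fspace n Z)) W"
  shows "reg (affine_fspace n Z) W f \<longleftrightarrow> locally_quotient n (\<lambda>x. x) W f"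
proof -
  let ?T = "zar (affine_fspace n Z)"
  have "reg (affine_fspace n Z) W f \<longleftrightarrow> (\<forall>p\<in>W. \<exists>V. openin ?T V \<and> p \<in> V \<and> V \<subseteq> W \<and>
      (\<exists>g\<in>poly_fun n. \<exists>h\<in>poly_fun n. \<forall>x\<in>V. h x \<noteq> 0 \<and> f x = g x / h x))"
    by (simp add: affine_fspace_def Let_def)
  also have "\<dots> \<longleftrightarrow> locally_quotient n (\<lambda>x. x) W f"
    unfolding locally_quotient_def
  proof (intro ball_cong refl iffI)
    fix p assume p: "p \<in> W"
      and "\<exists>V. openin ?T V \<and> p \<in> V \<and> V \<subseteq> W \<and>
        (\<exists>g\<in>poly_fun n. \<exists>h\<in>poly_fun n. \<forall>x\<in>V. h x \<noteq> 0 \<and> f x = g x / h x)"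
    then obtain V g h where V: "openin ?T V" "p \<in> V" "V \<subseteq> W"
      and gh: "g \<in> poly_fun n" "h \<in> poly_fun n" "\<And>x. x \<in> V \<Longrightarrow> h x \<noteq> 0 \<and> f x = g x / h x"
      by blast
    obtain k where k: "k \<in> poly_fun n" "k p \<noteq> 0" "{z \<in> Z. k z \<noteq> 0} \<subseteq> V"
      using V unfolding openin_affine_fspace by blast
    have "W \<subseteq> Z" using assms unfolding openin_affine_fspace by blast
    show "\<exists>g\<in>poly_fun n. \<exists>h\<in>poly_fun n. h p \<noteq> 0 \<and> (\<forall>u\<in>W. h u \<noteq> 0 \<longrightarrow> f u = g u / h u)"
    proof (rule bexI[of _ "\<lambda>x. g x * k x"], rule bexI[of _ "\<lambda>x. h x * k x"], intro conjI ballI impI)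
      show "(\<lambda>x. g x * k x) \<in> poly_fun n" "(\<lambda>x. h x * k x) \<in> poly_fun n"
        using gh k by (auto intro: poly_fun.mult)
      show "h p * k p \<noteq> 0" using gh(3)[OF V(2)] k(2) by simp
      fix u assume "u \<in> W" "h u * k u \<noteq> 0"
      moreover from this k(3) \<open>W \<subseteq> Z\<close> have "u \<in> V" by auto
      ultimately show "f u = g u * k u / (h u * k u)" using gh(3)[of u] by simp
    qed
  next
    fix p assume p: "p \<in> W"
      and "\<exists>g\<in>poly_fun n. \<exists>h\<in>poly_fun n. h p \<noteq> 0 \<and> (\<forall>u\<in>W. h u \<noteq> 0 \<longrightarrow> f u = g u / h u)"
    then obtain g h where gh: "g \<in> poly_fun n" "h \<in> poly_fun n" "h p \<noteq> 0"
      "\<forall>u\<in>W. h u \<noteq> 0 \<longrightarrow> f u = g u / h u" by blast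
    have "openin ?T {z \<in> Z. h z \<noteq> 0}"
      unfolding openin_affine_fspace using gh(2) by blast
    then have "openin ?T (W \<inter> {z \<in> Z. h z \<noteq> 0})" using assms by (intro openin_Int)
    moreover have "W \<subseteq> Z" using assms unfolding openin_affine_fspace by blast
    ultimately show "\<exists>V. openin ?T V \<and> p \<in> V \<and> V \<subseteq> W \<and>
        (\<exists>g\<in>poly_fun n. \<exists>h\<in>poly_fun n. \<forall>x\<in>V. h x \<noteq> 0 \<and> f x = g x / h x)"
      using gh p by (intro exI[of _ "W \<inter> {z \<in> Z. h z \<noteq> 0}"]) auto
  qed
  finally show ?thesis .
qed

lemma zar_induced: "zar (induced X U) = subtopology (zar X) U"
  by (simp add: induced_def)

lemma space_with_functionsD:
  assumes "space_with_functions X" "openin (zar X) U"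
  shows reg_cong: "reg X U f \<Longrightarrow> (\<And>x. x \<in> U \<Longrightarrow> g x = f x) \<Longrightarrow> reg X U g"
    and reg_const: "reg X U (\<lambda>_. c)"
    and reg_add: "reg X U f \<Longrightarrow> reg X U g \<Longrightarrow> reg X U (\<lambda>x. f x + g x)"
    and reg_mult: "reg X U f \<Longrightarrow> reg X U g \<Longrightarrow> reg X U (\<lambda>x. f x * g x)"
    and reg_restrict: "openin (zar X) V \<Longrightarrow> V \<subseteq> U \<Longrightarrow> reg X U f \<Longrightarrow> reg X V f"
    and reg_local: "(\<And>p. p \<in> U \<Longrightarrow> \<exists>V. openin (zar X) V \<and> p \<in> V \<and> V \<subseteq> U \<and> reg X V f) \<Longrightarrow> reg X U f"
proof -
  note X = assms(1)[unfolded space_with_functions_def]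
  show "reg X U f \<Longrightarrow> (\<And>x. x \<in> U \<Longrightarrow> g x = f x) \<Longrightarrow> reg X U g"
    using X[THEN conjunct1] assms(2) by simp
  show "reg X U (\<lambda>_. c)"
    using X[THEN conjunct2, THEN conjunct1] assms(2) by simp
  show "reg X U f \<Longrightarrow> reg X U g \<Longrightarrow> reg X U (\<lambda>x. f x + g x)"
    "reg X U f \<Longrightarrow> reg X U g \<Longrightarrow> reg X U (\<lambda>x. f x * g x)"
    using X[THEN conjunct2, THEN conjunct2, THEN conjunct1] assms(2) by simp_all
  show "openin (zar X) V \<Longrightarrow> V \<subseteq> U \<Longrightarrow> reg X U f \<Longrightarrow> reg X V f"
    using X[THEN conjunct2, THEN conjunct2, THEN conjunct2, THEN conjunct1] assms(2) by simp
  show "(\<And>p. p \<in> U \<Longrightarrow> \<exists>V. openin (zar X) V \<and> p \<in> V \<and> V \<subseteq> U \<and> reg X V f) \<Longrightarrow> reg X U f"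
    using X[THEN conjunct2, THEN conjunct2, THEN conjunct2, THEN conjunct2] assms(2) by simp
qed

lemma reg_induced_open:
  assumes X: "space_with_functions X" and U: "openin (zar X) U"
    and W: "openin (zar X) W" "W \<subseteq> U"
  shows "reg (induced X U) W f \<longleftrightarrow> reg X W f"
proof
  assume "reg X W f"
  then show "reg (induced X U) W f" using W by (auto simp: induced_def)
next
  assume *: "reg (induced X U) W f"
  show "reg X W f"
  proof (rule reg_local[OF X W(1)])
    fix p assume "p \<in> W"
    with * obtain V F where V: "openin (zar X) V" "p \<in> V" "reg X V F" "\<And>x. x \<in> V \<inter> W \<Longrightarrow> f x = F x"
      unfolding induced_def by auto
    have VW: "openin (zar X) (V \<inter> W)" using V(1) W(1) by (rule openin_Int)
    have "reg X (V \<inter> W) F" using V by (intro reg_restrict[OF X V(1) VW]) auto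
    then have "reg X (V \<inter> W) f" using V(4) by (rule reg_cong[OF X VW])
    with VW V(2) \<open>p \<in> W\<close> show "\<exists>V. openin (zar X) V \<and> p \<in> V \<and> V \<subseteq> W \<and> reg X V f" by blast
  qed
qed

lemma affine_open_has_chart:
  assumes X: "space_with_functions X" and U: "openin (zar X) U" and "affine_variety (induced X U)"
  shows "\<exists>n \<phi>. affine_chart X U n \<phi>"
proof -
  let ?Y = "induced X U"
  obtain n Z where Z: "algebraic_set n Z" "isomorphic ?Y (affine_fspace n Z)"
    using assms(3) unfolding affine_variety_def by blast
  let ?A = "affine_fspace n Z"
  obtain \<phi> \<psi> where \<phi>: "morphism ?Y ?A \<phi>" and \<psi>: "morphism ?A ?Y \<psi>"
    and inv1: "\<forall>x\<in>points ?Y. \<psi> (\<phi> x) = x" and inv2: "\<forall>y\<in>points ?A. \<phi> (\<psi> y) = y"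
    using Z(2) unfolding isomorphic_def by blast
  have pY: "points ?Y = U" using openin_subset[OF U] by (auto simp: zar_induced)
  have pA: "points ?A = Z" by (rule points_affine_fspace)
  have cont: "continuous_map (zar ?Y) (zar ?A) \<phi>" "continuous_map (zar ?A) (zar ?Y) \<psi>"
    using \<phi> \<psi> unfolding morphism_def by auto
  have map: "\<And>u. u \<in> U \<Longrightarrow> \<phi> u \<in> Z" "\<And>z. z \<in> Z \<Longrightarrow> \<psi> z \<in> U"
    using cont pY pA by (auto simp: continuous_map_def)
  have inv: "\<And>u. u \<in> U \<Longrightarrow> \<psi> (\<phi> u) = u" "\<And>z. z \<in> Z \<Longrightarrow> \<phi> (\<psi> z) = z"
    using inv1 inv2 pY pA by auto
  have im: "\<phi> ` U = Z"
  proof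
    show "\<phi> ` U \<subseteq> Z" using map(1) by (rule image_subsetI)
    show "Z \<subseteq> \<phi> ` U"
    proof
      fix z assume "z \<in> Z"
      then show "z \<in> \<phi> ` U" using map(2)[of z] inv(2)[of z] by (intro image_eqI[of _ _ "\<psi> z"]) simp_all
    qed
  qed
  have inj: "inj_on \<phi> U" by (rule inj_on_inverseI[of U \<psi>]) (rule inv(1))
  have openY: "openin (zar ?Y) W \<longleftrightarrow> openin (zar X) W" if "W \<subseteq> U" for W
    using that openin_open_subtopology[OF U] by (simp add: zar_induced)
  have image_eq: "\<phi> ` W = {z \<in> Z. \<psi> z \<in> W}" if "W \<subseteq> U" for W
  proof
    show "\<phi> ` W \<subseteq> {z \<in> Z. \<psi> z \<in> W}" using map(1) inv(1) subsetD[OF that] by auto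
    show "{z \<in> Z. \<psi> z \<in> W} \<subseteq> \<phi> ` W"
    proof
      fix z assume "z \<in> {z \<in> Z. \<psi> z \<in> W}"
      then show "z \<in> \<phi> ` W" using inv(2)[of z] by (intro image_eqI[of _ _ "\<psi> z"]) auto
    qed
  qed
  have preimage_eq: "W = {u \<in> U. \<phi> u \<in> \<phi> ` W}" if "W \<subseteq> U" for W
    using that inj_on_image_mem_iff[OF inj _ that] by blast
  have open_iff: "openin (zar X) W \<longleftrightarrow> openin (zar ?A) (\<phi> ` W)" if "W \<subseteq> U" for W
  proof
    assume "openin (zar X) W"
    then have "openin (zar ?A) {z \<in> points ?A. \<psi> z \<in> W}"
      using openin_continuous_map_preimage[OF cont(2)] openY[OF that] by blast
    then show "openin (zar ?A) (\<phi> ` W)" by (simp add: image_eq[OF that] pA)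
  next
    assume "openin (zar ?A) (\<phi> ` W)"
    then have "openin (zar ?Y) {u \<in> points ?Y. \<phi> u \<in> \<phi> ` W}"
      using openin_continuous_map_preimage[OF cont(1)] by blast
    then have "openin (zar ?Y) W" using preimage_eq[OF that] pY by simp
    then show "openin (zar X) W" using openY[OF that] by simp
  qed
  have open_chart: "openin (zar X) W \<longleftrightarrow>
      (\<forall>p\<in>W. \<exists>f\<in>poly_fun n. f (\<phi> p) \<noteq> 0 \<and> {u \<in> U. f (\<phi> u) \<noteq> 0} \<subseteq> W)" if "W \<subseteq> U" for W
  proof -
    have sub: "{z \<in> Z. f z \<noteq> 0} \<subseteq> \<phi> ` W \<longleftrightarrow> {u \<in> U. f (\<phi> u) \<noteq> 0} \<subseteq> W" for f
    proof
      assume *: "{z \<in> Z. f z \<noteq> 0} \<subseteq> \<phi> ` W"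
      show "{u \<in> U. f (\<phi> u) \<noteq> 0} \<subseteq> W"
      proof
        fix u assume "u \<in> {u \<in> U. f (\<phi> u) \<noteq> 0}"
        then have u: "u \<in> U" "\<phi> u \<in> {z \<in> Z. f z \<noteq> 0}" using map by auto
        with * obtain w where "w \<in> W" "\<phi> u = \<phi> w" by blast
        with u that inj show "u \<in> W" by (metis inj_onD subsetD)
      qed
    next
      assume *: "{u \<in> U. f (\<phi> u) \<noteq> 0} \<subseteq> W"
      show "{z \<in> Z. f z \<noteq> 0} \<subseteq> \<phi> ` W"
        unfolding im[symmetric] using * by blast
    qed
    have "\<phi> ` W \<subseteq> Z" using that map(1) by (intro image_subsetI) blast
    then show ?thesis
      unfolding open_iff[OF that] openin_affine_fspace sub by simp
  qed
  have reg_chart: "reg X W f \<longleftrightarrow> locally_quotient n \<phi> W f" if W: "W \<subseteq> U" "openin (zar X) W" for W f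
  proof -
    have oW: "openin (zar ?A) (\<phi> ` W)" "openin (zar ?Y) W"
      using open_iff[OF W(1)] openY[OF W(1)] W(2) by auto
    have "reg X W f \<longleftrightarrow> reg ?Y W f"
      using reg_induced_open[OF X U W(2,1)] by simp
    also have "\<dots> \<longleftrightarrow> reg ?A (\<phi> ` W) (\<lambda>z. f (\<psi> z))"
    proof
      assume "reg ?Y W f"
      from \<psi>[unfolded morphism_def, THEN conjunct2, rule_format, OF oW(2) this]
      show "reg ?A (\<phi> ` W) (\<lambda>z. f (\<psi> z))" by (simp add: image_eq[OF W(1)] pA)
    next
      assume "reg ?A (\<phi> ` W) (\<lambda>z. f (\<psi> z))"
      from \<phi>[unfolded morphism_def, THEN conjunct2, rule_format, OF oW(1) this]
      have "reg ?Y {u \<in> U. \<phi> u \<in> \<phi> ` W} (\<lambda>u. f (\<psi> (\<phi> u)))"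
        by (simp only: pY)
      then have "reg ?Y W (\<lambda>u. f (\<psi> (\<phi> u)))" using preimage_eq[OF W(1)] by simp
      then have "reg X W (\<lambda>u. f (\<psi> (\<phi> u)))" using reg_induced_open[OF X U W(2,1)] by simp
      from this have "reg X W f"
      proof (rule reg_cong[OF X W(2)])
        fix u assume "u \<in> W"
        then show "f u = f (\<psi> (\<phi> u))" using inv(1)[of u] W(1) by auto
      qed
      then show "reg ?Y W f" using reg_induced_open[OF X U W(2,1)] by simp
    qed
    also have "\<dots> \<longleftrightarrow> locally_quotient n (\<lambda>x. x) (\<phi> ` W) (\<lambda>z. f (\<psi> z))"
      by (rule reg_affine_fspace[OF oW(1)])
    also have "\<dots> \<longleftrightarrow> locally_quotient n \<phi> W f"
      unfolding locally_quotient_def using subsetD[OF W(1)] inv(1) by (simp cong: ball_cong)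
    finally show ?thesis .
  qed
  show ?thesis
    unfolding affine_chart_def using U inj im Z(1) open_chart reg_chart
    by (intro exI[of _ n] exI[of _ \<phi>] conjI allI impI) simp_all
qed

lemma affine_chartD:
  assumes "affine_chart X U n \<phi>"
  shows chart_open: "openin (zar X) U"
    and chart_inj: "inj_on \<phi> U"
    and chart_algebraic: "algebraic_set n (\<phi> ` U)"
    and chart_openin: "W \<subseteq> U \<Longrightarrow> openin (zar X) W \<longleftrightarrow>
        (\<forall>p\<in>W. \<exists>f\<in>poly_fun n. f (\<phi> p) \<noteq> 0 \<and> {u \<in> U. f (\<phi> u) \<noteq> 0} \<subseteq> W)"
    and chart_reg: "W \<subseteq> U \<Longrightarrow> openin (zar X) W \<Longrightarrow> reg X W f \<longleftrightarrow> locally_quotient n \<phi> W f"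
  using assms unfolding affine_chart_def by blast+

lemma chart_principal_open:
  assumes "affine_chart X U n \<phi>" "f \<in> poly_fun n"
  shows "openin (zar X) {u \<in> U. f (\<phi> u) \<noteq> 0}"
  using assms(2) by (subst chart_openin[OF assms(1)]) auto

lemma chart_quotient_reg:
  assumes ch: "affine_chart X U n \<phi>" and W: "openin (zar X) W" "W \<subseteq> U"
    and "g \<in> poly_fun n" "h \<in> poly_fun n" "\<And>u. u \<in> W \<Longrightarrow> h (\<phi> u) \<noteq> 0"
  shows "reg X W (\<lambda>u. g (\<phi> u) / h (\<phi> u))"
  unfolding chart_reg[OF ch W(2,1)] locally_quotient_def using assms(4-) by blast

lemma chart_point_separation:
  assumes ch: "affine_chart X U n \<phi>" and "p \<in> U" "q \<in> U" "p \<noteq> q"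
  shows "\<exists>i<n. \<phi> p i \<noteq> \<phi> q i"
proof (rule ccontr)
  assume *: "\<not> ?thesis"
  have "\<phi> ` U \<subseteq> {..<n} \<rightarrow>\<^sub>E UNIV"
    using chart_algebraic[OF ch] unfolding algebraic_set_def by blast
  then have "\<phi> p \<in> {..<n} \<rightarrow>\<^sub>E UNIV" "\<phi> q \<in> {..<n} \<rightarrow>\<^sub>E UNIV" using assms by blast+
  then have "\<phi> p = \<phi> q" using * by (intro PiE_ext) auto
  then show False using chart_inj[OF ch] assms by (auto dest: inj_onD)
qed

text \<open>A point is the common zero of the functions \<open>x\<^sub>i - c\<^sub>i\<close>.\<close>

lemma chart_remove_point_open:
  assumes ch: "affine_chart X U n \<phi>" and p: "p \<in> U"
  shows "openin (zar X) (U - {p})"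
proof (subst chart_openin[OF ch], blast, intro ballI)
  fix q assume q: "q \<in> U - {p}"
  obtain i where i: "i < n" "\<phi> q i \<noteq> \<phi> p i"
    using chart_point_separation[OF ch, of q p] p q by auto
  then show "\<exists>f\<in>poly_fun n. f (\<phi> q) \<noteq> 0 \<and> {u \<in> U. f (\<phi> u) \<noteq> 0} \<subseteq> U - {p}"
    by (intro bexI[of _ "\<lambda>x. x i - \<phi> p i"] poly_fun_intros) auto
qed

lemma chart_relatively_closed:
  assumes ch: "affine_chart X U n \<phi>" and Y: "Y \<subseteq> U" and G: "closedin (zar X) G"
  shows "\<exists>F\<subseteq>poly_fun n. G \<inter> Y = {u \<in> Y. \<forall>f\<in>F. f (\<phi> u) = 0}"
proof -
  have "openin (zar X) (U - G)" using chart_open[OF ch] G by (rule openin_diff)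
  then have *: "\<forall>p\<in>U - G. \<exists>f\<in>poly_fun n. f (\<phi> p) \<noteq> 0 \<and> {u \<in> U. f (\<phi> u) \<noteq> 0} \<subseteq> U - G"
    by (subst (asm) chart_openin[OF ch]) auto
  let ?F = "{f \<in> poly_fun n. {u \<in> U. f (\<phi> u) \<noteq> 0} \<subseteq> U - G}"
  have "G \<inter> Y = {u \<in> Y. \<forall>f\<in>?F. f (\<phi> u) = 0}" using * Y by blast
  then show ?thesis by (intro exI[of _ ?F]) auto
qed

lemma prevariety_chart_cover:
  assumes "prevariety X"
  obtains \<U> where "finite \<U>" "\<Union>\<U> = points X" "\<And>U. U \<in> \<U> \<Longrightarrow> \<exists>n \<phi>. affine_chart X U n \<phi>"
proof -
  obtain \<U> where \<U>: "finite \<U>" "\<Union>\<U> = points X"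
    "\<And>U. U \<in> \<U> \<Longrightarrow> openin (zar X) U \<and> affine_variety (induced X U)"
    using assms unfolding prevariety_def by blast
  have X: "space_with_functions X" using assms unfolding prevariety_def by blast
  show thesis
  proof (rule that[OF \<U>(1,2)])
    fix U assume "U \<in> \<U>"
    from \<U>(3)[OF this] show "\<exists>n \<phi>. affine_chart X U n \<phi>"
      using affine_open_has_chart[OF X, of U] by simp
  qed
qed

lemma prevariety_chart_at:
  assumes "prevariety X" "p \<in> points X"
  obtains U n \<phi> where "affine_chart X U n \<phi>" "p \<in> U"
proof -
  obtain \<U> where \<U>: "\<Union>\<U> = points X" "\<And>U. U \<in> \<U> \<Longrightarrow> \<exists>n \<phi>. affine_chart X U n \<phi>"
    by (rule prevariety_chart_cover[OF assms(1)]) blast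
  obtain U where U: "U \<in> \<U>" "p \<in> U" using assms(2) \<U>(1) by blast
  from \<U>(2)[OF U(1)] obtain n \<phi> where "affine_chart X U n \<phi>" by blast
  then show thesis using U(2) by (rule that)
qed

lemma prevariety_points_closed:
  assumes "prevariety X" "p \<in> points X"
  shows "closedin (zar X) {p}"
proof -
  have "openin (zar X) (points X - {p})"
  proof (subst openin_subopen, intro ballI)
    fix q assume q: "q \<in> points X - {p}"
    then have "q \<in> points X" by simp
    then obtain U n \<phi> where ch: "affine_chart X U n \<phi>" "q \<in> U"
      by (rule prevariety_chart_at[OF assms(1)])
    have "openin (zar X) (U - {p})"
      using chart_remove_point_open[OF ch(1), of p] chart_open[OF ch(1)] by (cases "p \<in> U") auto
    moreover have "U \<subseteq> points X" using openin_subset[OF chart_open[OF ch(1)]] .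
    ultimately show "\<exists>T. openin (zar X) T \<and> q \<in> T \<and> T \<subseteq> points X - {p}"
      using q ch(2) by (intro exI[of _ "U - {p}"]) auto
  qed
  with assms(2) show ?thesis by (simp add: closedin_def)
qed

section \<open>Irreducible curves\<close>

lemma irreducible_top_iff_open:
  "irreducible_top T \<longleftrightarrow> topspace T \<noteq> {} \<and>
     (\<forall>U V. openin T U \<longrightarrow> openin T V \<longrightarrow> U \<noteq> {} \<longrightarrow> V \<noteq> {} \<longrightarrow> U \<inter> V \<noteq> {})"
proof (intro iffI conjI allI impI)
  assume irr: "irreducible_top T"
  then show "topspace T \<noteq> {}" by (simp add: irreducible_top_def)
  fix U V assume UV: "openin T U" "openin T V" "U \<noteq> {}" "V \<noteq> {}"
  show "U \<inter> V \<noteq> {}"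
  proof
    assume "U \<inter> V = {}"
    then have "(topspace T - U) \<union> (topspace T - V) = topspace T" by blast
    moreover have "closedin T (topspace T - U)" "closedin T (topspace T - V)"
      using UV by auto
    ultimately have "topspace T - U = topspace T \<or> topspace T - V = topspace T"
      using irr unfolding irreducible_top_def by simp
    then show False using UV openin_subset[OF UV(1)] openin_subset[OF UV(2)] by blast
  qed
next
  assume *: "topspace T \<noteq> {} \<and>
     (\<forall>U V. openin T U \<longrightarrow> openin T V \<longrightarrow> U \<noteq> {} \<longrightarrow> V \<noteq> {} \<longrightarrow> U \<inter> V \<noteq> {})"
  show "irreducible_top T"
    unfolding irreducible_top_def
  proof (intro conjI allI impI)
    show "topspace T \<noteq> {}" using * by blast
    fix A B assume AB: "closedin T A" "closedin T B" "A \<union> B = topspace T"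
    show "A = topspace T \<or> B = topspace T"
    proof (rule ccontr)
      assume "\<not> ?thesis"
      then have "topspace T - A \<noteq> {}" "topspace T - B \<noteq> {}"
        using closedin_subset[OF AB(1)] closedin_subset[OF AB(2)] by auto
      then have "(topspace T - A) \<inter> (topspace T - B) \<noteq> {}"
        using * AB by (meson openin_diff openin_topspace)
      then show False using AB(3) by blast
    qed
  qed
qed

text \<open>Generic conditions can be imposed simultaneously.\<close>

lemma irreducible_top_finite_Inter:
  assumes irr: "irreducible_top T" and "finite I"
    and "\<And>i. i \<in> I \<Longrightarrow> openin T (U i) \<and> U i \<noteq> {}" and "openin T V" "V \<noteq> {}"
  shows "openin T (V \<inter> (\<Inter>i\<in>I. U i)) \<and> V \<inter> (\<Inter>i\<in>I. U i) \<noteq> {}"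
  using assms(2,3)
proof (induction I rule: finite_induct)
  case empty
  then show ?case using assms by simp
next
  case (insert i I)
  have eq: "V \<inter> (\<Inter>i\<in>insert i I. U i) = U i \<inter> (V \<inter> (\<Inter>i\<in>I. U i))" by blast
  have IH: "openin T (V \<inter> (\<Inter>i\<in>I. U i))" "V \<inter> (\<Inter>i\<in>I. U i) \<noteq> {}"
    using insert.IH insert.prems by simp_all
  have Ui: "openin T (U i)" "U i \<noteq> {}" using insert.prems by simp_all
  have "U i \<inter> (V \<inter> (\<Inter>i\<in>I. U i)) \<noteq> {}"
    using irr Ui IH unfolding irreducible_top_iff_open by simp
  then show ?case unfolding eq using openin_Int[OF Ui(1) IH(1)] by simp
qed

lemma irreducible_closure_of:
  assumes W: "W \<subseteq> topspace T" and irr: "irreducible_top (subtopology T W)"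
  shows "irreducible_top (subtopology T (T closure_of W))"
proof -
  have sub: "W \<subseteq> T closure_of W" using W by (rule closure_of_subset)
  have "W \<noteq> {}" using irr unfolding irreducible_top_def by auto
  have meets: "V \<inter> W \<noteq> {}" if "openin T V" "V \<inter> T closure_of W \<noteq> {}" for V
    using that openin_Int_closure_of_eq_empty by blast
  show ?thesis
    unfolding irreducible_top_iff_open
  proof (intro conjI allI impI)
    show "topspace (subtopology T (T closure_of W)) \<noteq> {}"
      using sub W \<open>W \<noteq> {}\<close> by auto
    fix U V assume "openin (subtopology T (T closure_of W)) U"
      "openin (subtopology T (T closure_of W)) V" "U \<noteq> {}" "V \<noteq> {}"
    then obtain U' V' where U': "openin T U'" "U = U' \<inter> T closure_of W"
      and V': "openin T V'" "V = V' \<inter> T closure_of W"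
      and ne: "U' \<inter> T closure_of W \<noteq> {}" "V' \<inter> T closure_of W \<noteq> {}"
      unfolding openin_subtopology by auto
    have "openin (subtopology T W) (U' \<inter> W)" "openin (subtopology T W) (V' \<inter> W)"
      using U'(1) V'(1) by (auto simp: openin_subtopology)
    then have "(U' \<inter> W) \<inter> (V' \<inter> W) \<noteq> {}"
      using irr meets[OF U'(1) ne(1)] meets[OF V'(1) ne(2)]
      unfolding irreducible_top_iff_open by simp
    then show "U \<inter> V \<noteq> {}" unfolding U'(2) V'(2) using sub by blast
  qed
qed

lemma krull_dim_chain:
  assumes "\<And>Y. Y \<in> {Z0, Z1, Z2} \<Longrightarrow> closedin T Y \<and> irreducible_top (subtopology T Y)"
    and "Z0 \<subset> Z1" "Z1 \<subset> Z2"
  shows "2 \<le> krull_dim T"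
proof -
  let ?Z = "\<lambda>i::nat. if i = 0 then Z0 else if i = 1 then Z1 else Z2"
  have "\<forall>i\<le>2. closedin T (?Z i) \<and> irreducible_top (subtopology T (?Z i))"
    by (intro allI impI assms(1)) simp
  moreover have "?Z i \<subset> ?Z (Suc i)" if "i < 2" for i
  proof -
    consider "i = 0" | "i = 1" using \<open>i < 2\<close> by linarith
    then show ?thesis using assms(2,3) by cases simp_all
  qed
  ultimately have "\<exists>Z. (\<forall>i\<le>2. closedin T (Z i) \<and> irreducible_top (subtopology T (Z i))) \<and>
      (\<forall>i<2. Z i \<subset> Z (Suc i))"
    by (intro exI[of _ ?Z] conjI allI impI) simp_all
  then have "enat 2 \<le> krull_dim T"
    unfolding krull_dim_def by (intro Sup_upper CollectI exI[of _ 2] conjI refl)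
  then show ?thesis by (simp add: numeral_eq_enat)
qed

lemma curve_subset_points: "irreducible_curve_in X C \<Longrightarrow> C \<subseteq> points X"
  unfolding irreducible_curve_in_def by (auto dest: openin_subset)

text \<open>An infinite \<open>K\<close> has infinite intersection with one of finitely many charts \<open>U\<close>. By the descending chain condition
  there is a minimal infinite relatively closed subset \<open>W\<close> of \<open>K \<inter> U\<close>; it is irreducible since of two closed sets
  covering it one is infinite. A point of \<open>W\<close>, the closure of \<open>W\<close> and \<open>C\<close> form a chain of length 2.\<close>

theorem proper_closed_subset_of_curve_finite:
  assumes X: "prevariety X" and C: "irreducible_curve_in X C"
    and K: "closedin (subtopology (zar X) C) K" "K \<noteq> C"
  shows "finite K"
proof (rule ccontr)
  let ?T = "subtopology (zar X) C"
  assume inf: "infinite K"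
  have CX: "C \<subseteq> points X" using C by (rule curve_subset_points)
  have top: "topspace ?T = C" using CX by auto
  have KC: "K \<subseteq> C" using closedin_subset[OF K(1)] top by simp
  have irr: "irreducible_top ?T" and dim: "krull_dim ?T = 1"
    using C unfolding irreducible_curve_in_def by auto
  obtain G where G: "closedin (zar X) G" "K = G \<inter> C"
    using K(1) unfolding closedin_subtopology by blast
  obtain \<U> where \<U>: "finite \<U>" "\<Union>\<U> = points X" "\<And>U. U \<in> \<U> \<Longrightarrow> \<exists>n \<phi>. affine_chart X U n \<phi>"
    by (rule prevariety_chart_cover[OF X]) blast
  have "K = (\<Union>U\<in>\<U>. K \<inter> U)" using \<U>(2) KC CX by blast
  then obtain U where U: "U \<in> \<U>" "infinite (K \<inter> U)"
    using inf \<U>(1) by (metis finite_UN)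
  obtain n \<phi> where ch: "affine_chart X U n \<phi>" using \<U>(3)[OF U(1)] by blast
  define \<F> where "\<F> = {W. infinite W \<and> W \<subseteq> K \<inter> U \<and> (\<exists>G. closedin (zar X) G \<and> W = G \<inter> (C \<inter> U))}"
  have KU: "K \<inter> U \<in> \<F>" unfolding \<F>_def using U(2) G by auto
  have wf: "wf {(A, B). A \<in> \<F> \<and> B \<in> \<F> \<and> A \<subset> B}"
    unfolding wf_iff_no_infinite_down_chain
  proof (rule notI, elim exE)
    fix W :: "nat \<Rightarrow> 'a set" assume W: "\<forall>i. (W (Suc i), W i) \<in> {(A, B). A \<in> \<F> \<and> B \<in> \<F> \<and> A \<subset> B}"
    show False
    proof (rule no_strictly_decreasing_zero_loci[of W n "C \<inter> U" \<phi>])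
      fix i
      show "W (Suc i) \<subset> W i" using W by blast
      have "W i \<in> \<F>" using W by blast
      then obtain H where "closedin (zar X) H" "W i = H \<inter> (C \<inter> U)" unfolding \<F>_def by blast
      then show "\<exists>F\<subseteq>poly_fun n. W i = {x \<in> C \<inter> U. \<forall>g\<in>F. g (\<phi> x) = 0}"
        using chart_relatively_closed[OF ch, of "C \<inter> U" H] by simp
    qed
  qed
  obtain W where W: "W \<in> \<F>" and min: "\<And>A. A \<in> \<F> \<Longrightarrow> \<not> A \<subset> W"
    by (rule wfE_min[OF wf KU]) blast
  obtain H where H: "closedin (zar X) H" "W = H \<inter> (C \<inter> U)" and infW: "infinite W" and WK: "W \<subseteq> K \<inter> U"
    using W unfolding \<F>_def by blast
  have WC: "W \<subseteq> C" using WK KC by blast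
  have TW: "subtopology ?T W = subtopology (zar X) W"
    using WC by (simp add: subtopology_subtopology Int_absorb1)
  have topW: "topspace (subtopology (zar X) W) = W" using WC CX by auto
  have closedW: "A = W" if A: "closedin (subtopology (zar X) W) A" "infinite A" for A
  proof -
    obtain G' where "closedin (zar X) G'" "A = G' \<inter> W"
      using A(1) unfolding closedin_subtopology by blast
    then have "A \<in> \<F>"
      unfolding \<F>_def using A(2) WK H by (auto intro!: exI[of _ "G' \<inter> H"])
    with min[of A] \<open>A = _\<close> show ?thesis by blast
  qed
  have irrW: "irreducible_top (subtopology ?T W)"
    unfolding TW irreducible_top_def topW
  proof (intro conjI allI impI)
    show "W \<noteq> {}" using infW by auto
    fix A B assume AB: "closedin (subtopology (zar X) W) A" "closedin (subtopology (zar X) W) B" "A \<union> B = W"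
    then have "infinite A \<or> infinite B" using infW by (metis finite_Un)
    then show "A = W \<or> B = W" using closedW AB by blast
  qed
  obtain p where p: "p \<in> W" using infW by (metis finite.emptyI ex_in_conv)
  have "p \<in> C" "p \<in> points X" using p WC CX by auto
  have irrp: "irreducible_top (subtopology ?T {p})"
    unfolding irreducible_top_iff_open using \<open>p \<in> C\<close> \<open>p \<in> points X\<close>
    by (auto simp: openin_subtopology)
  have closedp: "closedin ?T {p}"
    using prevariety_points_closed[OF X \<open>p \<in> points X\<close>] \<open>p \<in> C\<close>
    unfolding closedin_subtopology by (intro exI[of _ "{p}"]) auto
  have sub: "W \<subseteq> ?T closure_of W" using WC top by (intro closure_of_subset) simp
  have "?T closure_of W \<subseteq> K"
    using WK K(1) by (intro closure_of_minimal) auto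
  then have "?T closure_of W \<subset> C" using K(2) KC by auto
  moreover have "{p} \<subset> ?T closure_of W"
  proof -
    have "W \<noteq> {p}" using infW by auto
    then show ?thesis using sub p by blast
  qed
  moreover have "irreducible_top (subtopology ?T (?T closure_of W))"
    using WC top irrW by (intro irreducible_closure_of) simp_all
  moreover have "subtopology ?T C = ?T" by (simp add: subtopology_subtopology)
  moreover have "closedin ?T C" using closedin_topspace[of ?T] top by simp
  ultimately have "2 \<le> krull_dim ?T"
    using irr irrp closedp by (intro krull_dim_chain[of "{p}" "?T closure_of W" C]) auto
  then show False using dim by simp
qed

section \<open>Algebraic dependence\<close>

text \<open>The set \<open>D\<close> is a principal open subset of an affine variety; the hypothesis on zeros is what
  dimension 1 provides. The polynomial \<open>P\<close> in two variables is a polynomial in \<open>y\<close> whose coefficients are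
  polynomials in \<open>t = g / h\<close>.\<close>

lemma algebraic_dependence:
  fixes D :: "(nat \<Rightarrow> complex) set"
  assumes D: "D = {x \<in> {..<n} \<rightarrow>\<^sub>E UNIV. (\<forall>f\<in>F. f x = 0) \<and> h x \<noteq> 0}"
    and F: "F \<subseteq> poly_fun n" and g: "g \<in> poly_fun n" and h: "h \<in> poly_fun n"
    and finite_zeros: "\<And>f. f \<in> poly_fun n \<Longrightarrow> \<exists>x\<in>D. f x \<noteq> 0 \<Longrightarrow> finite {x \<in> D. f x = 0}"
    and y: "y \<in> poly_fun n"
  shows "\<exists>P :: complex poly poly. P \<noteq> 0 \<and> (\<forall>x\<in>D. poly (poly P [:y x:]) (g x / h x) = 0)"
proof (cases "\<exists>a. \<forall>x\<in>D. y x = a")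
  case True
  then obtain a where "\<forall>x\<in>D. y x = a" by blast
  then show ?thesis by (intro exI[of _ "[:[:- a:], 1:]"]) simp
next
  case False
  define t where "t x = g x / h x" for x
  define Z where "Z a = {x \<in> D. y x = a}" for a
  have Z: "finite (Z a)" for a
  proof -
    have "(\<lambda>x. y x - a) \<in> poly_fun n" using y by (intro poly_fun_diff poly_fun.const)
    moreover have "\<exists>x\<in>D. y x - a \<noteq> 0" using False by auto
    ultimately show ?thesis unfolding Z_def using finite_zeros[of "\<lambda>x. y x - a"] by simp
  qed
  define p where "p a = (\<Prod>z\<in>Z a. [:- t z, 1:])" for a
  \<comment> \<open>on \<open>D\<close> this is a power of \<open>h\<close> times \<open>\<Prod>z. t - t z\<close>; the extra factor \<open>h\<close> makes it vanish off the open set \<open>h \<noteq> 0\<close>\<close>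
  define q where "q a x = h x * (\<Prod>z\<in>Z a. g x - t z * h x)" for a x
  have q: "q a \<in> poly_fun n" for a
  proof -
    have "(\<lambda>x. h x * (\<Prod>z\<in>Z a. g x - t z * h x)) \<in> poly_fun n"
      using g h by (intro poly_fun.mult poly_fun_prod poly_fun_diff poly_fun.const)
    then show ?thesis by (simp add: q_def[abs_def])
  qed
  have q_on_D: "q a x = h x ^ Suc (card (Z a)) * poly (p a) (t x)" if "x \<in> D" for a x
  proof -
    have "h x \<noteq> 0" using that D by simp
    then have "g x - t z * h x = h x * (t x - t z)" for z
      by (simp add: t_def field_simps)
    then show ?thesis
      by (simp add: q_def p_def poly_prod prod.distrib)
  qed
  define I where "I = {f \<in> poly_fun n. \<forall>x\<in>D. f x = 0}"
  have I: "poly_ideal n I"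
    unfolding I_def poly_ideal_def by (auto intro: poly_fun.intros)
  have "\<exists>k. (\<lambda>x. q a x ^ k) \<in> adjoin n I (\<lambda>x. y x - a)" for a
  proof (rule ccontr)
    assume "\<nexists>k. (\<lambda>x. q a x ^ k) \<in> adjoin n I (\<lambda>x. y x - a)"
    then have nopow: "\<And>k. (\<lambda>x. q a x ^ k) \<notin> adjoin n I (\<lambda>x. y x - a)" by blast
    have "(\<lambda>x. y x - a) \<in> poly_fun n" using y by (intro poly_fun_diff poly_fun.const)
    with I have "poly_ideal n (adjoin n I (\<lambda>x. y x - a))" by (rule poly_ideal_adjoin)
    then obtain u where u: "u \<in> {..<n} \<rightarrow>\<^sub>E UNIV"
      "\<forall>f\<in>adjoin n I (\<lambda>x. y x - a). f u = 0" "q a u \<noteq> 0"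
      using q nopow by (rule nullstellensatz)
    have "h u \<noteq> 0" using u(3) unfolding q_def by auto
    moreover have "f u = 0" if "f \<in> F" for f
    proof -
      have "f \<in> I" unfolding I_def using that F D by auto
      then show ?thesis using u(2) adjoin_superset[of I n] by blast
    qed
    ultimately have "u \<in> D" using u(1) D by simp
    moreover have "y u = a" using u(2) adjoin_mem[OF I, of "\<lambda>x. y x - a"] by fastforce
    ultimately have "u \<in> Z a" unfolding Z_def by simp
    moreover have "g u - t u * h u = 0" using \<open>h u \<noteq> 0\<close> by (simp add: t_def)
    ultimately have "q a u = 0" using Z[of a] unfolding q_def by (auto intro: prod_zero)
    with u(3) show False by simp
  qed
  then obtain N where "\<And>a. (\<lambda>x. q a x ^ N a) \<in> adjoin n I (\<lambda>x. y x - a)" by metis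
  then have N: "\<exists>f r. (\<forall>x. q a x ^ N a = f x + r x * (y x - a)) \<and> f \<in> I \<and> r \<in> poly_fun n" for a
    unfolding adjoin_def mem_Collect_eq fun_eq_iff by blast
  have "\<forall>a. \<exists>r. r \<in> poly_fun n \<and> (\<forall>x\<in>D. q a x ^ N a = r x * (y x - a))"
  proof
    fix a
    obtain f r where "\<And>x. q a x ^ N a = f x + r x * (y x - a)" "f \<in> I" "r \<in> poly_fun n"
      using N[of a] by blast
    then show "\<exists>r. r \<in> poly_fun n \<and> (\<forall>x\<in>D. q a x ^ N a = r x * (y x - a))"
      unfolding I_def by (intro exI[of _ r]) simp
  qed
  then obtain r where "\<forall>a. r a \<in> poly_fun n \<and> (\<forall>x\<in>D. q a x ^ N a = r a x * (y x - a))"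
    by (rule choice[THEN exE])
  then have r: "\<And>a. r a \<in> poly_fun n" "\<And>a x. x \<in> D \<Longrightarrow> q a x ^ N a = r a x * (y x - a)"
    by blast+
  \<comment> \<open>the exponent of \<open>h\<close> in the relation for \<open>a\<close>; equal exponents can be cancelled together\<close>
  define \<kappa> where "\<kappa> a = Suc (card (Z a)) * N a" for a
  obtain B c where B: "finite B" "\<exists>a\<in>B. c a \<noteq> 0" "\<And>a b. a \<in> B \<Longrightarrow> b \<in> B \<Longrightarrow> \<kappa> a = \<kappa> b"
    "\<And>x. (\<Sum>a\<in>B. c a * r a x) = 0"
    using uncountable_family_dependent[where r = r and \<kappa> = \<kappa>, OF r(1)] by blast
  then obtain a where a: "a \<in> B" "c a \<noteq> 0" by blast
  let ?c = "\<lambda>a. smult (c a) (p a ^ N a)"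
  let ?P = "lagrange_comb B (\<lambda>a. [:a:]) ?c"
  have "p a \<noteq> 0" unfolding p_def using Z by simp
  then have "?P \<noteq> 0"
    using B(1) a by (intro lagrange_comb_nonzero[of _ _ a]) (auto simp: inj_on_def)
  moreover have "poly (poly ?P [:y x:]) (g x / h x) = 0" if x: "x \<in> D" for x
  proof -
    have "h x \<noteq> 0" using x D by simp
    have "h x ^ \<kappa> a * poly (poly ?P [:y x:]) (t x) =
        (\<Sum>b\<in>B. c b * (h x ^ \<kappa> b * poly (p b) (t x) ^ N b) * (\<Prod>d\<in>B - {b}. y x - d))"
      unfolding poly_lagrange_comb poly_sum sum_distrib_left
      using B(3)[OF a(1)] by (intro sum.cong refl) (simp add: poly_prod mult_ac)
    also have "\<dots> = (\<Sum>b\<in>B. c b * r b x * ((y x - b) * (\<Prod>d\<in>B - {b}. y x - d)))"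
    proof (intro sum.cong refl)
      fix b
      have "h x ^ \<kappa> b * poly (p b) (t x) ^ N b = r b x * (y x - b)"
        unfolding r(2)[OF x, symmetric] q_on_D[OF x] \<kappa>_def
        by (simp only: power_mult power_mult_distrib)
      then show "c b * (h x ^ \<kappa> b * poly (p b) (t x) ^ N b) * (\<Prod>d\<in>B - {b}. y x - d) =
          c b * r b x * ((y x - b) * (\<Prod>d\<in>B - {b}. y x - d))" by (simp only: mult_ac)
    qed
    also have "\<dots> = (\<Sum>b\<in>B. c b * r b x * (\<Prod>d\<in>B. y x - d))"
      using B(1) by (intro sum.cong) (simp_all add: prod.remove)
    also have "\<dots> = 0" using B(4) by (simp flip: sum_distrib_right)
    finally show ?thesis using \<open>h x \<noteq> 0\<close> by (simp add: t_def)
  qed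
  ultimately show ?thesis by blast
qed

text \<open>In a nonzero relation of least degree in \<open>y\<close>, the derivative is nonzero (characteristic 0, and the degree is
  positive as \<open>t\<close> satisfies no equation alone) and of smaller degree, hence not a relation.\<close>

lemma separable_relation:
  fixes t y :: "'a \<Rightarrow> complex"
  assumes "P \<noteq> 0" "\<And>u. u \<in> D \<Longrightarrow> poly (poly P [:y u:]) (t u) = 0"
    and transcendental: "\<And>a. a \<noteq> 0 \<Longrightarrow> \<exists>u\<in>D. poly a (t u) \<noteq> 0"
  shows "\<exists>Q. (\<forall>u\<in>D. poly (poly Q [:y u:]) (t u) = 0) \<and>
    (\<exists>u\<in>D. poly (poly (pderiv Q) [:y u:]) (t u) \<noteq> 0)"
proof -
  let ?rel = "\<lambda>Q. Q \<noteq> 0 \<and> (\<forall>u\<in>D. poly (poly Q [:y u:]) (t u) = 0)"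
  obtain Q where Q: "?rel Q" and least: "\<And>R. ?rel R \<Longrightarrow> degree Q \<le> degree R"
    using ex_has_least_nat[of ?rel P degree] assms(1,2) by blast
  have "degree Q \<noteq> 0"
  proof
    assume "degree Q = 0"
    then obtain a where a: "Q = [:a:]" by (rule degree_eq_zeroE)
    with Q have "a \<noteq> 0" by auto
    then show False using transcendental[of a] Q a by auto
  qed
  then have "pderiv Q \<noteq> 0" "degree (pderiv Q) < degree Q"
    by (simp_all add: pderiv_eq_0_iff degree_pderiv)
  then have "\<not> ?rel (pderiv Q)" using least[of "pderiv Q"] by linarith
  then have "\<exists>u\<in>D. poly (poly (pderiv Q) [:y u:]) (t u) \<noteq> 0" using \<open>pderiv Q \<noteq> 0\<close> by blast
  then show ?thesis using Q by blast
qed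

text \<open>Dividing \<open>Q\<close> by \<open>y - b\<close> leaves the remainder \<open>Q(t, b)\<close>, which is divisible by \<open>t - a\<close>. If the derivative of \<open>Q\<close> in \<open>y\<close>
  is nonzero at \<open>(a, b)\<close>, the relation \<open>Q = 0\<close> can thus be solved for \<open>y - b\<close> as a multiple of \<open>t - a\<close>.\<close>

lemma relation_linearisation:
  fixes Q :: "complex poly poly"
  assumes "poly (poly Q [:b:]) a = 0"
  obtains R p where "\<And>y t. poly (poly Q [:y:]) t = (y - b) * poly (poly R [:y:]) t + (t - a) * poly p t"
    "poly (poly R [:b:]) a = poly (poly (pderiv Q) [:b:]) a"
proof -
  obtain R where R: "Q = [:- [:b:], 1:] * R + [:poly Q [:b:]:]"
  proof -
    have "[:- [:b:], 1:] dvd Q - [:poly Q [:b:]:]"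
      by (subst poly_eq_0_iff_dvd[symmetric]) simp
    then obtain R where "Q - [:poly Q [:b:]:] = [:- [:b:], 1:] * R" by (rule dvdE)
    then show thesis using that[of R] by (simp add: algebra_simps)
  qed
  obtain p where p: "poly Q [:b:] = [:- a, 1:] * p"
    using assms unfolding poly_eq_0_iff_dvd by (rule dvdE)
  have "poly (poly Q [:y:]) t = (y - b) * poly (poly R [:y:]) t + (t - a) * poly p t" for y t
    by (subst R, subst p) (simp add: algebra_simps)
  moreover have "poly (poly R [:b:]) a = poly (poly (pderiv Q) [:b:]) a"
    by (subst R) (simp add: pderiv_mult pderiv_add pderiv_pCons del: mult_pCons_left)
  ultimately show thesis using that by blast
qed

section \<open>Functions regular near a point\<close>

abbreviation regular_near :: "'a fspace \<Rightarrow> 'a \<Rightarrow> ('a \<Rightarrow> complex) set" where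
  "regular_near X p \<equiv> carrier (near_ring X p)"

lemma regular_near_iff: "f \<in> regular_near X p \<longleftrightarrow> (\<exists>U. openin (zar X) U \<and> p \<in> U \<and> reg X U f)"
  by (simp add: near_ring_def)

lemma regular_nearE:
  assumes "f \<in> regular_near X p"
  obtains U where "openin (zar X) U" "p \<in> U" "reg X U f"
  using assms unfolding regular_near_iff by blast

lemma regular_near_point: "f \<in> regular_near X p \<Longrightarrow> p \<in> points X"
  by (erule regular_nearE) (auto dest: openin_subset)

lemma regular_near_const:
  assumes "space_with_functions X" "p \<in> points X"
  shows "(\<lambda>_. c) \<in> regular_near X p"
  unfolding regular_near_iff
  by (intro exI[of _ "points X"] conjI openin_topspace assms(2) reg_const[OF assms(1)])

lemma regular_near_common_domain:
  assumes X: "space_with_functions X" and f: "f \<in> regular_near X p" and g: "g \<in> regular_near X p"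
  obtains U where "openin (zar X) U" "p \<in> U" "reg X U f" "reg X U g"
proof -
  obtain U V where U: "openin (zar X) U" "p \<in> U" "reg X U f"
    and V: "openin (zar X) V" "p \<in> V" "reg X V g"
    using f g by (meson regular_nearE)
  have UV: "openin (zar X) (U \<inter> V)" using U(1) V(1) by (rule openin_Int)
  have "reg X (U \<inter> V) f" by (rule reg_restrict[OF X U(1) UV _ U(3)]) blast
  moreover have "reg X (U \<inter> V) g" by (rule reg_restrict[OF X V(1) UV _ V(3)]) blast
  ultimately show thesis using UV U(2) V(2) by (intro that[of "U \<inter> V"]) simp_all
qed

lemma regular_near_add:
  assumes X: "space_with_functions X" and "f \<in> regular_near X p" "g \<in> regular_near X p"
  shows "(\<lambda>u. f u + g u) \<in> regular_near X p"
proof -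
  obtain U where U: "openin (zar X) U" "p \<in> U" "reg X U f" "reg X U g"
    by (rule regular_near_common_domain[OF assms])
  show ?thesis unfolding regular_near_iff using reg_add[OF X U(1,3,4)] U(1,2) by blast
qed

lemma regular_near_mult:
  assumes X: "space_with_functions X" and "f \<in> regular_near X p" "g \<in> regular_near X p"
  shows "(\<lambda>u. f u * g u) \<in> regular_near X p"
proof -
  obtain U where U: "openin (zar X) U" "p \<in> U" "reg X U f" "reg X U g"
    by (rule regular_near_common_domain[OF assms])
  show ?thesis unfolding regular_near_iff using reg_mult[OF X U(1,3,4)] U(1,2) by blast
qed

lemma regular_near_cmult:
  assumes X: "space_with_functions X" and "f \<in> regular_near X p"
  shows "(\<lambda>u. c * f u) \<in> regular_near X p"
  using regular_near_mult[OF X regular_near_const[OF X regular_near_point[OF assms(2)]] assms(2)] .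

lemma regular_near_diff:
  assumes X: "space_with_functions X" and "f \<in> regular_near X p" "g \<in> regular_near X p"
  shows "(\<lambda>u. f u - g u) \<in> regular_near X p"
  using regular_near_add[OF X assms(2) regular_near_cmult[OF X assms(3), of "-1"]] by simp

lemma regular_near_sum:
  assumes X: "space_with_functions X" and p: "p \<in> points X"
    and "\<And>i. i \<in> I \<Longrightarrow> f i \<in> regular_near X p"
  shows "(\<lambda>u. \<Sum>i\<in>I. f i u) \<in> regular_near X p"
  using assms(3)
  by (induction I rule: infinite_finite_induct)
     (simp_all add: regular_near_add[OF X] regular_near_const[OF X p])

lemma regular_near_poly:
  assumes X: "space_with_functions X" and t: "t \<in> regular_near X p"
  shows "(\<lambda>u. poly a (t u)) \<in> regular_near X p"
proof (induction a)
  case 0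
  show ?case using regular_near_const[OF X regular_near_point[OF t]] by simp
next
  case (pCons c a)
  then show ?case
    using regular_near_add[OF X regular_near_const[OF X regular_near_point[OF t]]
        regular_near_mult[OF X t pCons.IH]] by simp
qed

lemma regular_near_poly_poly:
  assumes X: "space_with_functions X" and t: "t \<in> regular_near X p" and y: "y \<in> regular_near X p"
  shows "(\<lambda>u. poly (poly P [:y u:]) (t u)) \<in> regular_near X p"
proof (induction P)
  case 0
  show ?case using regular_near_const[OF X regular_near_point[OF t]] by simp
next
  case (pCons a P)
  then show ?case
    using regular_near_add[OF X regular_near_poly[OF X t] regular_near_mult[OF X y pCons.IH]] by simp
qed

lemma regular_near_chart_quotient:
  assumes X: "space_with_functions X" and ch: "affine_chart X U n \<phi>" and p: "p \<in> U"
    and f: "f \<in> regular_near X p"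
  obtains W g h where "openin (zar X) W" "p \<in> W" "W \<subseteq> U" "g \<in> poly_fun n" "h \<in> poly_fun n"
    "\<And>u. u \<in> W \<Longrightarrow> h (\<phi> u) \<noteq> 0" "\<And>u. u \<in> W \<Longrightarrow> f u = g (\<phi> u) / h (\<phi> u)"
proof -
  obtain V where V: "openin (zar X) V" "p \<in> V" "reg X V f" using f by (rule regular_nearE)
  have VU: "openin (zar X) (V \<inter> U)" using V(1) chart_open[OF ch] by (rule openin_Int)
  have "reg X (V \<inter> U) f" by (rule reg_restrict[OF X V(1) VU _ V(3)]) blast
  then have "locally_quotient n \<phi> (V \<inter> U) f" using chart_reg[OF ch _ VU] by blast
  then obtain g h where gh: "g \<in> poly_fun n" "h \<in> poly_fun n" "h (\<phi> p) \<noteq> 0"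
    "\<forall>u\<in>V \<inter> U. h (\<phi> u) \<noteq> 0 \<longrightarrow> f u = g (\<phi> u) / h (\<phi> u)"
    unfolding locally_quotient_def using V(2) p by blast
  have "openin (zar X) (V \<inter> {u \<in> U. h (\<phi> u) \<noteq> 0})"
    using V(1) chart_principal_open[OF ch gh(2)] by (rule openin_Int)
  then show thesis
    using gh V(2) p by (intro that[of "V \<inter> {u \<in> U. h (\<phi> u) \<noteq> 0}" g h]) auto
qed

lemma quotient_regular_near:
  assumes ch: "affine_chart X U n \<phi>" and p: "p \<in> U"
    and g: "g \<in> poly_fun n" and h: "h \<in> poly_fun n" and "h (\<phi> p) \<noteq> 0"
  shows "(\<lambda>u. g (\<phi> u) / h (\<phi> u)) \<in> regular_near X p"
  unfolding regular_near_iff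
proof (intro exI conjI)
  show "openin (zar X) {u \<in> U. h (\<phi> u) \<noteq> 0}" using ch h by (rule chart_principal_open)
  then show "reg X {u \<in> U. h (\<phi> u) \<noteq> 0} (\<lambda>u. g (\<phi> u) / h (\<phi> u))"
    using g h by (intro chart_quotient_reg[OF ch]) auto
qed (use assms in simp)

lemma regular_near_cong:
  assumes X: "space_with_functions X" and f: "f \<in> regular_near X p"
    and W: "openin (zar X) W" "p \<in> W" "\<And>u. u \<in> W \<Longrightarrow> g u = f u"
  shows "g \<in> regular_near X p"
proof -
  obtain V where V: "openin (zar X) V" "p \<in> V" "reg X V f" using f by (rule regular_nearE)
  have VW: "openin (zar X) (V \<inter> W)" using V(1) W(1) by (rule openin_Int)
  have "reg X (V \<inter> W) f" by (rule reg_restrict[OF X V(1) VW _ V(3)]) blast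
  then have "reg X (V \<inter> W) g" by (rule reg_cong[OF X VW]) (simp add: W(3))
  then show ?thesis unfolding regular_near_iff using VW V(2) W(2) by blast
qed

text \<open>In a chart \<open>f\<close> is a quotient \<open>g / h\<close>, whose numerator is nonzero at \<open>p\<close>.\<close>

lemma regular_near_nonvanishing:
  assumes X: "prevariety X" and f: "f \<in> regular_near X p" and nz: "f p \<noteq> 0"
  shows "\<exists>W. openin (zar X) W \<and> p \<in> W \<and> (\<forall>u\<in>W. f u \<noteq> 0)"
    and "(\<lambda>u. inverse (f u)) \<in> regular_near X p"
proof -
  have swf: "space_with_functions X" using X unfolding prevariety_def by blast
  obtain U n \<phi> where ch: "affine_chart X U n \<phi>" "p \<in> U"
    using X regular_near_point[OF f] by (rule prevariety_chart_at)
  obtain W g h where W: "openin (zar X) W" "p \<in> W" "W \<subseteq> U" and gh: "g \<in> poly_fun n" "h \<in> poly_fun n"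
    and eq: "\<And>u. u \<in> W \<Longrightarrow> h (\<phi> u) \<noteq> 0" "\<And>u. u \<in> W \<Longrightarrow> f u = g (\<phi> u) / h (\<phi> u)"
    by (rule regular_near_chart_quotient[OF swf ch f]) blast
  let ?W = "W \<inter> {u \<in> U. g (\<phi> u) \<noteq> 0}"
  have open_W: "openin (zar X) ?W"
    using W(1) chart_principal_open[OF ch(1) gh(1)] by (rule openin_Int)
  have gp: "g (\<phi> p) \<noteq> 0" using nz eq[OF W(2)] by auto
  then have p: "p \<in> ?W" using W(2,3) by blast
  have "f u \<noteq> 0" if "u \<in> ?W" for u using eq[of u] that by simp
  then show "\<exists>W. openin (zar X) W \<and> p \<in> W \<and> (\<forall>u\<in>W. f u \<noteq> 0)" using open_W p by blast
  have "inverse (f u) = h (\<phi> u) / g (\<phi> u)" if "u \<in> W" for u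
    using eq[OF that] by simp
  with quotient_regular_near[OF ch gh(2,1) gp] W(1,2)
  show "(\<lambda>u. inverse (f u)) \<in> regular_near X p"
    by (rule regular_near_cong[OF swf])
qed

section \<open>A projection of a curve is generically unramified\<close>

text \<open>The function \<open>t\<close> is a coordinate of the base, composed with \<open>\<pi>\<close>. It takes two values on the curve: since \<open>C\<close> is
  irreducible, the part of \<open>C\<close> over a chart around one value meets the open set of points of \<open>C\<close> with another image.
  Around a point of the curve the chart \<open>U\<close> is cut down by \<open>h \<noteq> 0\<close> until \<open>t\<close> is a single quotient
  of polynomials and \<open>C\<close> is closed.\<close>

lemma curve_chart_with_function:
  assumes X: "prevariety X" and S: "prevariety S" and \<pi>: "morphism X S \<pi>"
    and C: "irreducible_curve_in X C" and nonconst: "\<forall>s\<in>points S. \<not> C \<subseteq> fiber X \<pi> s"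
  obtains U n \<phi> t g h F where "affine_chart X U n \<phi>" "g \<in> poly_fun n" "h \<in> poly_fun n" "F \<subseteq> poly_fun n"
    "\<And>u. u \<in> U \<Longrightarrow> h (\<phi> u) \<noteq> 0 \<Longrightarrow> t u = g (\<phi> u) / h (\<phi> u)"
    "\<phi> ` {u \<in> C \<inter> U. h (\<phi> u) \<noteq> 0} = {x \<in> {..<n} \<rightarrow>\<^sub>E UNIV. (\<forall>f\<in>F. f x = 0) \<and> h x \<noteq> 0}"
    "\<And>u v. \<pi> u = \<pi> v \<Longrightarrow> t u = t v"
    "\<And>a. a \<noteq> 0 \<Longrightarrow> \<exists>u\<in>{u \<in> C \<inter> U. h (\<phi> u) \<noteq> 0}. poly a (t u) \<noteq> 0"
proof -
  let ?T = "subtopology (zar X) C"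
  have swf: "space_with_functions X" using X unfolding prevariety_def by blast
  have CX: "C \<subseteq> points X" using C by (rule curve_subset_points)
  have irr: "irreducible_top ?T" using C unfolding irreducible_curve_in_def by blast
  obtain G E where GE: "openin (zar X) G" "closedin (zar X) E" "C = G \<inter> E"
    using C unfolding irreducible_curve_in_def by blast
  have cont: "continuous_map (zar X) (zar S) \<pi>" using \<pi> unfolding morphism_def by blast
  have relopen: "openin ?T (C \<inter> V)" if "openin (zar X) V" for V
    using that unfolding openin_subtopology by blast
  have meet: "A \<inter> B \<noteq> {}" if "openin ?T A" "openin ?T B" "A \<noteq> {}" "B \<noteq> {}" for A B
    using irr that unfolding irreducible_top_iff_open by blast
  \<comment> \<open>two points of the curve, over the same affine open subset of the base, with different images\<close>
  obtain p where p: "p \<in> C" using irr unfolding irreducible_top_def by auto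
  have \<pi>S: "\<pi> u \<in> points S" if "u \<in> C" for u using cont CX that by (auto simp: continuous_map_def)
  obtain V m \<psi> where V: "affine_chart S V m \<psi>" "\<pi> p \<in> V"
    using S \<pi>S[OF p] by (rule prevariety_chart_at)
  define \<Omega> where "\<Omega> = {u \<in> points X. \<pi> u \<in> V}"
  have \<Omega>: "openin (zar X) \<Omega>"
    unfolding \<Omega>_def using openin_continuous_map_preimage[OF cont chart_open[OF V(1)]] .
  have p\<Omega>: "p \<in> \<Omega>" unfolding \<Omega>_def using p CX V(2) by blast
  obtain p' where p': "p' \<in> C" "p' \<in> \<Omega>" "\<pi> p' \<noteq> \<pi> p"
  proof -
    have "openin (zar S) (points S - {\<pi> p})"
      using prevariety_points_closed[OF S \<pi>S[OF p]] by (intro openin_diff openin_topspace)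
    then have "openin (zar X) {u \<in> points X. \<pi> u \<in> points S - {\<pi> p}}"
      by (rule openin_continuous_map_preimage[OF cont])
    then have "openin ?T (C \<inter> {u \<in> points X. \<pi> u \<in> points S - {\<pi> p}})" by (rule relopen)
    moreover have "C \<inter> {u \<in> points X. \<pi> u \<in> points S - {\<pi> p}} \<noteq> {}"
      using nonconst[rule_format, OF \<pi>S[OF p]] CX \<pi>S unfolding fiber_def by blast
    moreover have "C \<inter> \<Omega> \<noteq> {}" using p p\<Omega> by blast
    ultimately have "(C \<inter> \<Omega>) \<inter> (C \<inter> {u \<in> points X. \<pi> u \<in> points S - {\<pi> p}}) \<noteq> {}"
      using meet[OF relopen[OF \<Omega>]] by simp
    then show thesis using that by blast
  qed
  obtain i where i: "i < m" "\<psi> (\<pi> p') i \<noteq> \<psi> (\<pi> p) i"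
    using chart_point_separation[OF V(1) _ V(2) p'(3)] p'(2) unfolding \<Omega>_def by blast
  define t where "t u = \<psi> (\<pi> u) i" for u
  have t_open: "openin (zar X) {u \<in> \<Omega>. t u \<noteq> c}" for c
  proof -
    have "(\<lambda>x. x i - c) \<in> poly_fun m"
      using i(1) by (intro poly_fun_diff poly_fun.const poly_fun.coord)
    then have "openin (zar S) {s \<in> V. \<psi> s i - c \<noteq> 0}" by (rule chart_principal_open[OF V(1)])
    from openin_continuous_map_preimage[OF cont this]
    have "openin (zar X) {u \<in> points X. \<pi> u \<in> {s \<in> V. \<psi> s i - c \<noteq> 0}}" .
    moreover have "{u \<in> points X. \<pi> u \<in> {s \<in> V. \<psi> s i - c \<noteq> 0}} = {u \<in> \<Omega>. t u \<noteq> c}"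
      unfolding \<Omega>_def t_def by auto
    ultimately show ?thesis by simp
  qed
  have t_reg: "t \<in> regular_near X p"
  proof -
    have "reg S V (\<lambda>s. \<psi> s i / 1)"
      using chart_quotient_reg[OF V(1) chart_open[OF V(1)] order_refl poly_fun.coord[OF i(1)] poly_fun.const[of 1]]
      by simp
    from \<pi>[unfolded morphism_def, THEN conjunct2, rule_format, OF chart_open[OF V(1)] this]
    have "reg X \<Omega> (\<lambda>u. \<psi> (\<pi> u) i)" unfolding \<Omega>_def by simp
    then show ?thesis unfolding regular_near_iff t_def[abs_def] using \<Omega> p\<Omega> by blast
  qed
  obtain U n \<phi> where ch: "affine_chart X U n \<phi>" "p \<in> U"
    using X subsetD[OF CX p] by (rule prevariety_chart_at)
  obtain W g0 h0 where W: "openin (zar X) W" "p \<in> W" "W \<subseteq> U" and gh0: "g0 \<in> poly_fun n" "h0 \<in> poly_fun n"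
    and eq: "\<And>u. u \<in> W \<Longrightarrow> h0 (\<phi> u) \<noteq> 0" "\<And>u. u \<in> W \<Longrightarrow> t u = g0 (\<phi> u) / h0 (\<phi> u)"
    by (rule regular_near_chart_quotient[OF swf ch t_reg]) blast
  have "openin (zar X) (W \<inter> \<Omega> \<inter> G)" using W(1) \<Omega> GE(1) by (intro openin_Int)
  moreover have "W \<inter> \<Omega> \<inter> G \<subseteq> U" using W(3) by blast
  moreover have "p \<in> W \<inter> \<Omega> \<inter> G" using W(2) p\<Omega> p GE(3) by blast
  ultimately obtain k where k: "k \<in> poly_fun n" "k (\<phi> p) \<noteq> 0" "{u \<in> U. k (\<phi> u) \<noteq> 0} \<subseteq> W \<inter> \<Omega> \<inter> G"
    using chart_openin[OF ch(1), of "W \<inter> \<Omega> \<inter> G"] by blast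
  define g where "g x = g0 x * k x" for x
  define h where "h x = h0 x * k x" for x
  have gh: "g \<in> poly_fun n" "h \<in> poly_fun n"
    using poly_fun.mult[OF gh0(1) k(1)] poly_fun.mult[OF gh0(2) k(1)]
    by (simp_all add: g_def[abs_def] h_def[abs_def])
  have sub: "u \<in> W \<and> u \<in> \<Omega> \<and> u \<in> G" if "u \<in> U" "h (\<phi> u) \<noteq> 0" for u
    using k(3) that unfolding h_def by auto
  have t_eq: "t u = g (\<phi> u) / h (\<phi> u)" if "u \<in> U" "h (\<phi> u) \<noteq> 0" for u
    using eq[of u] sub[OF that] that by (simp add: g_def h_def)
  let ?D = "{u \<in> C \<inter> U. h (\<phi> u) \<noteq> 0}"
  have "p \<in> ?D" using p ch(2) k(2) eq(1)[OF W(2)] unfolding h_def by simp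
  have "?D = C \<inter> {u \<in> U. h (\<phi> u) \<noteq> 0}" by blast
  then have D_open: "openin ?T ?D" using relopen[OF chart_principal_open[OF ch(1) gh(2)]] by simp
  obtain F1 where F1: "F1 \<subseteq> poly_fun n" "\<phi> ` U = {x \<in> {..<n} \<rightarrow>\<^sub>E UNIV. \<forall>f\<in>F1. f x = 0}"
    using chart_algebraic[OF ch(1)] unfolding algebraic_set_def by blast
  obtain F2 where F2: "F2 \<subseteq> poly_fun n" "E \<inter> U = {u \<in> U. \<forall>f\<in>F2. f (\<phi> u) = 0}"
    using chart_relatively_closed[OF ch(1) order_refl GE(2)] by blast
  have "?D = {u \<in> U. (\<forall>f\<in>F2. f (\<phi> u) = 0) \<and> h (\<phi> u) \<noteq> 0}"
    using F2(2) sub GE(3) by blast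
  then have "\<phi> ` ?D = {x \<in> \<phi> ` U. (\<forall>f\<in>F2. f x = 0) \<and> h x \<noteq> 0}" by auto
  also have "\<dots> = {x \<in> {..<n} \<rightarrow>\<^sub>E UNIV. (\<forall>f\<in>F1 \<union> F2. f x = 0) \<and> h x \<noteq> 0}"
    unfolding F1(2) by blast
  finally have im: "\<phi> ` ?D = {x \<in> {..<n} \<rightarrow>\<^sub>E UNIV. (\<forall>f\<in>F1 \<union> F2. f x = 0) \<and> h x \<noteq> 0}" .
  have transcendental: "\<exists>u\<in>?D. poly a (t u) \<noteq> 0" if "a \<noteq> 0" for a
  proof -
    \<comment> \<open>generically \<open>t\<close> avoids the finitely many roots of \<open>a\<close>\<close>
    let ?R = "{c. poly a c = 0}"
    let ?U = "\<lambda>c. C \<inter> {u \<in> \<Omega>. t u \<noteq> c}"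
    have "openin ?T (?U c) \<and> ?U c \<noteq> {}" for c
    proof
      show "openin ?T (?U c)" by (rule relopen[OF t_open])
      have "t p' \<noteq> t p" using i(2) unfolding t_def .
      then have "t p \<noteq> c \<or> t p' \<noteq> c" by blast
      then show "?U c \<noteq> {}" using p p' p\<Omega> by blast
    qed
    moreover have "finite ?R" using poly_roots_finite[OF that] .
    ultimately have "?D \<inter> (\<Inter>c\<in>?R. ?U c) \<noteq> {}"
      using irreducible_top_finite_Inter[OF irr, of ?R ?U ?D] D_open \<open>p \<in> ?D\<close> by blast
    then obtain u where "u \<in> ?D \<inter> (\<Inter>c\<in>?R. ?U c)" unfolding ex_in_conv[symmetric] by (rule exE)
    then have u: "u \<in> ?D" "u \<in> (\<Inter>c\<in>?R. ?U c)" by (rule IntD1, rule IntD2)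
    have "poly a (t u) \<noteq> 0"
    proof
      assume "poly a (t u) = 0"
      with u(2) have "u \<in> ?U (t u)" by blast
      then show False by simp
    qed
    with u(1) show ?thesis by blast
  qed
  show thesis
  proof (rule that[OF ch(1) gh _ t_eq im _ transcendental])
    show "F1 \<union> F2 \<subseteq> poly_fun n" using F1(1) F2(1) by blast
    show "t u = t v" if "\<pi> u = \<pi> v" for u v using that unfolding t_def by simp
  qed
qed

text \<open>Each coordinate satisfies a separable relation over \<open>t\<close>. Outside the zeros of the finitely many derivatives, the
  relations can be solved for \<open>x\<^sub>i - x\<^sub>i(p)\<close> as multiples of \<open>t - t(p)\<close>.\<close>

lemma curve_generic_coordinates:
  assumes X: "prevariety X" and C: "irreducible_curve_in X C"
    and ch: "affine_chart X U n \<phi>" and g: "g \<in> poly_fun n" and h: "h \<in> poly_fun n" and F: "F \<subseteq> poly_fun n"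
    and t: "\<And>u. u \<in> U \<Longrightarrow> h (\<phi> u) \<noteq> 0 \<Longrightarrow> t u = g (\<phi> u) / h (\<phi> u)"
    and im: "\<phi> ` {u \<in> C \<inter> U. h (\<phi> u) \<noteq> 0} = {x \<in> {..<n} \<rightarrow>\<^sub>E UNIV. (\<forall>f\<in>F. f x = 0) \<and> h x \<noteq> 0}"
    and transcendental: "\<And>a. a \<noteq> 0 \<Longrightarrow> \<exists>u\<in>{u \<in> C \<inter> U. h (\<phi> u) \<noteq> 0}. poly a (t u) \<noteq> 0"
  obtains V where "openin (subtopology (zar X) C) V" "V \<noteq> {}" "V \<subseteq> U"
    "\<And>p. p \<in> V \<Longrightarrow> t \<in> regular_near X p"
    "\<And>p i. p \<in> V \<Longrightarrow> i < n \<Longrightarrow> \<exists>w\<in>regular_near X p. \<exists>W. openin (zar X) W \<and> p \<in> W \<and>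
       (\<forall>u\<in>W \<inter> C. \<phi> u i - \<phi> p i = (t u - t p) * w u)"
proof -
  let ?T = "subtopology (zar X) C"
  let ?DU = "{u \<in> U. h (\<phi> u) \<noteq> 0}"
  let ?D = "{u \<in> C \<inter> U. h (\<phi> u) \<noteq> 0}"
  have swf: "space_with_functions X" using X unfolding prevariety_def by blast
  have CX: "C \<subseteq> points X" using C by (rule curve_subset_points)
  have topC: "topspace ?T = C" using CX by auto
  have irr: "irreducible_top ?T" using C unfolding irreducible_curve_in_def by blast
  have relopen: "openin ?T (C \<inter> V)" if "openin (zar X) V" for V
    using that unfolding openin_subtopology by blast
  have DU_open: "openin (zar X) ?DU" using ch h by (rule chart_principal_open)
  have "?D = C \<inter> ?DU" by blast
  then have D_open: "openin ?T ?D" using relopen[OF DU_open] by simp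
  have "?D \<noteq> {}" using transcendental[of 1] by auto
  have t_near: "t \<in> regular_near X p" if "p \<in> ?DU" for p
  proof -
    have p: "p \<in> U" "h (\<phi> p) \<noteq> 0" using that by simp_all
    from quotient_regular_near[OF ch p(1) g h p(2)] DU_open that
    show ?thesis by (rule regular_near_cong[OF swf]) (simp add: t)
  qed
  have coord_near: "(\<lambda>u. \<phi> u i) \<in> regular_near X p" if "p \<in> ?DU" "i < n" for p i
    using quotient_regular_near[OF ch _ poly_fun.coord[OF that(2)] poly_fun.const[of 1], of p] that(1)
    by simp
  have finite_zeros: "finite {x \<in> \<phi> ` ?D. f x = 0}"
    if f: "f \<in> poly_fun n" "\<exists>x\<in>\<phi> ` ?D. f x \<noteq> 0" for f
  proof -
    let ?N = "C \<inter> {u \<in> U. h (\<phi> u) * f (\<phi> u) \<noteq> 0}"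
    have "openin ?T ?N"
      using relopen[OF chart_principal_open[OF ch poly_fun.mult[OF h f(1)]]] .
    from closedin_diff[OF closedin_topspace this] have "closedin ?T (C - ?N)" unfolding topC .
    moreover have "C - ?N \<noteq> C" using f(2) by auto
    ultimately have "finite (C - ?N)" by (rule proper_closed_subset_of_curve_finite[OF X C])
    then have "finite {u \<in> ?D. f (\<phi> u) = 0}" by (rule rev_finite_subset) auto
    then have "finite (\<phi> ` {u \<in> ?D. f (\<phi> u) = 0})" by (rule finite_imageI)
    then show ?thesis by (rule rev_finite_subset) auto
  qed
  have "\<exists>Q. (\<forall>u\<in>?D. poly (poly Q [:\<phi> u i:]) (t u) = 0) \<and>
      (\<exists>u\<in>?D. poly (poly (pderiv Q) [:\<phi> u i:]) (t u) \<noteq> 0)" if i: "i < n" for i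
  proof -
    obtain P :: "complex poly poly" where P: "P \<noteq> 0"
      "\<forall>x\<in>\<phi> ` ?D. poly (poly P [:x i:]) (g x / h x) = 0"
      using algebraic_dependence[OF im F g h finite_zeros poly_fun.coord[OF i]] by blast
    have P': "poly (poly P [:\<phi> u i:]) (t u) = 0" if "u \<in> ?D" for u
    proof -
      have "t u = g (\<phi> u) / h (\<phi> u)" using t that by simp
      with P(2) that show ?thesis by simp
    qed
    show ?thesis by (rule separable_relation[OF P(1) P' transcendental])
  qed
  then have "\<forall>i. \<exists>Q. i < n \<longrightarrow> (\<forall>u\<in>?D. poly (poly Q [:\<phi> u i:]) (t u) = 0) \<and>
      (\<exists>u\<in>?D. poly (poly (pderiv Q) [:\<phi> u i:]) (t u) \<noteq> 0)"
    by blast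
  then obtain Q where *: "\<forall>i. i < n \<longrightarrow> (\<forall>u\<in>?D. poly (poly (Q i) [:\<phi> u i:]) (t u) = 0) \<and>
      (\<exists>u\<in>?D. poly (poly (pderiv (Q i)) [:\<phi> u i:]) (t u) \<noteq> 0)"
    by (rule choice[THEN exE])
  have Q: "poly (poly (Q i) [:\<phi> u i:]) (t u) = 0" if "i < n" "u \<in> ?D" for i u
    using *[rule_format, OF that(1)] that(2) by blast
  have Q': "\<exists>u\<in>?D. poly (poly (pderiv (Q i)) [:\<phi> u i:]) (t u) \<noteq> 0" if "i < n" for i
    using *[rule_format, OF that] by blast
  let ?U = "\<lambda>i. C \<inter> {u \<in> ?DU. poly (poly (pderiv (Q i)) [:\<phi> u i:]) (t u) \<noteq> 0}"
  have U: "openin ?T (?U i) \<and> ?U i \<noteq> {}" if i: "i \<in> {..<n}" for i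
  proof
    have "openin (zar X) {u \<in> ?DU. poly (poly (pderiv (Q i)) [:\<phi> u i:]) (t u) \<noteq> 0}"
    proof (subst openin_subopen, intro ballI)
      fix p assume p: "p \<in> {u \<in> ?DU. poly (poly (pderiv (Q i)) [:\<phi> u i:]) (t u) \<noteq> 0}"
      then have pU: "p \<in> ?DU" by blast
      have "(\<lambda>u. poly (poly (pderiv (Q i)) [:\<phi> u i:]) (t u)) \<in> regular_near X p"
        using i pU by (intro regular_near_poly_poly[OF swf] t_near coord_near) auto
      from regular_near_nonvanishing(1)[OF X this] p
      obtain W where W: "openin (zar X) W" "p \<in> W"
        "\<forall>u\<in>W. poly (poly (pderiv (Q i)) [:\<phi> u i:]) (t u) \<noteq> 0" by blast
      show "\<exists>N. openin (zar X) N \<and> p \<in> N \<and>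
          N \<subseteq> {u \<in> ?DU. poly (poly (pderiv (Q i)) [:\<phi> u i:]) (t u) \<noteq> 0}"
        using openin_Int[OF W(1) DU_open] W(2,3) pU by (intro exI[of _ "W \<inter> ?DU"]) auto
    qed
    then show "openin ?T (?U i)" by (rule relopen)
    show "?U i \<noteq> {}" using Q'[of i] i by auto
  qed
  let ?V = "?D \<inter> (\<Inter>i\<in>{..<n}. ?U i)"
  have V: "openin ?T ?V" "?V \<noteq> {}"
    using irreducible_top_finite_Inter[OF irr finite_lessThan U D_open \<open>?D \<noteq> {}\<close>] by simp_all
  show thesis
  proof (rule that[OF V])
    show "?V \<subseteq> U" by blast
    show "t \<in> regular_near X p" if "p \<in> ?V" for p using that by (intro t_near) blast
  next
    fix p i assume p: "p \<in> ?V" and i: "i < n"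
    have "p \<in> ?U i" by (rule INT_D[OF IntD2[OF p]]) (simp add: i)
    have pD: "p \<in> ?D" and pU: "p \<in> ?DU" using IntD1[OF p] by simp_all
    obtain R q where
      R: "\<And>y s. poly (poly (Q i) [:y:]) s = (y - \<phi> p i) * poly (poly R [:y:]) s + (s - t p) * poly q s"
      and Rp: "poly (poly R [:\<phi> p i:]) (t p) = poly (poly (pderiv (Q i)) [:\<phi> p i:]) (t p)"
      using Q[OF i pD] by (rule relation_linearisation) blast
    let ?r = "\<lambda>u. poly (poly R [:\<phi> u i:]) (t u)"
    have r_near: "?r \<in> regular_near X p"
      using i pU by (intro regular_near_poly_poly[OF swf] t_near coord_near)
    have "?r p \<noteq> 0" unfolding Rp using \<open>p \<in> ?U i\<close> by blast
    note r_inv = regular_near_nonvanishing[OF X r_near this]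
    obtain W where W: "openin (zar X) W" "p \<in> W" "\<forall>u\<in>W. ?r u \<noteq> 0" using r_inv(1) by blast
    let ?w = "\<lambda>u. - 1 * (poly q (t u) * inverse (?r u))"
    have "?w \<in> regular_near X p"
      using pU r_inv(2)
      by (intro regular_near_cmult[OF swf] regular_near_mult[OF swf] regular_near_poly[OF swf] t_near)
    moreover have "\<phi> u i - \<phi> p i = (t u - t p) * ?w u" if u: "u \<in> (W \<inter> ?DU) \<inter> C" for u
    proof -
      have "(\<phi> u i - \<phi> p i) * ?r u + (t u - t p) * poly q (t u) = 0"
        using R[of "\<phi> u i" "t u"] Q[OF i, of u] u by simp
      then have "(\<phi> u i - \<phi> p i) * ?r u = (t u - t p) * (- poly q (t u))"
        by (simp add: add_eq_0_iff2)
      moreover have "?r u \<noteq> 0" using W(3) u by blast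
      ultimately have "\<phi> u i - \<phi> p i = (t u - t p) * (- poly q (t u)) / ?r u"
        by (metis nonzero_mult_div_cancel_right)
      then show ?thesis by (simp add: divide_inverse mult.assoc)
    qed
    moreover have "openin (zar X) (W \<inter> ?DU)" "p \<in> W \<inter> ?DU"
      using W(1,2) DU_open pU by (auto intro: openin_Int)
    ultimately show "\<exists>w\<in>regular_near X p. \<exists>W. openin (zar X) W \<and> p \<in> W \<and>
        (\<forall>u\<in>W \<inter> C. \<phi> u i - \<phi> p i = (t u - t p) * w u)"
      by (intro bexI[of _ ?w] exI[of _ "W \<inter> ?DU"] conjI ballI)
  qed
qed

text \<open>Once the coordinates differ from their values at \<open>p\<close> by multiples of \<open>t - t(p)\<close>, the same holds for
  polynomials and then for quotients of polynomials.\<close>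

lemma uniformiser_expansion:
  assumes X: "prevariety X" and ch: "affine_chart X U n \<phi>" and p: "p \<in> U" "p \<in> C"
    and t: "t \<in> regular_near X p"
    and coords: "\<And>i. i < n \<Longrightarrow> \<exists>w\<in>regular_near X p. \<exists>W. openin (zar X) W \<and> p \<in> W \<and>
       (\<forall>u\<in>W \<inter> C. \<phi> u i - \<phi> p i = (t u - t p) * w u)"
    and f: "f \<in> regular_near X p"
  shows "\<exists>r\<in>regular_near X p. \<exists>W. openin (zar X) W \<and> p \<in> W \<and>
       (\<forall>u\<in>W \<inter> C. f u = f p + (t u - t p) * r u)"
proof -
  have swf: "space_with_functions X" using X unfolding prevariety_def by blast
  have pX: "p \<in> points X" using t by (rule regular_near_point)
  obtain w W where w: "\<And>i. i < n \<Longrightarrow> w i \<in> regular_near X p"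
    "\<And>i. i < n \<Longrightarrow> openin (zar X) (W i)" "\<And>i. i < n \<Longrightarrow> p \<in> W i"
    "\<And>i u. i < n \<Longrightarrow> u \<in> W i \<inter> C \<Longrightarrow> \<phi> u i - \<phi> p i = (t u - t p) * w i u"
  proof -
    define K where "K i w W \<longleftrightarrow> w \<in> regular_near X p \<and> openin (zar X) W \<and> p \<in> W \<and>
      (\<forall>u\<in>W \<inter> C. \<phi> u i - \<phi> p i = (t u - t p) * w u)" for i w W
    have "\<forall>i\<in>{..<n}. \<exists>x. K i (fst x) (snd x)"
    proof
      fix i assume "i \<in> {..<n}"
      then obtain w W where "K i w W" using coords[of i] unfolding K_def by blast
      then show "\<exists>x. K i (fst x) (snd x)" by (intro exI[of _ "(w, W)"]) simp
    qed
    from bchoice[OF this] obtain x where "\<forall>i\<in>{..<n}. K i (fst (x i)) (snd (x i))" by blast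
    then have x: "K i (fst (x i)) (snd (x i))" if "i < n" for i using that by blast
    show thesis
      by (rule that[of "\<lambda>i. fst (x i)" "\<lambda>i. snd (x i)"]; drule x; unfold K_def; blast)
  qed
  obtain V g h where V: "openin (zar X) V" "p \<in> V" "V \<subseteq> U" and gh: "g \<in> poly_fun n" "h \<in> poly_fun n"
    and eq: "\<And>u. u \<in> V \<Longrightarrow> h (\<phi> u) \<noteq> 0" "\<And>u. u \<in> V \<Longrightarrow> f u = g (\<phi> u) / h (\<phi> u)"
    by (rule regular_near_chart_quotient[OF swf ch p(1) f]) blast
  let ?c = "\<phi> p"
  have "(\<lambda>x. g x * h ?c - g ?c * h x) \<in> poly_fun n"
    by (rule poly_fun_diff[OF poly_fun.mult[OF gh(1) poly_fun.const] poly_fun_cmult[OF gh(2)]])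
  from poly_fun_difference_expansion[OF this, of ?c]
  obtain r where r: "\<forall>i<n. r i \<in> poly_fun n"
    "\<And>x. g x * h ?c - g ?c * h x = (\<Sum>i<n. (x i - ?c i) * r i x)" by auto
  let ?r = "\<lambda>u. \<Sum>i<n. w i u * (r i (\<phi> u) / (h (\<phi> u) * h ?c))"
  have "?r \<in> regular_near X p"
  proof (rule regular_near_sum[OF swf pX])
    fix i assume "i \<in> {..<n}"
    then have i: "i < n" by simp
    have "(\<lambda>x. h x * h ?c) \<in> poly_fun n" by (rule poly_fun.mult[OF gh(2) poly_fun.const])
    from quotient_regular_near[OF ch p(1) r(1)[rule_format, OF i] this] eq(1)[OF V(2)]
    have "(\<lambda>u. r i (\<phi> u) / (h (\<phi> u) * h ?c)) \<in> regular_near X p" by simp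
    with w(1)[OF i] show "(\<lambda>u. w i u * (r i (\<phi> u) / (h (\<phi> u) * h ?c))) \<in> regular_near X p"
      by (rule regular_near_mult[OF swf])
  qed
  moreover let ?W = "V \<inter> (\<Inter>i\<in>{..<n}. W i \<inter> points X)"
  have "openin (zar X) ?W \<and> p \<in> ?W"
  proof
    have "openin (zar X) (points X \<inter> (\<Inter>i\<in>{..<n}. W i))"
    proof (cases "n = 0")
      case False
      then have "openin (zar X) (\<Inter>i\<in>{..<n}. W i)" using w(2) by (intro openin_INT2) auto
      then show ?thesis by (intro openin_Int openin_topspace)
    qed simp
    from openin_Int[OF V(1) this] have "openin (zar X) (V \<inter> (points X \<inter> (\<Inter>i\<in>{..<n}. W i)))" .
    moreover have "V \<inter> (points X \<inter> (\<Inter>i\<in>{..<n}. W i)) = ?W"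
      using openin_subset[OF V(1)] by auto
    ultimately show "openin (zar X) ?W" by simp
    show "p \<in> ?W" using V(2) w(3) pX by simp
  qed
  moreover have "f u = f p + (t u - t p) * ?r u" if u: "u \<in> ?W \<inter> C" for u
  proof -
    have nz: "h (\<phi> u) \<noteq> 0" "h ?c \<noteq> 0" using eq(1) u V(2) by auto
    have "f u - f p = (g (\<phi> u) * h ?c - g ?c * h (\<phi> u)) / (h (\<phi> u) * h ?c)"
      using eq(2)[of u] eq(2)[OF V(2)] nz u by (simp add: diff_frac_eq)
    also have "\<dots> = (\<Sum>i<n. ((t u - t p) * w i u) * r i (\<phi> u)) / (h (\<phi> u) * h ?c)"
    proof -
      have "\<phi> u i - ?c i = (t u - t p) * w i u" if "i < n" for i
        using u that by (intro w(4)) blast+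
      then show ?thesis unfolding r(2) by simp
    qed
    also have "\<dots> = (t u - t p) * ?r u"
      by (simp add: sum_divide_distrib sum_distrib_left mult.assoc)
    finally show ?thesis by (simp add: algebra_simps)
  qed
  ultimately show ?thesis
    by (intro bexI[of _ ?r] exI[of _ ?W] conjI ballI) (simp_all only:)
qed

text \<open>The conclusion says that functions vanishing on the fiber of \<open>\<pi>\<close> through \<open>p\<close> generate the maximal ideal of the local
  ring of \<open>C\<close> at \<open>p\<close>; the function \<open>e\<close> is a multiple of \<open>t - t p\<close>.\<close>

theorem curve_generically_unramified:
  assumes X: "prevariety X" and S: "prevariety S" and \<pi>: "morphism X S \<pi>"
    and C: "irreducible_curve_in X C" and nonconst: "\<forall>s\<in>points S. \<not> C \<subseteq> fiber X \<pi> s"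
  obtains V where "openin (subtopology (zar X) C) V" "V \<noteq> {}"
    "\<And>p f. p \<in> V \<Longrightarrow> f \<in> regular_near X p \<Longrightarrow> \<exists>e\<in>regular_near X p. (\<forall>u. \<pi> u = \<pi> p \<longrightarrow> e u = 0) \<and>
       (\<exists>W. openin (zar X) W \<and> p \<in> W \<and> (\<forall>u\<in>W \<inter> C. f u = f p + e u))"
proof -
  have swf: "space_with_functions X" using X unfolding prevariety_def by blast
  obtain U n \<phi> t g h F where ch: "affine_chart X U n \<phi>" "g \<in> poly_fun n" "h \<in> poly_fun n" "F \<subseteq> poly_fun n"
    "\<And>u. u \<in> U \<Longrightarrow> h (\<phi> u) \<noteq> 0 \<Longrightarrow> t u = g (\<phi> u) / h (\<phi> u)"
    "\<phi> ` {u \<in> C \<inter> U. h (\<phi> u) \<noteq> 0} = {x \<in> {..<n} \<rightarrow>\<^sub>E UNIV. (\<forall>f\<in>F. f x = 0) \<and> h x \<noteq> 0}"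
    and t: "\<And>u v. \<pi> u = \<pi> v \<Longrightarrow> t u = t v"
    and tr: "\<And>a. a \<noteq> 0 \<Longrightarrow> \<exists>u\<in>{u \<in> C \<inter> U. h (\<phi> u) \<noteq> 0}. poly a (t u) \<noteq> 0"
    by (rule curve_chart_with_function[OF assms]) blast
  obtain V where V: "openin (subtopology (zar X) C) V" "V \<noteq> {}" "V \<subseteq> U"
    and tV: "\<And>p. p \<in> V \<Longrightarrow> t \<in> regular_near X p"
    and coords: "\<And>p i. p \<in> V \<Longrightarrow> i < n \<Longrightarrow> \<exists>w\<in>regular_near X p. \<exists>W. openin (zar X) W \<and> p \<in> W \<and>
       (\<forall>u\<in>W \<inter> C. \<phi> u i - \<phi> p i = (t u - t p) * w u)"
    by (rule curve_generic_coordinates[OF X C ch tr]) blast+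
  show thesis
  proof (rule that[OF V(1,2)])
    fix p f assume p: "p \<in> V" and f: "f \<in> regular_near X p"
    have "p \<in> C" using p openin_subset[OF V(1)] by auto
    obtain r W where r: "r \<in> regular_near X p" "openin (zar X) W" "p \<in> W"
      "\<forall>u\<in>W \<inter> C. f u = f p + (t u - t p) * r u"
      using uniformiser_expansion[OF X ch(1) subsetD[OF V(3) p] \<open>p \<in> C\<close> tV[OF p] coords[OF p] f]
      by blast
    have "(\<lambda>u. (t u - t p) * r u) \<in> regular_near X p"
      using r(1) tV[OF p] regular_near_const[OF swf regular_near_point[OF f]]
      by (intro regular_near_mult[OF swf] regular_near_diff[OF swf])
    moreover have "(t u - t p) * r u = 0" if "\<pi> u = \<pi> p" for u using t[OF that] by simp
    ultimately show "\<exists>e\<in>regular_near X p. (\<forall>u. \<pi> u = \<pi> p \<longrightarrow> e u = 0) \<and>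
       (\<exists>W. openin (zar X) W \<and> p \<in> W \<and> (\<forall>u\<in>W \<inter> C. f u = f p + e u))"
      using r(2-) by (intro bexI[of _ "\<lambda>u. (t u - t p) * r u"]) blast+
  qed
qed

section \<open>Intersection multiplicity one\<close>

lemma near_ring_simps:
  "f \<otimes>\<^bsub>near_ring X p\<^esub> g = (\<lambda>x. f x * g x)" "\<one>\<^bsub>near_ring X p\<^esub> = (\<lambda>_. 1)"
  "\<zero>\<^bsub>near_ring X p\<^esub> = (\<lambda>_. 0)" "f \<oplus>\<^bsub>near_ring X p\<^esub> g = (\<lambda>x. f x + g x)"
  by (simp_all add: near_ring_def)

lemma near_ring_cring:
  assumes X: "space_with_functions X" and p: "p \<in> points X"
  shows "cring (near_ring X p)"
proof (rule cringI)
  show "abelian_group (near_ring X p)"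
  proof (rule abelian_groupI)
    fix f assume f: "f \<in> carrier (near_ring X p)"
    show "\<exists>g\<in>carrier (near_ring X p). g \<oplus>\<^bsub>near_ring X p\<^esub> f = \<zero>\<^bsub>near_ring X p\<^esub>"
      by (rule bexI[of _ "\<lambda>x. - 1 * f x"])
         (simp add: near_ring_simps, rule regular_near_cmult[OF X f])
  qed (auto simp: near_ring_simps algebra_simps
        intro: regular_near_add[OF X] regular_near_const[OF X p])
  show "Group.comm_monoid (near_ring X p)"
    by (rule comm_monoidI)
       (auto simp: near_ring_simps algebra_simps
         intro: regular_near_mult[OF X] regular_near_const[OF X p])
qed (simp add: near_ring_simps algebra_simps)

lemma vanishing_near_ideal:
  assumes X: "space_with_functions X" and p: "p \<in> points X"
  shows "ideal (vanishing_near X p Y) (near_ring X p)"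
proof -
  interpret N: cring "near_ring X p" by (rule near_ring_cring[OF X p])
  have minus: "\<ominus>\<^bsub>near_ring X p\<^esub> f = (\<lambda>x. - 1 * f x)" if "f \<in> carrier (near_ring X p)" for f
    using that by (intro N.minus_equality regular_near_cmult[OF X]) (simp_all add: near_ring_simps)
  have add: "(\<lambda>x. f x + g x) \<in> vanishing_near X p Y"
    if f: "f \<in> vanishing_near X p Y" and g: "g \<in> vanishing_near X p Y" for f g
  proof -
    obtain U V where U: "openin (zar X) U" "p \<in> U" "\<forall>x\<in>U \<inter> Y. f x = 0"
      and V: "openin (zar X) V" "p \<in> V" "\<forall>x\<in>V \<inter> Y. g x = 0"
      using f g unfolding vanishing_near_def by blast
    have "(\<lambda>x. f x + g x) \<in> regular_near X p"
      using f g unfolding vanishing_near_def by (intro regular_near_add[OF X]) simp_all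
    then show ?thesis
      unfolding vanishing_near_def using U V openin_Int[OF U(1) V(1)]
      by (intro CollectI conjI exI[of _ "U \<inter> V"]) simp_all
  qed
  have mult: "(\<lambda>x. g x * f x) \<in> vanishing_near X p Y"
    if f: "f \<in> vanishing_near X p Y" and g: "g \<in> carrier (near_ring X p)" for f g
  proof -
    obtain U where U: "openin (zar X) U" "p \<in> U" "\<forall>x\<in>U \<inter> Y. f x = 0"
      using f unfolding vanishing_near_def by blast
    have "(\<lambda>x. g x * f x) \<in> regular_near X p"
      using f g unfolding vanishing_near_def by (intro regular_near_mult[OF X]) simp_all
    then show ?thesis
      unfolding vanishing_near_def using U by (intro CollectI conjI exI[of _ U]) simp_all
  qed
  have sub: "vanishing_near X p Y \<subseteq> carrier (near_ring X p)"
    unfolding vanishing_near_def by blast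
  have zero: "(\<lambda>_. 0) \<in> vanishing_near X p Y"
    unfolding vanishing_near_def using p regular_near_const[OF X p] by auto
  show ?thesis
  proof (rule idealI[OF N.ring_axioms])
    show "subgroup (vanishing_near X p Y) (add_monoid (near_ring X p))"
    proof (rule N.add.subgroupI)
      fix f assume f: "f \<in> vanishing_near X p Y"
      have "(\<lambda>x. - 1 * f x) \<in> vanishing_near X p Y"
        by (rule mult[OF f regular_near_const[OF X p]])
      then show "\<ominus>\<^bsub>near_ring X p\<^esub> f \<in> vanishing_near X p Y"
        using minus[OF subsetD[OF sub f]] by simp
    next
      fix f g assume "f \<in> vanishing_near X p Y" "g \<in> vanishing_near X p Y"
      then show "f \<oplus>\<^bsub>near_ring X p\<^esub> g \<in> vanishing_near X p Y"
        unfolding near_ring_simps by (rule add)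
    qed (use sub zero in auto)
  next
    fix f g assume fg: "f \<in> vanishing_near X p Y" "g \<in> carrier (near_ring X p)"
    show "g \<otimes>\<^bsub>near_ring X p\<^esub> f \<in> vanishing_near X p Y"
      unfolding near_ring_simps by (rule mult[OF fg])
    show "f \<otimes>\<^bsub>near_ring X p\<^esub> g \<in> vanishing_near X p Y"
      unfolding near_ring_simps using mult[OF fg] by (simp add: mult.commute)
  qed
qed

lemma germ_hom:
  assumes X: "space_with_functions X" and p: "p \<in> points X"
  shows "ring_hom_ring (near_ring X p) (local_ring X p) (germ X p)"
  unfolding local_ring_def germ_def[abs_def]
  by (rule ideal.rcos_ring_hom_ring[OF vanishing_near_ideal[OF X p]])

lemma carrier_quotient_ring: "carrier (R Quot I) = (\<lambda>a. I +>\<^bsub>R\<^esub> a) ` carrier R"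
  by (auto simp: FactRing_def A_RCOSETS_def')

lemma germ_surj: "carrier (local_ring X p) = germ X p ` carrier (near_ring X p)"
  unfolding local_ring_def germ_def[abs_def] by (rule carrier_quotient_ring)

text \<open>Evaluation at \<open>p\<close> is well defined on germs.\<close>

lemma germ_eq_value:
  assumes X: "space_with_functions X" and p: "p \<in> points X" and eq: "germ X p f = germ X p g"
  shows "f p = g p"
proof -
  have "(\<lambda>_. 0) \<in> vanishing_near X p UNIV"
    unfolding vanishing_near_def using p regular_near_const[OF X p] by auto
  then have "f \<in> germ X p f"
    unfolding germ_def a_r_coset_def' by (auto simp: near_ring_simps intro!: bexI[of _ "\<lambda>_. 0"])
  then have "f \<in> germ X p g" using eq by simp
  then obtain v where "v \<in> vanishing_near X p UNIV" "f = (\<lambda>x. v x + g x)"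
    unfolding germ_def a_r_coset_def' by (auto simp: near_ring_simps)
  then show ?thesis unfolding vanishing_near_def by auto
qed

lemma (in ring_hom_ring) surj_image_ideal:
  assumes surj: "carrier S = h ` carrier R" and I: "ideal I R"
  shows "ideal (h ` I) S"
proof (rule idealI[OF S.ring_axioms])
  have "group_hom (add_monoid R) (add_monoid S) h" by (rule abelian_group_hom.a_group_hom[OF abelian_group_hom_axioms])
  then show "subgroup (h ` I) (add_monoid S)"
    by (rule group_hom.subgroup_img_is_subgroup)
       (rule additive_subgroup.a_subgroup[OF ideal.axioms(1)[OF I]])
next
  fix a x assume "a \<in> h ` I" "x \<in> carrier S"
  then obtain i r where ir: "i \<in> I" "r \<in> carrier R" "a = h i" "x = h r" using surj by auto
  have i: "i \<in> carrier R" using I ir(1) by (rule ideal.Icarr)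
  show "x \<otimes>\<^bsub>S\<^esub> a \<in> h ` I"
    using ir i ideal.I_l_closed[OF I ir(1,2)] by (metis hom_mult image_eqI)
  show "a \<otimes>\<^bsub>S\<^esub> x \<in> h ` I"
    using ir i ideal.I_r_closed[OF I ir(1,2)] by (metis hom_mult image_eqI)
qed

text \<open>The field of constants, as a ring with explicit carrier, so that the constant functions are the image of a
  ring homomorphism.\<close>

definition complex_ring :: "complex ring" where
  "complex_ring = \<lparr>carrier = UNIV, monoid.mult = (*), one = 1, zero = 0, add = (+)\<rparr>"

lemma complex_ring_field: "field complex_ring"
proof (rule cring.cring_fieldI2)
  show "cring complex_ring"
  proof (rule cringI)
    show "abelian_group complex_ring"
      by (rule abelian_groupI) (auto simp: complex_ring_def algebra_simps intro: exI[of _ "- _"])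
    show "Group.comm_monoid complex_ring"
      by (rule comm_monoidI) (auto simp: complex_ring_def algebra_simps)
  qed (simp add: complex_ring_def algebra_simps)
  show "\<exists>b\<in>carrier complex_ring. a \<otimes>\<^bsub>complex_ring\<^esub> b = \<one>\<^bsub>complex_ring\<^esub>"
    if "a \<noteq> \<zero>\<^bsub>complex_ring\<^esub>" for a
    using that by (intro bexI[of _ "inverse a"]) (simp_all add: complex_ring_def)
qed (simp add: complex_ring_def)

text \<open>The decomposition says that the constants map onto the quotient, which is therefore the field of
  constants itself, of dimension 1 over itself.\<close>

lemma dimension_of_quotient_by_constants:
  fixes R (structure)
  assumes R: "ring R" and I: "ideal I R" and g: "g \<in> ring_hom complex_ring R"
    and decomposition: "\<And>a. a \<in> carrier R \<Longrightarrow> \<exists>i\<in>I. \<exists>c. a = i \<oplus> g c"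
    and proper: "\<one> \<notin> I"
  shows "ring.dimension (R Quot I) n (range (\<lambda>c. I +> g c)) ((\<lambda>a. I +> a) ` carrier R) \<longleftrightarrow> n = 1"
proof -
  interpret C: field complex_ring by (rule complex_ring_field)
  interpret R: ring R by (rule R)
  interpret I: ideal I R by (rule I)
  interpret Q: ring "R Quot I" by (rule I.quotient_is_ring)
  have g_closed: "g c \<in> carrier R" for c
    using ring_hom_closed[OF g] by (simp add: complex_ring_def)
  have hom: "(\<lambda>c. I +> g c) \<in> ring_hom complex_ring (R Quot I)"
    using ring_hom_trans[OF g I.rcos_ring_hom] by (simp add: comp_def)
  have nontrivial: "\<one>\<^bsub>R Quot I\<^esub> \<noteq> \<zero>\<^bsub>R Quot I\<^esub>"
    using I.rcos_const_imp_mem[OF R.one_closed] proper by (auto simp: FactRing_def)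
  have "ring_hom_ring complex_ring (R Quot I) (\<lambda>c. I +> g c)"
    by (rule ring_hom_ringI2[OF C.ring_axioms Q.ring_axioms hom])
  from ring_hom_ring.img_is_subfield(2)[OF this C.carrier_is_subfield nontrivial]
  have K: "subfield (range (\<lambda>c. I +> g c)) (R Quot I)" by (simp add: complex_ring_def)
  have "I +> a \<in> range (\<lambda>c. I +> g c)" if a: "a \<in> carrier R" for a
  proof -
    obtain i c where ic: "i \<in> I" "a = i \<oplus> g c" using decomposition[OF a] by blast
    have "I +> a = (I +> i) <+> (I +> g c)"
      unfolding ic(2) using I.a_rcos_sum I.Icarr[OF ic(1)] g_closed by metis
    also have "I +> i = I +> \<zero>"
      using R.a_rcos_zero[OF I ic(1)] R.a_rcos_zero[OF I I.zero_closed] by simp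
    also have "(I +> \<zero>) <+> (I +> g c) = I +> g c"
      using I.a_rcos_sum[OF R.zero_closed g_closed[of c]] g_closed by simp
    finally show ?thesis by blast
  qed
  then have "(\<lambda>a. I +> a) ` carrier R = range (\<lambda>c. I +> g c)" using g_closed by blast
  then show ?thesis
    using Q.dimension_one[OF K] Q.dimension_is_inj[OF K] by metis
qed

text \<open>Modulo the two ideals every germ \<open>f\<close> is congruent to the constant \<open>f p\<close>, and \<open>1\<close> is not congruent to
  \<open>0\<close> because all elements of both ideals vanish at \<open>p\<close>.\<close>

lemma intersection_mult_eq_1:
  assumes X: "space_with_functions X" and p: "p \<in> points X" "p \<in> Y" "p \<in> Z"
    and expand: "\<And>f. f \<in> regular_near X p \<Longrightarrow> \<exists>e\<in>vanishing_near X p Z.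
      (\<lambda>x. f x - (f p + e x)) \<in> vanishing_near X p Y"
  shows "intersection_mult X Y Z p = 1"
proof -
  let ?N = "near_ring X p" and ?R = "local_ring X p" and ?g = "germ X p"
  note hom = germ_hom[OF X p(1)]
  have R: "ring ?R" using hom by (rule ring_hom_ring.axioms(2))
  have g_hom: "?g \<in> ring_hom ?N ?R"
    using ring_hom_ring.axioms(3)[OF hom] unfolding ring_hom_ring_axioms_def .
  have g_add: "?g (\<lambda>x. a x + b x) = ?g a \<oplus>\<^bsub>?R\<^esub> ?g b" if "a \<in> carrier ?N" "b \<in> carrier ?N" for a b
    using ring_hom_add[OF g_hom that] by (simp add: near_ring_simps)
  have const: "(\<lambda>_. c) \<in> carrier ?N" for c by (rule regular_near_const[OF X p(1)])
  let ?I = "ideal_of X p Y <+>\<^bsub>?R\<^esub> ideal_of X p Z"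
  have ideals: "ideal (ideal_of X p W) ?R" for W
    unfolding ideal_of_def
    by (rule ring_hom_ring.surj_image_ideal[OF hom germ_surj vanishing_near_ideal[OF X p(1)]])
  have I: "ideal ?I ?R" by (rule ring.add_ideals[OF R ideals ideals])
  have mem_I: "i \<in> ?I \<longleftrightarrow> (\<exists>a\<in>vanishing_near X p Y. \<exists>b\<in>vanishing_near X p Z. i = ?g a \<oplus>\<^bsub>?R\<^esub> ?g b)" for i
    unfolding set_add_def' ideal_of_def by blast
  have carrierD: "a \<in> vanishing_near X p W \<Longrightarrow> a \<in> carrier ?N" for a W
    unfolding vanishing_near_def by simp
  have "(\<lambda>c. \<lambda>_. c) \<in> ring_hom complex_ring ?N"
    by (rule ring_hom_memI) (simp_all add: const near_ring_simps, simp_all add: complex_ring_def)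
  from ring_hom_trans[OF this g_hom]
  have const_hom: "(\<lambda>c. ?g (\<lambda>_. c)) \<in> ring_hom complex_ring ?R" by (simp add: comp_def)
  have decomposition: "\<exists>i\<in>?I. \<exists>c. a = i \<oplus>\<^bsub>?R\<^esub> ?g (\<lambda>_. c)" if a: "a \<in> carrier ?R" for a
  proof -
    obtain f where f: "f \<in> carrier ?N" "a = ?g f" using a unfolding germ_surj by blast
    obtain e where e: "e \<in> vanishing_near X p Z" "(\<lambda>x. f x - (f p + e x)) \<in> vanishing_near X p Y"
      using expand[OF f(1)] by blast
    let ?d = "\<lambda>x. f x - (f p + e x)"
    have ce: "e \<in> carrier ?N" and cd: "?d \<in> carrier ?N" using e by (auto intro: carrierD)
    have "a = ?g (\<lambda>x. (?d x + e x) + f p)" unfolding f(2) by simp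
    also have "\<dots> = (?g ?d \<oplus>\<^bsub>?R\<^esub> ?g e) \<oplus>\<^bsub>?R\<^esub> ?g (\<lambda>_. f p)"
      unfolding g_add[OF regular_near_add[OF X cd ce] const] g_add[OF cd ce] ..
    finally show ?thesis using mem_I e by blast
  qed
  have proper: "\<one>\<^bsub>?R\<^esub> \<notin> ?I"
  proof
    assume "\<one>\<^bsub>?R\<^esub> \<in> ?I"
    then obtain a b where ab: "a \<in> vanishing_near X p Y" "b \<in> vanishing_near X p Z"
      "\<one>\<^bsub>?R\<^esub> = ?g a \<oplus>\<^bsub>?R\<^esub> ?g b"
      unfolding mem_I by blast
    have "?g (\<lambda>_. 1) = ?g (\<lambda>x. a x + b x)"
      using ab(3) ring_hom_one[OF g_hom] g_add[OF carrierD[OF ab(1)] carrierD[OF ab(2)]]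
      by (simp add: near_ring_simps)
    from germ_eq_value[OF X p(1) this] have "1 = a p + b p" by simp
    moreover have "a p = 0" "b p = 0" using ab p(2,3) unfolding vanishing_near_def by auto
    ultimately show False by simp
  qed
  have "ring.dimension (?R Quot ?I) n (range (\<lambda>c. ?I +>\<^bsub>?R\<^esub> ?g (\<lambda>_. c)))
      ((\<lambda>a. ?I +>\<^bsub>?R\<^esub> a) ` carrier ?R) \<longleftrightarrow> n = 1" for n
    by (rule dimension_of_quotient_by_constants[OF R I const_hom decomposition proper])
  then show ?thesis
    unfolding intersection_mult_def quot_dim_def Let_def by (simp add: one_enat_def)
qed

section \<open>Finiteness of the ramification locus\<close>

theorem theorem1p3:
  fixes S :: "'s fspace" and A :: "'a fspace" and \<pi> :: "'a \<Rightarrow> 's" and C :: "'a set"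
  assumes "irreducible_curve S" and "smooth_variety S"
    and "abelian_scheme A S \<pi>"
    and "irreducible_curve_in A C"
    and "\<forall>s\<in>points S. \<not> C \<subseteq> fiber A \<pi> s"
  shows "finite (\<Union>s\<in>points S. inter_sing A C (fiber A \<pi> s))"
proof -
  have A: "prevariety A" and S: "prevariety S" and \<pi>: "morphism A S \<pi>"
    using assms(3) unfolding abelian_scheme_def proper_morphism_def variety_def by blast+
  have swf: "space_with_functions A" using A unfolding prevariety_def by blast
  let ?T = "subtopology (zar A) C"
  have CA: "C \<subseteq> points A" using assms(4) by (rule curve_subset_points)
  then have top: "topspace ?T = C" by auto
  obtain V where V: "openin ?T V" "V \<noteq> {}" and
    expand: "\<And>p f. p \<in> V \<Longrightarrow> f \<in> regular_near A p \<Longrightarrow> \<exists>e\<in>regular_near A p.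
      (\<forall>u. \<pi> u = \<pi> p \<longrightarrow> e u = 0) \<and>
      (\<exists>W. openin (zar A) W \<and> p \<in> W \<and> (\<forall>u\<in>W \<inter> C. f u = f p + e u))"
    by (rule curve_generically_unramified[OF A S \<pi> assms(4,5)]) blast
  have VC: "V \<subseteq> C" using openin_subset[OF V(1)] top by simp
  have "intersection_mult A C (fiber A \<pi> s) p = 1" if p: "p \<in> V" "p \<in> fiber A \<pi> s" for p s
  proof (rule intersection_mult_eq_1[OF swf _ _ p(2)])
    have s: "\<pi> p = s" using p(2) unfolding fiber_def by blast
    show "p \<in> C" "p \<in> points A" using p(1) VC CA by auto
    fix f assume f: "f \<in> regular_near A p"
    obtain e W where e: "e \<in> regular_near A p" "\<forall>u. \<pi> u = \<pi> p \<longrightarrow> e u = 0"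
      and W: "openin (zar A) W" "p \<in> W" "\<forall>u\<in>W \<inter> C. f u = f p + e u"
      using expand[OF p(1) f] by blast
    have "e \<in> vanishing_near A p (fiber A \<pi> s)"
      unfolding vanishing_near_def fiber_def using e s W(1,2) by auto
    moreover have "(\<lambda>x. f x - (f p + e x)) \<in> regular_near A p"
      using f e(1) regular_near_const[OF swf regular_near_point[OF f]]
      by (intro regular_near_diff[OF swf] regular_near_add[OF swf])
    then have "(\<lambda>x. f x - (f p + e x)) \<in> vanishing_near A p C"
      unfolding vanishing_near_def using W by auto
    ultimately show "\<exists>e\<in>vanishing_near A p (fiber A \<pi> s).
        (\<lambda>x. f x - (f p + e x)) \<in> vanishing_near A p C" by blast
  qed
  then have "(\<Union>s\<in>points S. inter_sing A C (fiber A \<pi> s)) \<subseteq> C - V"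
    unfolding inter_sing_def by auto
  moreover have "finite (C - V)"
  proof (rule proper_closed_subset_of_curve_finite[OF A assms(4)])
    from closedin_diff[OF closedin_topspace V(1)] show "closedin ?T (C - V)" unfolding top .
    show "C - V \<noteq> C" using V(2) VC by blast
  qed
  ultimately show ?thesis by (rule finite_subset)
qed

end
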